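(* Let $G$ be a Borel graph of subexponential growth and of finite maximum degree $\Delta$. Then $\chi'_\mathsf{B}(G) \leq \Delta + 1$; that is, there is a Borel proper $(\Delta+1)$-edge-coloring $\phi \colon E(G) \to \{0,1,\ldots,\Delta\}$ (meaning $\phi^{-1}(i)$ is a Borel subset of $E(G)$ for every $i$).
   Context: A graph $G$ has vertex set $V(G)$ and edge set $E(G) \subseteq [V(G)]^2$, where $[X]^2$ is the set of $2$-element subsets of $X$. A graph is Borel if $V(G)$ is a standard Borel space and $E(G)$ is a Borel subset of $[V(G)]^2$. A proper $q$-edge-coloring is a map $\phi \colon E(G) \to \{0,\ldots,q-1\}$ with $\phi(e)\neq\phi(e')$ whenever distinct edges $e,e'$ share an endpoint. The Borel chromatic index $\chi'_\mathsf{B}(G)$ is the least $q \in \mathbb{N}$ such that $G$ has a proper $q$-edge-coloring $\phi$ with each $\phi^{-1}(i)$ Borel ($\infty$ if none exists). For a vertex $v$ and $R \in \mathbb{N}$, $N^R_G[v]$ denotes the set of vertices reachable from $v$ by a path of at most $R$ edges. A function $f\colon \mathbb{N}\to\mathbb{N}$ is subexponential if for every $\epsilon>0$ there is $R(\epsilon)\in\mathbb{N}$ such that $f(R) < \exp(\epsilon R)$ for all $R \geq R(\epsilon)$. $f$ bounds the growth of $G$ if $|N^R_G[v]| \leq f(R)$ for all $v \in V(G)$ and $R \in \mathbb{N}$. $G$ is of subexponential growth if its growth is bounded by some subexponential function. *)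

theory Defs
  imports
    "HOL-Analysis.Analysis"
    "HOL-Library.Ramsey"
    "HOL-Library.Extended_Nat"
begin

text \<open>
  A graph is given by a vertex space \<open>M :: 'a measure\<close> and an edge set \<open>E :: 'a set set\<close>.
  As usual for measurable spaces in HOL-Analysis, only \<open>space M\<close> (the vertex set) and \<open>sets M\<close>
  (its Borel sets) matter; the measure component of \<open>M\<close> plays no role.
\<close>

definition standard_borel_space :: "'a measure \<Rightarrow> bool" where
  "standard_borel_space M \<longleftrightarrow>
     (\<exists>X. completely_metrizable_space X \<and> separable_space X \<and>
          sets M = sigma_sets (topspace X) {U. openin X U})"

text \<open>
  The Borel structure on \<open>[V]\<^sup>2\<close> is the quotient of the off-diagonal part of \<open>V \<times> V\<close> under
  \<open>(x, y) \<mapsto> {x, y}\<close>. The family below is already a \<open>\<sigma>\<close>-algebra, see \<open>sets_pair_sets_space\<close>.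
\<close>

definition off_diagonal :: "'a measure \<Rightarrow> ('a \<times> 'a) measure" where
  "off_diagonal M = restrict_space (M \<Otimes>\<^sub>M M) {(x, y). x \<noteq> y}"

definition pair_sets_space :: "'a measure \<Rightarrow> 'a set measure" where
  "pair_sets_space M =
     sigma (nsets (space M) 2)
       {A. A \<subseteq> nsets (space M) 2 \<and>
           {(x, y) \<in> space (off_diagonal M). {x, y} \<in> A} \<in> sets (off_diagonal M)}"

lemma space_pair_sets_space: "space (pair_sets_space M) = nsets (space M) 2"
  unfolding pair_sets_space_def by (rule space_measure_of) auto

lemma sets_pair_sets_space:
  "sets (pair_sets_space M) =
     {A. A \<subseteq> nsets (space M) 2 \<and>
         {(x, y) \<in> space (off_diagonal M). {x, y} \<in> A} \<in> sets (off_diagonal M)}"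
    (is "_ = ?S")
proof -
  let ?O = "nsets (space M) 2" and ?D = "off_diagonal M"
  let ?P = "\<lambda>A. {(x, y) \<in> space ?D. {x, y} \<in> A}"
  have sp: "space ?D = {(x, y). x \<in> space M \<and> y \<in> space M \<and> x \<noteq> y}"
    by (auto simp: off_diagonal_def space_restrict_space space_pair_measure)
  have O: "{x, y} \<in> ?O" if "(x, y) \<in> space ?D" for x y
    using that by (auto simp: sp nsets_def)
  have "sigma_algebra ?O ?S"
    unfolding sigma_algebra_iff2
  proof (intro conjI ballI allI impI)
    show "?S \<subseteq> Pow ?O" by auto
    show "{} \<in> ?S" by simp
  next
    fix A assume "A \<in> ?S"
    moreover have "?P (?O - A) = space ?D - ?P A" using O by auto
    ultimately show "?O - A \<in> ?S"
      by (simp add: sets.compl_sets)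
  next
    fix A :: "nat \<Rightarrow> 'a set set" assume "range A \<subseteq> ?S"
    then have A: "A i \<subseteq> ?O" "?P (A i) \<in> sets ?D" for i by auto
    have "?P (\<Union>i. A i) = (\<Union>i. ?P (A i))" by auto
    then have "?P (\<Union>i. A i) \<in> sets ?D" using A(2) by simp
    then show "(\<Union>i. A i) \<in> ?S" using A(1) by blast
  qed
  then show ?thesis
    unfolding pair_sets_space_def
    by (subst sets_measure_of) (auto simp: sigma_algebra.sigma_sets_eq)
qed

definition borel_graph :: "'a measure \<Rightarrow> 'a set set \<Rightarrow> bool" where
  "borel_graph M E \<longleftrightarrow> standard_borel_space M \<and> E \<in> sets (pair_sets_space M)"

definition vertex_degree :: "'a set set \<Rightarrow> 'a \<Rightarrow> enat" where
  "vertex_degree E v = (let N = {u. {v, u} \<in> E} in if finite N then enat (card N) else \<infinity>)"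

definition max_degree :: "'a set \<Rightarrow> 'a set set \<Rightarrow> enat" where
  "max_degree V E = (SUP v\<in>V. vertex_degree E v)"

definition is_path :: "'a set set \<Rightarrow> 'a list \<Rightarrow> bool" where
  "is_path E p \<longleftrightarrow> p \<noteq> [] \<and> distinct p \<and> successively (\<lambda>x y. {x, y} \<in> E) p"

text \<open>A path with \<open>length p\<close> vertices has \<open>length p - 1\<close> edges.\<close>

definition neighborhood :: "'a set set \<Rightarrow> nat \<Rightarrow> 'a \<Rightarrow> 'a set" where
  "neighborhood E R v = {u. \<exists>p. is_path E p \<and> hd p = v \<and> last p = u \<and> length p - 1 \<le> R}"

definition subexponential :: "(nat \<Rightarrow> nat) \<Rightarrow> bool" where
  "subexponential f \<longleftrightarrow>
     (\<forall>\<epsilon>::real. \<epsilon> > 0 \<longrightarrow> (\<exists>R0. \<forall>R\<ge>R0. real (f R) < exp (\<epsilon> * real R)))"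

definition bounds_growth :: "(nat \<Rightarrow> nat) \<Rightarrow> 'a set \<Rightarrow> 'a set set \<Rightarrow> bool" where
  "bounds_growth f V E \<longleftrightarrow>
     (\<forall>v\<in>V. \<forall>R. finite (neighborhood E R v) \<and> card (neighborhood E R v) \<le> f R)"

definition subexponential_growth :: "'a set \<Rightarrow> 'a set set \<Rightarrow> bool" where
  "subexponential_growth V E \<longleftrightarrow> (\<exists>f. subexponential f \<and> bounds_growth f V E)"

text \<open>Colorings are total functions, but only their values on \<open>E\<close> matter.\<close>

definition proper_edge_coloring :: "'a set set \<Rightarrow> nat \<Rightarrow> ('a set \<Rightarrow> nat) \<Rightarrow> bool" where
  "proper_edge_coloring E q \<phi> \<longleftrightarrow>
     \<phi> \<in> E \<rightarrow> {..<q} \<and>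
     (\<forall>e\<in>E. \<forall>e'\<in>E. e \<noteq> e' \<and> e \<inter> e' \<noteq> {} \<longrightarrow> \<phi> e \<noteq> \<phi> e')"

definition borel_edge_coloring ::
    "'a measure \<Rightarrow> 'a set set \<Rightarrow> nat \<Rightarrow> ('a set \<Rightarrow> nat) \<Rightarrow> bool" where
  "borel_edge_coloring M E q \<phi> \<longleftrightarrow>
     proper_edge_coloring E q \<phi> \<and>
     (\<forall>i<q. \<phi> -` {i} \<inter> E \<in> sets (restrict_space (pair_sets_space M) E))"

text \<open>The infimum of the empty set in \<^typ>\<open>enat\<close> is \<open>\<infinity>\<close>.\<close>

definition borel_chromatic_index :: "'a measure \<Rightarrow> 'a set set \<Rightarrow> enat" where
  "borel_chromatic_index M E = Inf {enat q |q. \<exists>\<phi>. borel_edge_coloring M E q \<phi>}"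

end

theory Submission
  imports Defs
begin

text \<open>
  A partial coloring is extended by bounded local modifications. If an uncolored edge could not be
  colored by changing colors within distance \<open>R\<close>, then every Vizing chain starting there is
  long and can be cut at any of its first \<open>L\<close> edges, which moves the uncolored edge to the cut,
  where the next chain starts. A chain along which the original coloring is still intact can be traced
  back from its cut to its start up to boundedly many choices, and for this reason few cut sequences lead
  to a chain that meets an earlier one. So the number of cut sequences of length \<open>n\<close>, and hence
  the number of positions reached within distance \<open>O(L n)\<close>, is exponential in \<open>n\<close> with
  a base that tends to infinity with \<open>L\<close>, against subexponential growth.

  Thus \<open>R\<close> depends only on the growth bound and the degree. The vertices split into finitely many
  Borel sets whose points are more than \<open>2 R\<close> apart. Treating these sets one after the other, each
  stage modifies disjoint balls and is Borel because the least of countably many codes of a modification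
  is chosen. Lusin's separation theorem provides Borel functions that enumerate the neighbours of a
  vertex.
\<close>

section \<open>Analytic sets and Lusin separation\<close>

text \<open>Tracing back needs one fixed coloring, but every step changes the current one. Chains
  are therefore traced in the original coloring, which is correct while the two colors of the chain
  look the same there along its walk. A sequence whose last chain meets older changes is not
  extended, and such sequences must be a minority at each length. The ancestor \<open>k\<close>
  steps back is hit by at most \<open>O(L) * C ^ (k - 1)\<close> of its descendants at that depth,
  where \<open>C\<close> depends on the degree only, out of about \<open>q ^ k\<close> with
  \<open>L = O(q)\<close>. For \<open>k \<ge> 2\<close> this is a small fraction, but for
  \<open>k = 1\<close> every child may be hit. So a chain has to be kept off the changes of the step
  just made. Up to boundedly many exceptional cuts the fan does this: either it avoids both colors
  of the previous chain, so that swapping them along the previous walk is invisible to the new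
  chain; or it reuses both, and then the new chain stays in a Kempe component that the previous step
  did not touch.\<close>

definition cylinder :: "nat \<Rightarrow> (nat \<Rightarrow> nat) \<Rightarrow> (nat \<Rightarrow> nat) set" where
  "cylinder n s = {t. \<forall>i<n. t i = s i}"

lemma open_cylinder: "open (cylinder n s)"
proof -
  have "open ((\<lambda>t::nat \<Rightarrow> nat. t i) -` {s i})" for i
    by (rule open_vimage) (auto simp: open_discrete)
  moreover have "cylinder n s = (\<Inter>i\<in>{..<n}. (\<lambda>t. t i) -` {s i})"
    by (auto simp: cylinder_def)
  moreover have "open (\<Inter>i\<in>{..<n}. (\<lambda>t::nat \<Rightarrow> nat. t i) -` {s i})"
    using calculation(1) by (intro open_INT) auto
  ultimately show ?thesis
    by (simp only:)
qed

lemma open_contains_cylinder: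
  assumes "open U" "s \<in> U"
  obtains n where "cylinder n s \<subseteq> U"
proof -
  have "openin (product_topology (\<lambda>i::nat. euclidean) UNIV) U"
    using assms(1) by (simp only: euclidean_product_topology open_openin)
  from product_topology_open_contains_basis[OF this assms(2)]
  obtain X where X: "s \<in> (\<Pi>\<^sub>E i\<in>UNIV. X i)"
      "finite {i. X i \<noteq> topspace (euclidean :: nat topology)}" "(\<Pi>\<^sub>E i\<in>UNIV. X i) \<subseteq> U"
    by auto
  then obtain n where n: "\<And>i. X i \<noteq> UNIV \<Longrightarrow> i < n"
    using finite_nat_set_iff_bounded by auto
  have "t i \<in> X i" if "t \<in> cylinder n s" for t i
    using X(1) n[of i] that by (cases "X i = UNIV") (auto simp: cylinder_def PiE_iff)
  then have "cylinder n s \<subseteq> (\<Pi>\<^sub>E i\<in>UNIV. X i)"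
    by (auto simp: PiE_iff)
  with X(3) have "cylinder n s \<subseteq> U" by (rule order_trans[rotated])
  then show ?thesis by (rule that)
qed

lemma cylinder_mono: "m \<le> n \<Longrightarrow> cylinder n s \<subseteq> cylinder m s"
  by (auto simp: cylinder_def)

section \<open>Polish spaces as continuous images of Baire space\<close>

primrec guided_seq :: "(nat \<Rightarrow> 'x::metric_space) \<Rightarrow> (nat \<Rightarrow> nat) \<Rightarrow> nat \<Rightarrow> 'x" where
  "guided_seq d s 0 = d (s 0)"
| "guided_seq d s (Suc n) =
     (if dist (d (s (Suc n))) (guided_seq d s n) < (1/2) ^ n then d (s (Suc n))
      else guided_seq d s n)"

text \<open>Step \<open>n\<close> moves by less than \<open>(1/2) ^ n\<close> whatever the code. The
  right-hand side is the exact sum of these bounds, which lets the induction close.\<close>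

lemma dist_guided_seq: "dist (guided_seq d s (n + k)) (guided_seq d s n) \<le> 2 * (1/2) ^ n - 2 * (1/2) ^ (n + k)"
proof (induction k)
  case (Suc k)
  have "dist (guided_seq d s (n + Suc k)) (guided_seq d s (n + k)) \<le> (1/2) ^ (n + k)"
    by auto
  then show ?case
    using Suc dist_triangle[of "guided_seq d s (n + Suc k)" "guided_seq d s n" "guided_seq d s (n + k)"]
    by (simp add: power_add)
qed simp

lemma dist_guided_seq_le: "n \<le> m \<Longrightarrow> dist (guided_seq d s m) (guided_seq d s n) \<le> 2 * (1/2) ^ n"
proof -
  assume "n \<le> m"
  then obtain k where "m = n + k" using le_Suc_ex by blast
  moreover have "2 * (1/2) ^ n - 2 * (1/2) ^ (n + k) \<le> 2 * (1/2::real) ^ n" by simp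
  ultimately show ?thesis using dist_guided_seq[of d s n k] order_trans by blast
qed

lemma guided_seq_cong: "(\<And>i. i \<le> n \<Longrightarrow> s i = t i) \<Longrightarrow> guided_seq d s n = guided_seq d t n"
  by (induction n) auto

lemma convergent_guided_seq:
  fixes d :: "nat \<Rightarrow> 'x::complete_space"
  shows "convergent (guided_seq d s)"
proof -
  have "Cauchy (guided_seq d s)"
  proof (rule metric_CauchyI)
    fix e :: real assume "e > 0"
    then obtain N where N: "(1/2::real) ^ N < e / 4"
      using real_arch_pow_inv[of "e/4" "1/2"] by auto
    have "dist (guided_seq d s m) (guided_seq d s n) < e" if "m \<ge> N" "n \<ge> N" for m n
    proof -
      have "dist (guided_seq d s m) (guided_seq d s n)
          \<le> dist (guided_seq d s m) (guided_seq d s N) + dist (guided_seq d s n) (guided_seq d s N)"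
        by (rule dist_triangle2)
      also have "\<dots> \<le> 4 * (1/2) ^ N"
        using dist_guided_seq_le[OF that(1), of d s] dist_guided_seq_le[OF that(2), of d s] by linarith
      finally show ?thesis using N by linarith
    qed
    then show "\<exists>M. \<forall>m\<ge>M. \<forall>n\<ge>M. dist (guided_seq d s m) (guided_seq d s n) < e" by blast
  qed
  then show ?thesis by (simp add: Cauchy_convergent_iff)
qed

text \<open>The point coded by \<open>s\<close> is the limit of the dense points \<open>d (s n)\<close>, where a term that
  jumps too far is ignored; this makes every \<open>s\<close> a valid code.\<close>

lemma polish_image_of_baire:
  obtains h :: "(nat \<Rightarrow> nat) \<Rightarrow> 'x::{complete_space, second_countable_topology}"
  where "continuous_on UNIV h" "surj h"
proof -
  obtain D :: "'x set" where D: "countable D" "\<And>X. open X \<Longrightarrow> X \<noteq> {} \<Longrightarrow> \<exists>d\<in>D. d \<in> X"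
    using countable_dense_exists by blast
  have "D \<noteq> {}" using D(2)[of UNIV] by auto
  define d where "d = from_nat_into D"
  have rd: "range d = D"
    using D(1) \<open>D \<noteq> {}\<close> by (simp add: d_def range_from_nat_into)
  define h where "h s = lim (guided_seq d s)" for s
  have lim: "guided_seq d s \<longlonglongrightarrow> h s" for s
    using convergent_guided_seq[of d s] by (simp add: h_def convergent_LIMSEQ_iff)
  have near: "dist (h s) (guided_seq d s n) \<le> 2 * (1/2) ^ n" for s n
  proof (rule LIMSEQ_le_const2)
    show "(\<lambda>m. dist (guided_seq d s m) (guided_seq d s n)) \<longlonglongrightarrow> dist (h s) (guided_seq d s n)"
      by (intro tendsto_intros lim)
    show "\<exists>N. \<forall>m\<ge>N. dist (guided_seq d s m) (guided_seq d s n) \<le> 2 * (1/2) ^ n"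
      using dist_guided_seq_le by blast
  qed
  have "continuous_on UNIV h"
    unfolding continuous_on_def
  proof (intro ballI)
    fix s :: "nat \<Rightarrow> nat"
    show "(h \<longlongrightarrow> h s) (at s)"
    proof (rule tendstoI)
      fix e :: real assume "e > 0"
      then obtain N where N: "(1/2::real) ^ N < e / 4"
        using real_arch_pow_inv[of "e/4" "1/2"] by auto
      have "dist (h t) (h s) < e" if "t \<in> cylinder (Suc N) s" for t
      proof -
        have "guided_seq d t N = guided_seq d s N"
          using that by (intro guided_seq_cong) (auto simp: cylinder_def)
        then have "dist (h t) (h s) \<le> 4 * (1/2) ^ N"
          using near[of t N] near[of s N] dist_triangle2[of "h t" "h s" "guided_seq d s N"]
          by simp
        then show ?thesis using N by linarith
      qed
      moreover have "s \<in> cylinder (Suc N) s" by (simp add: cylinder_def)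
      ultimately show "\<forall>\<^sub>F t in at s. dist (h t) (h s) < e"
        unfolding eventually_at_topological using open_cylinder by blast
    qed
  qed
  moreover have "surj h"
  proof (rule surjI)
    fix x :: 'x
    \<comment> \<open>Accuracy \<open>(1/2) ^ (n + 2)\<close> makes consecutive chosen points closer
      than \<open>(1/2) ^ n\<close>, so that \<open>guided_seq\<close> ignores none of them.\<close>
    have "\<exists>k. dist (d k) x < (1/2) ^ (n + 2)" for n
    proof -
      have "\<exists>y\<in>D. y \<in> ball x ((1/2) ^ (n + 2))"
        by (rule D(2)) (auto simp: not_le)
      then obtain y where "y \<in> range d" "y \<in> ball x ((1/2) ^ (n + 2))"
        unfolding rd by blast
      then show ?thesis by (auto simp: dist_commute)
    qed
    then obtain s where s: "\<And>n. dist (d (s n)) x < (1/2) ^ (n + 2)" by metis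
    have "guided_seq d s n = d (s n)" for n
    proof (induction n)
      case (Suc n)
      have "dist (d (s (Suc n))) (d (s n)) \<le> dist (d (s (Suc n))) x + dist (d (s n)) x"
        by (rule dist_triangle2)
      also have "\<dots> < (1/2) ^ (Suc n + 2) + (1/2) ^ (n + 2)"
        using s[of "Suc n"] s[of n] by linarith
      also have "\<dots> \<le> (1/2) ^ n" by (simp add: power_add)
      finally show ?case using Suc by simp
    qed simp
    moreover have "(\<lambda>n. d (s n)) \<longlonglongrightarrow> x"
    proof (rule metric_LIMSEQ_I)
      fix e :: real assume "e > 0"
      then obtain N where N: "(1/2::real) ^ N < e"
        using real_arch_pow_inv[of "e" "1/2"] by auto
      have "dist (d (s n)) x < e" if "n \<ge> N" for n
      proof -
        have "(1/2::real) ^ (n + 2) \<le> (1/2) ^ N" using that by (intro power_decreasing) auto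
        then show ?thesis using s[of n] N by linarith
      qed
      then show "\<exists>no. \<forall>n\<ge>no. dist (d (s n)) x < e" by blast
    qed
    ultimately have "guided_seq d s \<longlonglongrightarrow> x" by presburger
    then show "h (SOME s. guided_seq d s \<longlonglongrightarrow> x) = x"
      using lim LIMSEQ_unique someI[of "\<lambda>s. guided_seq d s \<longlonglongrightarrow> x"] by blast
  qed
  ultimately show ?thesis using that by blast
qed

text \<open>A closed domain in Baire space, instead of all of it, covers the empty set and lets
  \<open>analytic_UN\<close> and \<open>analytic_INT\<close> encode side conditions in the
  domain.\<close>

definition analytic_set :: "'x::topological_space set \<Rightarrow> bool" where
  "analytic_set A \<longleftrightarrow>
     (\<exists>h D. continuous_on UNIV h \<and> closed (D :: (nat \<Rightarrow> nat) set) \<and> A = h ` D)"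

lemma analytic_image:
  assumes "analytic_set A" "continuous_on UNIV f"
  shows "analytic_set (f ` A)"
proof -
  obtain h and D :: "(nat \<Rightarrow> nat) set" where h: "continuous_on UNIV h" "closed D" "A = h ` D"
    using assms(1) by (auto simp: analytic_set_def)
  have "continuous_on UNIV (f \<circ> h)"
    using h(1) assms(2) by (intro continuous_on_compose) (auto intro: continuous_on_subset)
  then show ?thesis
    unfolding analytic_set_def using h by (intro exI[of _ "f \<circ> h"] exI[of _ D]) auto
qed

lemma analytic_closed:
  fixes A :: "'x::{complete_space, second_countable_topology} set"
  assumes "closed A"
  shows "analytic_set A"
proof -
  obtain h :: "(nat \<Rightarrow> nat) \<Rightarrow> 'x" where h: "continuous_on UNIV h" "surj h"
    by (rule polish_image_of_baire)
  have "closed (h -` A)" using h(1) assms by (simp add: closed_vimage)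
  then show ?thesis
    unfolding analytic_set_def using h
    by (intro exI[of _ h] exI[of _ "h -` A"]) (auto simp: surj_image_vimage_eq)
qed

lemma continuous_on_baire_reindex:
  "continuous_on UNIV (\<lambda>s::nat \<Rightarrow> nat. (\<lambda>n. s (r n)))"
  by (intro continuous_on_coordinatewise_then_product continuous_on_product_coordinates)

text \<open>The first entry of the argument selects the index, the remaining entries are the
  argument for that set.\<close>

lemma analytic_UN:
  fixes A :: "nat \<Rightarrow> 'x::topological_space set"
  assumes "\<And>i. analytic_set (A i)"
  shows "analytic_set (\<Union>i. A i)"
proof -
  have "\<exists>h D. continuous_on UNIV h \<and> closed (D :: (nat \<Rightarrow> nat) set) \<and> A i = h ` D" for i
    using assms[of i] by (simp add: analytic_set_def)
  then obtain h and D :: "nat \<Rightarrow> (nat \<Rightarrow> nat) set"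
    where h: "\<And>i. continuous_on UNIV (h i)" "\<And>i. closed (D i)" "\<And>i. A i = h i ` D i"
    by metis
  define tl' where "tl' s = (\<lambda>n. s (Suc n))" for s :: "nat \<Rightarrow> nat"
  define H where "H s = h (s 0) (tl' s)" for s
  define F where "F = {s. tl' s \<in> D (s 0)}"
  have tl': "continuous_on UNIV tl'"
    unfolding tl'_def by (rule continuous_on_baire_reindex)
  have op: "open {s::nat \<Rightarrow> nat. s 0 = i}" for i
    using open_cylinder[of 1 "\<lambda>_. i"] by (simp add: cylinder_def)
  have "continuous_on {s. s 0 = i} H" for i
  proof -
    have "continuous_on UNIV (\<lambda>s. h i (tl' s))"
      using continuous_on_compose2[OF h(1) tl', of i] by simp
    then have "continuous_on {s. s 0 = i} (\<lambda>s. h i (tl' s))"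
      by (rule continuous_on_subset) simp
    then show ?thesis
      by (rule continuous_on_eq) (auto simp: H_def)
  qed
  then have "continuous_on (\<Union>i. {s. s 0 = i}) H"
    by (intro continuous_on_open_UN op)
  moreover have "(\<Union>i. {s::nat \<Rightarrow> nat. s 0 = i}) = UNIV" by auto
  ultimately have H: "continuous_on UNIV H" by simp
  have "open (- F)"
  proof -
    have "- F = (\<Union>i. {s. s 0 = i} \<inter> tl' -` (- D i))" by (auto simp: F_def)
    then show ?thesis
      using op h(2) tl' by (auto intro!: open_UN open_Int open_vimage)
  qed
  then have "closed F" by (simp add: closed_def)
  moreover have "(\<Union>i. A i) = H ` F"
  proof safe
    fix x i assume "x \<in> A i"
    then obtain s where s: "s \<in> D i" "x = h i s" using h(3) by auto
    define t where "t = (\<lambda>n. case n of 0 \<Rightarrow> i | Suc n \<Rightarrow> s n)"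
    have "tl' t = s" "t 0 = i" by (auto simp: tl'_def t_def)
    then show "x \<in> H ` F" using s by (intro image_eqI[of _ _ t]) (auto simp: H_def F_def)
  next
    fix s assume "s \<in> F"
    then show "H s \<in> (\<Union>i. A i)" unfolding h(3) by (auto simp: H_def F_def)
  qed
  ultimately show ?thesis unfolding analytic_set_def using H by blast
qed

text \<open>One sequence codes a sequence of sequences; the domain requires all coded points to be
  equal, which is a closed condition in a Hausdorff space.\<close>

lemma analytic_INT:
  fixes A :: "nat \<Rightarrow> 'x::t2_space set"
  assumes "\<And>i. analytic_set (A i)"
  shows "analytic_set (\<Inter>i. A i)"
proof -
  have "\<exists>h D. continuous_on UNIV h \<and> closed (D :: (nat \<Rightarrow> nat) set) \<and> A i = h ` D" for i
    using assms[of i] by (simp add: analytic_set_def)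
  then obtain h and D :: "nat \<Rightarrow> (nat \<Rightarrow> nat) set"
    where h: "\<And>i. continuous_on UNIV (h i)" "\<And>i. closed (D i)" "\<And>i. A i = h i ` D i"
    by metis
  define pr where "pr i s = (\<lambda>n. s (prod_encode (i, n)))" for i and s :: "nat \<Rightarrow> nat"
  have pr: "continuous_on UNIV (pr i)" for i
    unfolding pr_def by (rule continuous_on_baire_reindex)
  define F where "F = {s. \<forall>i. pr i s \<in> D i \<and> h i (pr i s) = h 0 (pr 0 s)}"
  have c: "continuous_on UNIV (\<lambda>s. h i (pr i s))" for i
    using continuous_on_compose2[OF h(1) pr, of i] by simp
  have "F = (\<Inter>i. pr i -` D i \<inter> {s. h i (pr i s) = h 0 (pr 0 s)})" by (auto simp: F_def)
  moreover have "closed (pr i -` D i \<inter> {s. h i (pr i s) = h 0 (pr 0 s)})" for i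
    using pr h(2) c by (intro closed_Int closed_vimage closed_Collect_eq) auto
  ultimately have "closed F" by auto
  moreover have "(\<Inter>i. A i) = (\<lambda>s. h 0 (pr 0 s)) ` F"
  proof safe
    fix x assume x: "x \<in> (\<Inter>i. A i)"
    have "\<exists>s. s \<in> D i \<and> x = h i s" for i using x h(3) by auto
    then obtain s where s: "\<And>i. s i \<in> D i" "\<And>i. x = h i (s i)" by metis
    define t where "t k = (case prod_decode k of (i, n) \<Rightarrow> s i n)" for k
    have "pr i t = s i" for i by (auto simp: pr_def t_def)
    then have "x = h i (pr i t)" "pr i t \<in> D i" for i using s by simp_all
    then have "t \<in> F" "x = h 0 (pr 0 t)" by (simp_all add: F_def)
    then show "x \<in> (\<lambda>s. h 0 (pr 0 s)) ` F" using \<open>x = h 0 (pr 0 t)\<close> by blast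
  next
    fix s i assume "s \<in> F"
    then show "h 0 (pr 0 s) \<in> A i" unfolding h(3) by (auto simp: F_def) (metis imageI)
  qed
  ultimately show ?thesis unfolding analytic_set_def using c by blast
qed

lemma open_eq_UN_closed:
  fixes U :: "'x::metric_space set"
  assumes "open U"
  obtains C :: "nat \<Rightarrow> 'x set" where "\<And>n. closed (C n)" "U = (\<Union>n. C n)"
proof (cases "U = UNIV")
  case True
  then show ?thesis using that[of "\<lambda>_. UNIV"] by auto
next
  case False
  define C where "C n = {x. inverse (real (Suc n)) \<le> infdist x (- U)}" for n
  have "closed (C n)" for n
    unfolding C_def by (intro closed_Collect_le continuous_intros)
  moreover have "x \<in> U \<longleftrightarrow> (\<exists>n. x \<in> C n)" for x
  proof
    assume "x \<in> U"
    moreover have "closed (- U)" using assms by auto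
    ultimately have "infdist x (- U) > 0"
      using False by (subst infdist_pos_not_in_closed) auto
    then obtain n where "inverse (real (Suc n)) < infdist x (- U)"
      using reals_Archimedean by blast
    then show "\<exists>n. x \<in> C n" by (auto simp: C_def intro!: exI[of _ n])
  next
    assume "\<exists>n. x \<in> C n"
    then obtain n where n: "inverse (real (Suc n)) \<le> infdist x (- U)" by (auto simp: C_def)
    moreover have "inverse (real (Suc n)) > 0" by simp
    ultimately have "infdist x (- U) > 0" by linarith
    then show "x \<in> U" by (metis ComplI infdist_zero less_irrefl)
  qed
  then have "U = (\<Union>n. C n)" by blast
  ultimately show ?thesis using that[of C] by blast
qed

lemma borel_imp_analytic:
  fixes A :: "'x::{complete_space, second_countable_topology} set"
  assumes "A \<in> sets borel"
  shows "analytic_set A"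
proof -
  have "A \<in> sigma_sets UNIV {S. open S}"
    using assms by (simp add: borel_def)
  \<comment> \<open>Complements of analytic sets need not be analytic, so the induction carries the
    complement along.\<close>
  then have "analytic_set A \<and> analytic_set (- A)"
  proof induction
    case (Basic U)
    then have "open U" by simp
    then obtain C :: "nat \<Rightarrow> 'x set" where C: "\<And>n. closed (C n)" "U = (\<Union>n. C n)"
      by (rule open_eq_UN_closed) blast
    have "closed (- U)" using \<open>open U\<close> by auto
    then have "analytic_set (- U)" by (rule analytic_closed)
    moreover have "analytic_set U" unfolding C(2) by (intro analytic_UN analytic_closed C(1))
    ultimately show ?case by simp
  next
    case Empty
    then show ?case by (simp add: analytic_closed)
  next
    case (Compl a)
    then show ?case by (simp add: Compl_eq_Diff_UNIV[symmetric])
  next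
    case (Union a)
    then have "analytic_set (\<Union>i. a i)" "analytic_set (\<Inter>i. - a i)"
      by (intro analytic_UN analytic_INT, simp)+
    then show ?case by (simp add: Compl_UN)
  qed
  then show ?thesis ..
qed

section \<open>Separation by Borel sets\<close>

definition borel_separable :: "'x::topological_space set \<Rightarrow> 'x set \<Rightarrow> bool" where
  "borel_separable A B \<longleftrightarrow> (\<exists>C\<in>sets borel. A \<subseteq> C \<and> B \<inter> C = {})"

lemma borel_separable_UN:
  fixes A B :: "nat \<Rightarrow> 'x::topological_space set"
  assumes "\<And>i j. borel_separable (A i) (B j)"
  shows "borel_separable (\<Union>i. A i) (\<Union>j. B j)"
proof -
  obtain C where C: "\<And>i j. C i j \<in> sets borel" "\<And>i j. A i \<subseteq> C i j" "\<And>i j. B j \<inter> C i j = {}"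
    using assms unfolding borel_separable_def by metis
  have "(\<Union>i. \<Inter>j. C i j) \<in> sets borel" using C(1) by auto
  moreover have "(\<Union>i. A i) \<subseteq> (\<Union>i. \<Inter>j. C i j)" using C(2) by blast
  moreover have "(\<Union>j. B j) \<inter> (\<Union>i. \<Inter>j. C i j) = {}" using C(3) by blast
  ultimately show ?thesis unfolding borel_separable_def by blast
qed

text \<open>If the images of two cylinders are inseparable, so are those of some pair of one-digit
  extensions, since separability passes to countable unions. Following such pairs yields two points
  with disjoint open neighborhoods, and by continuity these separate the images of long
  cylinders.\<close>

theorem lusin_separation:
  fixes A B :: "'x::t2_space set"
  assumes "analytic_set A" "analytic_set B" "A \<inter> B = {}"
  shows "borel_separable A B"
proof (rule ccontr)
  assume neg: "\<not> borel_separable A B"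
  obtain h and D :: "(nat \<Rightarrow> nat) set" where h: "continuous_on UNIV h" "closed D" "A = h ` D"
    using assms(1) by (auto simp: analytic_set_def)
  obtain k and F :: "(nat \<Rightarrow> nat) set" where k: "continuous_on UNIV k" "closed F" "B = k ` F"
    using assms(2) by (auto simp: analytic_set_def)
  define P where "P n u \<longleftrightarrow>
    \<not> borel_separable (h ` (D \<inter> cylinder n (fst u))) (k ` (F \<inter> cylinder n (snd u)))" for n u
  define Q where "Q n u v \<longleftrightarrow> (\<exists>i j. v = ((fst u)(n := i), (snd u)(n := j)))"
    for n :: nat and u v :: "(nat \<Rightarrow> nat) \<times> (nat \<Rightarrow> nat)"
  have "\<exists>f. \<forall>n. P n (f n) \<and> Q n (f n) (f (Suc n))"
  proof (rule dependent_nat_choice)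
    show "\<exists>u. P 0 u" using neg by (auto simp: P_def cylinder_def h k)
  next
    fix u n assume "P n u"
    have cyl: "D \<inter> cylinder n s = (\<Union>i. D \<inter> cylinder (Suc n) (s(n := i)))" for s D
      by (auto simp: cylinder_def less_Suc_eq)
    have "\<exists>i j. \<not> borel_separable (h ` (D \<inter> cylinder (Suc n) ((fst u)(n := i))))
        (k ` (F \<inter> cylinder (Suc n) ((snd u)(n := j))))"
    proof (rule ccontr)
      assume "\<not> ?thesis"
      then have "borel_separable (\<Union>i. h ` (D \<inter> cylinder (Suc n) ((fst u)(n := i))))
          (\<Union>j. k ` (F \<inter> cylinder (Suc n) ((snd u)(n := j))))"
        by (intro borel_separable_UN) auto
      then show False
        using \<open>P n u\<close> unfolding P_def cyl[of D "fst u"] cyl[of F "snd u"] image_UN by blast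
    qed
    then show "\<exists>v. P (Suc n) v \<and> Q n u v"
      unfolding P_def Q_def by (metis fst_conv snd_conv)
  qed
  then obtain f where f: "\<And>n. P n (f n)" "\<And>n. Q n (f n) (f (Suc n))" by blast
  define S where "S i = fst (f (Suc i)) i" for i
  define T where "T i = snd (f (Suc i)) i" for i
  have agree: "(\<forall>i<n. fst (f n) i = S i \<and> snd (f n) i = T i)" for n
  proof (induction n)
    case (Suc n)
    obtain a b where "f (Suc n) = ((fst (f n))(n := a), (snd (f n))(n := b))"
      using f(2)[of n] by (auto simp: Q_def)
    then show ?case using Suc by (auto simp: S_def T_def less_Suc_eq)
  qed simp
  have "cylinder n (fst (f n)) = cylinder n S" "cylinder n (snd (f n)) = cylinder n T" for n
    using agree[of n] by (auto simp: cylinder_def)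
  then have ns: "\<not> borel_separable (h ` (D \<inter> cylinder n S)) (k ` (F \<inter> cylinder n T))" for n
    using f(1)[of n] by (simp add: P_def)
  have "S \<in> D"
  proof (rule ccontr)
    assume "S \<notin> D"
    then obtain n where "cylinder n S \<subseteq> - D"
      using open_contains_cylinder[of "- D" S] h(2) by auto
    then have "D \<inter> cylinder n S = {}" by auto
    then show False using ns[of n] by (auto simp: borel_separable_def)
  qed
  have "T \<in> F"
  proof (rule ccontr)
    assume "T \<notin> F"
    then obtain n where "cylinder n T \<subseteq> - F"
      using open_contains_cylinder[of "- F" T] k(2) by auto
    then have "F \<inter> cylinder n T = {}" by auto
    then show False using ns[of n] by (auto simp: borel_separable_def intro!: bexI[of _ UNIV])
  qed
  have "h S \<noteq> k T" using \<open>S \<in> D\<close> \<open>T \<in> F\<close> assms(3) h(3) k(3) by auto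
  then obtain U V where UV: "open U" "open V" "h S \<in> U" "k T \<in> V" "U \<inter> V = {}"
    using hausdorff by metis
  obtain n where n: "cylinder n S \<subseteq> h -` U"
    using open_contains_cylinder[of "h -` U" S] UV h(1) by (auto simp: open_vimage)
  obtain m where m: "cylinder m T \<subseteq> k -` V"
    using open_contains_cylinder[of "k -` V" T] UV k(1) by (auto simp: open_vimage)
  have "borel_separable (h ` (D \<inter> cylinder (max n m) S)) (k ` (F \<inter> cylinder (max n m) T))"
    unfolding borel_separable_def
  proof (intro bexI[of _ U] conjI)
    show "h ` (D \<inter> cylinder (max n m) S) \<subseteq> U"
      using n cylinder_mono[of n "max n m" S] by auto
    show "k ` (F \<inter> cylinder (max n m) T) \<inter> U = {}"
      using m cylinder_mono[of m "max n m" T] UV(5) by fastforce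
  qed (use UV in auto)
  then show False using ns by blast
qed

text \<open>Separating the points lying below and above a rational in coordinate \<open>i\<close> recovers the
  second coordinate of a Borel set with at most one point above each \<open>x\<close>.\<close>

lemma borel_uniformization:
  fixes P :: "('x::{complete_space, second_countable_topology} \<times> ('i::countable \<Rightarrow> real)) set"
  assumes P: "P \<in> sets borel" and single: "\<And>x y y'. (x, y) \<in> P \<Longrightarrow> (x, y') \<in> P \<Longrightarrow> y = y'"
  obtains h where "h \<in> borel_measurable borel" "\<And>x y. (x, y) \<in> P \<Longrightarrow> y = h x"
proof -
  define V where "V i q = {z :: 'x \<times> ('i \<Rightarrow> real). snd z i < real_of_rat q}" for i q
  have V: "V i q \<in> sets borel" for i q
  proof -
    have "continuous_on UNIV (\<lambda>z :: 'x \<times> ('i \<Rightarrow> real). snd z i)"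
      using continuous_on_compose2[OF continuous_on_product_coordinates continuous_on_snd[OF continuous_on_id]]
      by auto
    then have "open (V i q)" unfolding V_def by (intro open_Collect_less continuous_intros) auto
    then show ?thesis by simp
  qed
  have "borel_separable (fst ` (P \<inter> V i q)) (fst ` (P - V i q))" for i q
  proof (rule lusin_separation)
    show "analytic_set (fst ` (P \<inter> V i q))"
      using P V by (intro analytic_image borel_imp_analytic continuous_intros) auto
    show "analytic_set (fst ` (P - V i q))"
      using P V by (intro analytic_image borel_imp_analytic continuous_intros) auto
    show "fst ` (P \<inter> V i q) \<inter> fst ` (P - V i q) = {}"
      using single by auto (metis)
  qed
  then obtain C where C: "\<And>i q. C i q \<in> sets borel" "\<And>i q. fst ` (P \<inter> V i q) \<subseteq> C i q"
      "\<And>i q. fst ` (P - V i q) \<inter> C i q = {}"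
    unfolding borel_separable_def by metis
  have C_iff: "x \<in> C i q \<longleftrightarrow> y i < real_of_rat q" if "(x, y) \<in> P" for x y i q
    using C(2)[of i q] C(3)[of i q] that by (force simp: V_def)
  \<comment> \<open>Off the projection of \<open>P\<close> nothing is known of \<open>C\<close>, and
    the infimum may be infinite; hence extended reals.\<close>
  define g where "g i x = (INF q. if x \<in> C i q then ereal (real_of_rat q) else \<infinity>)" for i x
  have g: "g i \<in> borel_measurable borel" for i
  proof -
    note C(1)[measurable]
    show ?thesis unfolding g_def by measurable
  qed
  have g_eq: "g i x = ereal (y i)" if "(x, y) \<in> P" for x y i
  proof (rule antisym)
    show "ereal (y i) \<le> g i x"
      unfolding g_def using C_iff[OF that] by (intro INF_greatest) (auto simp: less_imp_le)
    show "g i x \<le> ereal (y i)"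
    proof (rule dense_ge)
      fix r assume r: "ereal (y i) < r"
      then obtain r' where r': "ereal (y i) < ereal r'" "ereal r' < r"
        using ereal_dense2 by blast
      then obtain q where q: "y i < real_of_rat q" "real_of_rat q < r'"
        using of_rat_dense[of "y i" r'] by auto
      have "g i x \<le> ereal (real_of_rat q)"
        unfolding g_def by (rule INF_lower2[of q]) (use C_iff[OF that] q in auto)
      also have "\<dots> < ereal r'" using q by simp
      also have "\<dots> < r" by fact
      finally show "g i x \<le> r" by simp
    qed
  qed
  define h where "h x = (\<lambda>i. real_of_ereal (g i x))" for x
  have "h \<in> borel_measurable borel"
    unfolding h_def using g by (intro measurable_coordinatewise_then_product) simp
  moreover have "y = h x" if "(x, y) \<in> P" for x y
    using g_eq[OF that] by (auto simp: h_def)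
  ultimately show ?thesis using that by blast
qed

section \<open>Neighbour functions of a Borel graph of bounded degree\<close>

lemma finite_disjoint_basis_sets:
  fixes A :: "'y::metric_space set" and U :: "nat \<Rightarrow> 'y set"
  assumes fin: "finite A" and basis: "\<And>y e. 0 < e \<Longrightarrow> \<exists>n. y \<in> U n \<and> U n \<subseteq> ball y e"
  obtains b where "\<And>y. y \<in> A \<Longrightarrow> y \<in> U (b y)"
    "\<And>y z. y \<in> A \<Longrightarrow> z \<in> A \<Longrightarrow> y \<noteq> z \<Longrightarrow> U (b y) \<inter> U (b z) = {}"
proof -
  \<comment> \<open>The 1 keeps the minimum defined when \<open>A\<close> has at most one
    point.\<close>
  define S where "S = insert 1 ((\<lambda>(y, z). dist y z) ` {(y, z) \<in> A \<times> A. y \<noteq> z})"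
  have fS: "finite S" "S \<noteq> {}"
    unfolding S_def using fin by (auto intro: finite_subset[of _ "A \<times> A"])
  have pos: "0 < Min S"
    using fS by (subst Min_gr_iff) (auto simp: S_def)
  have le: "Min S \<le> dist y z" if "y \<in> A" "z \<in> A" "y \<noteq> z" for y z
    using fS that by (intro Min_le) (auto simp: S_def)
  have "\<exists>n. y \<in> U n \<and> U n \<subseteq> ball y (Min S / 2)" for y
    using basis pos by simp
  then obtain b where b: "\<And>y. y \<in> U (b y)" "\<And>y. U (b y) \<subseteq> ball y (Min S / 2)" by metis
  have "U (b y) \<inter> U (b z) = {}" if "y \<in> A" "z \<in> A" "y \<noteq> z" for y z
  proof (rule ccontr)
    assume "U (b y) \<inter> U (b z) \<noteq> {}"
    then obtain u where "u \<in> ball y (Min S / 2)" "u \<in> ball z (Min S / 2)" using b by blast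
    then show False using le[OF that] dist_triangle2[of y z u] by (auto simp: dist_commute)
  qed
  then show ?thesis using that[of b] b(1) by blast
qed

text \<open>Points of degree exactly \<open>j\<close> (the maximum, after removing \<open>X\<close>) are handled by choosing
  \<open>j\<close> pairwise disjoint basic sets that each meet the section: the section is then listed by a unique
  tuple.\<close>

lemma borel_section_selectors_step:
  fixes P :: "('x::{complete_space, second_countable_topology} \<times> (nat \<Rightarrow> real)) set"
  assumes P: "P \<in> sets borel" and fin: "\<And>x. finite {y. (x, y) \<in> P}"
    and X: "{x. Suc j \<le> card {y. (x, y) \<in> P}} \<in> sets borel" (is "?X \<in> _")
  obtains F :: "nat \<Rightarrow> nat \<Rightarrow> 'x \<Rightarrow> (nat \<Rightarrow> real)"
  where "\<And>n i. F n i \<in> borel_measurable borel"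
    "\<And>x y. (x, y) \<in> P \<Longrightarrow> card {y. (x, y) \<in> P} = j \<Longrightarrow> \<exists>n i. y = F n i x"
    "{x. j \<le> card {y. (x, y) \<in> P}} \<in> sets borel"
proof -
  obtain \<B> :: "(nat \<Rightarrow> real) set set" where \<B>: "countable \<B>" "topological_basis \<B>"
    using ex_countable_basis by blast
  then have "\<B> \<noteq> {}" using topological_basisE[OF \<B>(2) open_UNIV UNIV_I] by blast
  define U where "U = from_nat_into \<B>"
  have rU: "range U = \<B>" using \<B> \<open>\<B> \<noteq> {}\<close> by (simp add: U_def range_from_nat_into)
  have oU: "open (U n)" for n using rU \<B>(2) topological_basis_open by blast
  have basis: "\<exists>n. y \<in> U n \<and> U n \<subseteq> ball y e" if "0 < e" for y e
  proof -
    have "y \<in> ball y e" using that by simp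
    then obtain B where "B \<in> \<B>" "y \<in> B" "B \<subseteq> ball y e" by (rule topological_basisE[OF \<B>(2) open_ball])
    then show ?thesis unfolding rU[symmetric] by blast
  qed
  define good where "good w \<longleftrightarrow> length w = j \<and> (\<forall>i<j. \<forall>k<j. i \<noteq> k \<longrightarrow> U (w ! i) \<inter> U (w ! k) = {})" for w
  \<comment> \<open>\<open>s\<close> codes \<open>j\<close> points of the section in one function on
    pairs, with point \<open>i\<close> in the basic set number \<open>w ! i\<close>. Excluding
    \<open>?X\<close> leaves no further points and the zero rows fix the remaining values, so
    \<open>s\<close> is unique.\<close>
  define Q where "Q w = {z :: 'x \<times> (nat \<times> nat \<Rightarrow> real). good w \<and> fst z \<notin> ?X \<and>
      (\<forall>i<j. (fst z, \<lambda>k. snd z (i, k)) \<in> P \<and> (\<lambda>k. snd z (i, k)) \<in> U (w ! i)) \<and>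
      (\<forall>i\<ge>j. \<forall>k. snd z (i, k) = 0)}" for w
  have coord: "continuous_on UNIV (\<lambda>z :: 'x \<times> (nat \<times> nat \<Rightarrow> real). snd z p)" for p
    using continuous_on_compose2[OF continuous_on_product_coordinates[of p] continuous_on_snd[OF continuous_on_id]]
    by auto
  have [measurable]: "(\<lambda>z :: 'x \<times> (nat \<times> nat \<Rightarrow> real). snd z p) \<in> borel_measurable borel" for p
    by (rule borel_measurable_continuous_onI[OF coord])
  have [measurable]: "(\<lambda>z :: 'x \<times> (nat \<times> nat \<Rightarrow> real). \<lambda>k. snd z (i, k)) \<in> borel_measurable borel" for i
    by (rule measurable_coordinatewise_then_product) measurable
  have [measurable]: "(fst :: 'x \<times> (nat \<times> nat \<Rightarrow> real) \<Rightarrow> 'x) \<in> borel_measurable borel"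
    by (intro borel_measurable_continuous_onI continuous_intros)
  have [measurable]: "(\<lambda>z :: 'x \<times> (nat \<times> nat \<Rightarrow> real). (fst z, \<lambda>k. snd z (i, k))) \<in> borel_measurable borel" for i
    by (rule borel_measurable_Pair) measurable
  have Q: "Q w \<in> sets borel" for w
  proof -
    note P[measurable] X[measurable]
    have [measurable]: "U n \<in> sets borel" for n using oU by simp
    have "Measurable.pred borel (\<lambda>z :: 'x \<times> (nat \<times> nat \<Rightarrow> real). good w \<and> fst z \<notin> ?X \<and>
      (\<forall>i. i < j \<longrightarrow> (fst z, \<lambda>k. snd z (i, k)) \<in> P \<and> (\<lambda>k. snd z (i, k)) \<in> U (w ! i)) \<and>
      (\<forall>i. i \<ge> j \<longrightarrow> (\<forall>k. snd z (i, k) = 0)))"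
      by measurable
    then show ?thesis
      unfolding Q_def pred_def by (simp add: space_borel)
  qed
  have memQ: "x \<notin> ?X" "card {y. (x, y) \<in> P} = j" "{y. (x, y) \<in> P} = (\<lambda>i k. s (i, k)) ` {..<j}"
    "inj_on (\<lambda>i k. s (i, k)) {..<j}" if "(x, s) \<in> Q w" for x s w
  proof -
    show nX: "x \<notin> ?X" using that by (simp add: Q_def)
    show inj: "inj_on (\<lambda>i k. s (i, k)) {..<j}"
    proof (rule inj_onI, rule ccontr)
      fix i i' assume *: "i \<in> {..<j}" "i' \<in> {..<j}" "(\<lambda>k. s (i, k)) = (\<lambda>k. s (i', k))" "i \<noteq> i'"
      then have "(\<lambda>k. s (i, k)) \<in> U (w ! i)" "(\<lambda>k. s (i', k)) \<in> U (w ! i')" "U (w ! i) \<inter> U (w ! i') = {}"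
        using that by (auto simp: Q_def good_def)
      then show False using * by auto
    qed
    have sub: "(\<lambda>i k. s (i, k)) ` {..<j} \<subseteq> {y. (x, y) \<in> P}" using that by (auto simp: Q_def)
    then have "j \<le> card {y. (x, y) \<in> P}"
      using card_mono[OF fin sub] card_image[OF inj] by simp
    then show c: "card {y. (x, y) \<in> P} = j" using nX by auto
    show "{y. (x, y) \<in> P} = (\<lambda>i k. s (i, k)) ` {..<j}"
      using card_subset_eq[OF fin sub] c card_image[OF inj] by simp
  qed
  have single: "s = s'" if "(x, s) \<in> Q w" "(x, s') \<in> Q w" for x s s' w
  proof
    fix p :: "nat \<times> nat"
    obtain i k where p: "p = (i, k)" by (cases p)
    show "s p = s' p"
    proof (cases "i < j")
      case True
      then have "(\<lambda>k. s (i, k)) \<in> (\<lambda>i k. s' (i, k)) ` {..<j}"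
        using memQ(3)[OF that(1)] memQ(3)[OF that(2)] by auto
      then obtain i' where i': "i' < j" "(\<lambda>k. s (i, k)) = (\<lambda>k. s' (i', k))" by auto
      have "i = i'"
      proof (rule ccontr)
        assume "i \<noteq> i'"
        then have "U (w ! i) \<inter> U (w ! i') = {}" using that(1) True i' by (auto simp: Q_def good_def)
        moreover have "(\<lambda>k. s (i, k)) \<in> U (w ! i)" "(\<lambda>k. s' (i', k)) \<in> U (w ! i')"
          using that True i' by (auto simp: Q_def)
        ultimately show False using i'(2) by auto
      qed
      then show ?thesis using i'(2) p by metis
    next
      case False
      then show ?thesis using that p by (auto simp: Q_def)
    qed
  qed
  have "\<exists>h. h \<in> borel_measurable borel \<and> (\<forall>x s. (x, s) \<in> Q w \<longrightarrow> s = h x)" for w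
  proof (rule borel_uniformization[OF Q single])
    fix h assume "h \<in> borel_measurable borel" "\<And>x s. (x, s) \<in> Q w \<Longrightarrow> s = h x"
    then show ?thesis by blast
  qed
  then have "\<forall>w. \<exists>h. h \<in> borel_measurable borel \<and> (\<forall>x s. (x, s) \<in> Q w \<longrightarrow> s = h x)" ..
  then obtain h where "\<forall>w. h w \<in> borel_measurable borel \<and> (\<forall>x s. (x, s) \<in> Q w \<longrightarrow> s = h w x)"
    by (rule choice[THEN exE])
  then have h: "\<And>w. h w \<in> borel_measurable borel" "\<And>w x s. (x, s) \<in> Q w \<Longrightarrow> s = h w x"
    by simp_all
  define F where "F n i x = (\<lambda>k. h (from_nat n) x (i, k))" for n i x
  show thesis
  proof (rule that)
    show "F n i \<in> borel_measurable borel" for n i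
    proof -
      note h(1)[measurable]
      have "(\<lambda>x. h (from_nat n) x p) \<in> borel_measurable borel" for p
        using measurable_compose[OF h(1) measurable_product_coordinates] by simp
      then show ?thesis unfolding F_def by (intro measurable_coordinatewise_then_product)
    qed
    have ex: "\<exists>w s. (x, s) \<in> Q w \<and> (\<forall>y. (x, y) \<in> P \<longrightarrow> (\<exists>i. y = (\<lambda>k. s (i, k))))"
      if c: "card {y. (x, y) \<in> P} = j" for x
    proof -
      obtain b where b: "\<And>y. (x, y) \<in> P \<Longrightarrow> y \<in> U (b y)"
          "\<And>y z. (x, y) \<in> P \<Longrightarrow> (x, z) \<in> P \<Longrightarrow> y \<noteq> z \<Longrightarrow> U (b y) \<inter> U (b z) = {}"
        using finite_disjoint_basis_sets[OF fin[of x], of U] basis by auto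
      obtain e where e: "bij_betw e {..<j} {y. (x, y) \<in> P}"
        using ex_bij_betw_nat_finite[OF fin[of x]] c by (auto simp: atLeast0LessThan)
      define s where "s = (\<lambda>(i, k). if i < j then e i k else 0)"
      define w where "w = map (\<lambda>i. b (e i)) [0..<j]"
      have si: "(\<lambda>k. s (i, k)) = e i" if "i < j" for i using that by (simp add: s_def)
      have eP: "(x, e i) \<in> P" if "i < j" for i using e that by (auto simp: bij_betw_def)
      have "good w"
        using e b(2)[OF eP eP] by (auto simp: good_def w_def bij_betw_def inj_on_def)
      then have "(x, s) \<in> Q w"
        using c si eP b(1)[OF eP] by (auto simp: Q_def w_def s_def)
      moreover have "\<exists>i. y = (\<lambda>k. s (i, k))" if "(x, y) \<in> P" for y
      proof -
        have "y \<in> e ` {..<j}" using that e by (simp add: bij_betw_def)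
        then obtain i where "i < j" "y = e i" by auto
        then show ?thesis using si[of i] by (intro exI[of _ i]) simp
      qed
      ultimately show ?thesis by blast
    qed
    then show "\<exists>n i. y = F n i x" if xy: "(x, y) \<in> P" and cj: "card {y. (x, y) \<in> P} = j" for x y
    proof -
      obtain w s where ws: "(x, s) \<in> Q w" "\<forall>y. (x, y) \<in> P \<longrightarrow> (\<exists>i. y = (\<lambda>k. s (i, k)))"
        using ex[OF cj] by meson
      then obtain i where "y = (\<lambda>k. s (i, k))" using xy by meson
      then have "y = F (to_nat w) i x" using h(2)[OF ws(1)] by (simp add: F_def)
      then show ?thesis by (intro exI)
    qed
    \<comment> \<open>A projection of a Borel set is only analytic in general. That of
      \<open>Q w\<close> is Borel because it is the preimage of \<open>Q w\<close> under the
      measurable map that pairs \<open>x\<close> with its only possible partner.\<close>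
    have "{x. j \<le> card {y. (x, y) \<in> P}} = ?X \<union> (\<Union>w. {x. (x, h w x) \<in> Q w})"
    proof (intro equalityI subsetI)
      fix x assume "x \<in> {x. j \<le> card {y. (x, y) \<in> P}}"
      then show "x \<in> ?X \<union> (\<Union>w. {x. (x, h w x) \<in> Q w})"
      proof (cases "x \<in> ?X")
        case False
        then have "card {y. (x, y) \<in> P} = j" using \<open>x \<in> {x. j \<le> card {y. (x, y) \<in> P}}\<close> by auto
        from ex[OF this] obtain w s where "(x, s) \<in> Q w" by (elim exE conjE)
        then have "(x, h w x) \<in> Q w" using h(2) by fastforce
        then show ?thesis by blast
      qed simp
    qed (use memQ(2) in force)
    moreover have "{x. (x, h w x) \<in> Q w} \<in> sets borel" for w
    proof -
      have "(\<lambda>x. (x, h w x)) \<in> borel_measurable borel"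
        by (intro borel_measurable_Pair h(1)) simp
      from measurable_sets[OF this Q] show ?thesis by (simp add: vimage_def)
    qed
    ultimately show "{x. j \<le> card {y. (x, y) \<in> P}} \<in> sets borel"
      using X by auto
  qed
qed

text \<open>Downward induction on the size of the section, from \<open>Suc d\<close>, which no
  section reaches: the step for size \<open>j\<close> returns the Borel set that the step for
  \<open>j - 1\<close> presupposes.\<close>

lemma borel_section_selectors:
  fixes P :: "('x::{complete_space, second_countable_topology} \<times> (nat \<Rightarrow> real)) set"
  assumes P: "P \<in> sets borel" and fin: "\<And>x. finite {y. (x, y) \<in> P}"
    and card: "\<And>x. card {y. (x, y) \<in> P} \<le> d"
  obtains F :: "nat \<Rightarrow> 'x \<Rightarrow> (nat \<Rightarrow> real)"
  where "\<forall>n. F n \<in> borel_measurable borel" "\<forall>x y. (x, y) \<in> P \<longrightarrow> (\<exists>n. y = F n x)"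
proof -
  have X: "{x. Suc d - j \<le> card {y. (x, y) \<in> P}} \<in> sets borel" for j
  proof (induction j)
    case 0
    have "{x. Suc d \<le> card {y. (x, y) \<in> P}} = {}" using card by (auto simp: not_less_eq_eq)
    then show ?case by simp
  next
    case (Suc j)
    show ?case
    proof (cases "j \<le> d")
      case True
      then have "Suc d - j = Suc (Suc d - Suc j)" by simp
      then have "{x. Suc (Suc d - Suc j) \<le> card {y. (x, y) \<in> P}} \<in> sets borel" using Suc by simp
      then show ?thesis by (rule borel_section_selectors_step[OF P fin])
    next
      case False
      then show ?thesis using Suc by simp
    qed
  qed
  have "\<exists>F :: nat \<Rightarrow> nat \<Rightarrow> 'x \<Rightarrow> nat \<Rightarrow> real. (\<forall>n i. F n i \<in> borel_measurable borel) \<and>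
      (\<forall>x y. (x, y) \<in> P \<longrightarrow> card {y. (x, y) \<in> P} = j \<longrightarrow> (\<exists>n i. y = F n i x))"
    if "j \<le> d" for j
  proof -
    have "Suc d - (d - j) = Suc j" using that by simp
    then have "{x. Suc j \<le> card {y. (x, y) \<in> P}} \<in> sets borel" using X[of "d - j"] by metis
    then show ?thesis
    proof (rule borel_section_selectors_step[OF P fin])
      fix F :: "nat \<Rightarrow> nat \<Rightarrow> 'x \<Rightarrow> nat \<Rightarrow> real"
      assume "\<And>n i. F n i \<in> borel_measurable borel"
        "\<And>x y. (x, y) \<in> P \<Longrightarrow> card {y. (x, y) \<in> P} = j \<Longrightarrow> \<exists>n i. y = F n i x"
      then show ?thesis by (intro exI[of _ F] conjI allI impI)
    qed
  qed
  then have "\<forall>j. \<exists>F :: nat \<Rightarrow> nat \<Rightarrow> 'x \<Rightarrow> nat \<Rightarrow> real. j \<le> d \<longrightarrow> (\<forall>n i. F n i \<in> borel_measurable borel) \<and>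
      (\<forall>x y. (x, y) \<in> P \<longrightarrow> card {y. (x, y) \<in> P} = j \<longrightarrow> (\<exists>n i. y = F n i x))" by blast
  then obtain F :: "nat \<Rightarrow> nat \<Rightarrow> nat \<Rightarrow> 'x \<Rightarrow> nat \<Rightarrow> real"
    where "\<forall>j. j \<le> d \<longrightarrow> (\<forall>n i. F j n i \<in> borel_measurable borel) \<and>
      (\<forall>x y. (x, y) \<in> P \<longrightarrow> card {y. (x, y) \<in> P} = j \<longrightarrow> (\<exists>n i. y = F j n i x))"
    by (rule choice[THEN exE])
  note all_F = this
  then have F: "F j n i \<in> borel_measurable borel" if "j \<le> d" for j n i
    using that by simp
  have F': "\<exists>n i. y = F (card {y. (x, y) \<in> P}) n i x" if "(x, y) \<in> P" for x y
    using all_F[THEN spec, THEN mp, OF card[of x]] that by blast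
  \<comment> \<open>The \<open>min\<close> keeps \<open>G m\<close> measurable when the decoded size
    exceeds \<open>d\<close>, where nothing is known of \<open>F\<close>.\<close>
  define G where "G m = (case from_nat m of (j, n, i) \<Rightarrow> F (min j d) n i)" for m
  have "G m \<in> borel_measurable borel" for m
    using F by (auto simp: G_def split: prod.splits)
  moreover have "\<exists>m. y = G m x" if xy: "(x, y) \<in> P" for x y
  proof -
    obtain n i where "y = F (card {y. (x, y) \<in> P}) n i x"
      using F'[OF xy] by blast
    then have "y = G (to_nat (card {y. (x, y) \<in> P}, n, i)) x"
      using card[of x] by (simp add: G_def min_def)
    then show ?thesis by blast
  qed
  ultimately show ?thesis using that by blast
qed

text \<open>A point is sent to its distances from a countable dense set, which is isometric for the
  sup distance. By completeness the image consists of all sup limits of images of dense points, a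
  countable combination of closed conditions on coordinates.\<close>

lemma standard_borel_embedding:
  assumes "standard_borel_space M"
  obtains g :: "'a \<Rightarrow> nat \<Rightarrow> real"
  where "inj_on g (space M)" "g ` space M \<in> sets borel"
    "\<forall>A. A \<in> sets M \<longleftrightarrow> (\<exists>B\<in>sets borel. A = g -` B \<inter> space M)"
proof -
  obtain X :: "'a topology" where X: "completely_metrizable_space X" "separable_space X"
      and sM: "sets M = sigma_sets (topspace X) {U. openin X U}"
    using assms by (auto simp: standard_borel_space_def)
  obtain V d where V: "Metric_space V d" "Metric_space.mcomplete V d" "X = Metric_space.mtopology V d"
    using X(1) by (auto simp: completely_metrizable_space_def)
  interpret Metric_space V d by (rule V(1))
  have tX: "topspace X = V" by (simp add: V(3))
  have openX: "openin X U \<Longrightarrow> U \<in> sets M" for U unfolding sM by blast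
  have spM: "space M = V"
  proof
    show "space M \<subseteq> V"
    proof -
      have "{U. openin X U} \<subseteq> Pow V" using openin_subset tX by auto
      moreover have "space M \<in> sigma_sets V {U. openin X U}" using sets.top[of M] sM tX by simp
      ultimately show ?thesis by (rule sigma_sets_into_sp)
    qed
    show "V \<subseteq> space M"
      by (rule sets.sets_into_space, rule openX) (simp add: V(3))
  qed
  obtain C where C: "countable C" "C \<subseteq> V" "X closure_of C = V"
    using X(2) by (auto simp: separable_space_def tX)
  show thesis
  proof (cases "V = {}")
    case True
    have "sets M = {{}}"
    proof -
      have "A = {}" if "A \<in> sets M" for A using sets.sets_into_space[OF that] True spM by simp
      then show ?thesis by auto
    qed
    then show ?thesis using that[of "\<lambda>_ _. 0"] True spM by auto
  next
    case False
    then have "C \<noteq> {}" using C(3) by auto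
    define p where "p = from_nat_into C"
    have rp: "range p = C" using C(1) \<open>C \<noteq> {}\<close> by (simp add: p_def range_from_nat_into)
    have pV: "p i \<in> V" for i using rp C(2) by auto
    have dense: "\<exists>i. d x (p i) < r" if "x \<in> V" "r > 0" for x r
    proof -
      have "x \<in> mtopology closure_of C" using C(3) V(3) that by simp
      then obtain y where "y \<in> C" "y \<in> mball x r" using \<open>r > 0\<close> unfolding metric_closure_of by blast
      then show ?thesis using rp by auto
    qed
    define g where "g x i = d x (p i)" for x i
    have inj: "inj_on g (space M)"
    proof (rule inj_onI, rule ccontr)
      fix x y assume xy: "x \<in> space M" "y \<in> space M" "g x = g y" "x \<noteq> y"
      then have "d x y > 0" using spM by (simp add: mdist_pos_eq)
      then obtain i where "d x (p i) < d x y / 2" using dense[of x "d x y / 2"] xy spM by auto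
      moreover have "d y (p i) = d x (p i)" using fun_cong[OF xy(3), of i] by (simp add: g_def)
      ultimately show False
        using triangle[of x "p i" y] xy spM pV by (simp add: commute)
    qed
    \<comment> \<open>\<open>\<Inter>j. K k i j\<close> is the closed sup ball of radius
      \<open>inverse (Suc k)\<close> around \<open>g (p i)\<close>.\<close>
    define K where "K k i j = {z :: nat \<Rightarrow> real. \<bar>z j - d (p i) (p j)\<bar> \<le> inverse (real (Suc k))}" for k i j
    have "closed (K k i j)" for k i j
      unfolding K_def
      by (intro closed_Collect_le continuous_intros continuous_on_product_coordinates)
    then have "(\<Inter>k. \<Union>i. \<Inter>j. K k i j) \<in> sets borel" by auto
    moreover have "g ` V = (\<Inter>k. \<Union>i. \<Inter>j. K k i j)"
    proof (intro equalityI subsetI)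
      fix z assume "z \<in> g ` V"
      then obtain x where x: "x \<in> V" "z = g x" by auto
      have "\<exists>i. \<forall>j. z \<in> K k i j" for k
      proof -
        obtain i where i: "d x (p i) < inverse (real (Suc k))" using dense[OF x(1)] by force
        have "\<bar>d x (p j) - d (p i) (p j)\<bar> \<le> inverse (real (Suc k))" for j
          using triangle[of x "p i" "p j"] triangle[of "p i" x "p j"] x pV i
          by (simp only: commute[of "p i" x] pV x abs_le_iff) linarith
        then have "z \<in> K k i j" for j
          by (simp add: K_def g_def x(2))
        then show ?thesis by blast
      qed
      then show "z \<in> (\<Inter>k. \<Union>i. \<Inter>j. K k i j)" by simp
    next
      fix z assume "z \<in> (\<Inter>k. \<Union>i. \<Inter>j. K k i j)"
      then have "\<forall>k. \<exists>i. \<forall>j. z \<in> K k i j" by simp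
      then obtain i where "\<forall>k j. z \<in> K k (i k) j" by (rule choice[THEN exE])
      then have i: "z \<in> K k (i k) j" for k j by simp
      then have zi: "\<bar>z j - d (p (i k)) (p j)\<bar> \<le> inverse (real (Suc k))" for k j
        by (simp add: K_def)
      have dd: "d (p (i k)) (p (i l)) \<le> inverse (real (Suc k)) + inverse (real (Suc l))" for k l
        using zi[of "i l" k] zi[of "i l" l] pV by (simp add: abs_le_iff)
      have "MCauchy (\<lambda>k. p (i k))"
        unfolding MCauchy_def
      proof (intro conjI allI impI)
        show "range (\<lambda>k. p (i k)) \<subseteq> V" using pV by auto
        fix e :: real assume "e > 0"
        then obtain N where N: "inverse (real (Suc N)) < e / 2" using reals_Archimedean[of "e/2"] by auto
        have inv: "inverse (real (Suc n)) \<le> inverse (real (Suc N))" if "N \<le> n" for n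
          using that by (simp add: field_simps)
        have "d (p (i n)) (p (i n')) < e" if "N \<le> n" "N \<le> n'" for n n'
          using dd[of n n'] inv[OF that(1)] inv[OF that(2)] N by linarith
        then show "\<exists>N. \<forall>n n'. N \<le> n \<longrightarrow> N \<le> n' \<longrightarrow> d (p (i n)) (p (i n')) < e" by blast
      qed
      then obtain x where x: "limitin mtopology (\<lambda>k. p (i k)) x sequentially"
        using V(2) by (auto simp: mcomplete_def)
      then have xV: "x \<in> V" and lim: "\<And>e. e > 0 \<Longrightarrow> \<exists>N. \<forall>n\<ge>N. p (i n) \<in> V \<and> d (p (i n)) x < e"
        by (auto simp: limit_metric_sequentially)
      have "z j = g x j" for j
      proof (rule ccontr)
        assume "z j \<noteq> g x j"
        define e where "e = \<bar>z j - g x j\<bar> / 2"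
        have "e > 0" using \<open>z j \<noteq> g x j\<close> by (simp add: e_def)
        obtain N where N: "\<forall>n\<ge>N. d (p (i n)) x < e" using lim[OF \<open>e > 0\<close>] by auto
        obtain N' where N': "inverse (real (Suc N')) < e" using reals_Archimedean[OF \<open>e > 0\<close>] by auto
        define n where "n = max N N'"
        have "inverse (real (Suc n)) \<le> inverse (real (Suc N'))" by (simp add: n_def field_simps)
        then have "\<bar>z j - d (p (i n)) (p j)\<bar> < e" using zi[of j n] N' by linarith
        moreover have "d (p (i n)) x < e" using N by (simp add: n_def)
        then have "\<bar>d (p (i n)) (p j) - d x (p j)\<bar> < e"
          using triangle[of x "p (i n)" "p j"] triangle[of "p (i n)" x "p j"] xV pV
          by (simp add: commute)
        moreover have "\<bar>z j - d x (p j)\<bar>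
            \<le> \<bar>z j - d (p (i n)) (p j)\<bar> + \<bar>d (p (i n)) (p j) - d x (p j)\<bar>" by linarith
        moreover have "a < y / 2 \<Longrightarrow> b < y / 2 \<Longrightarrow> y \<le> a + b \<Longrightarrow> False" for a b y :: real
          by linarith
        ultimately show False unfolding e_def g_def by blast
      qed
      then show "z \<in> g ` V" using xV by auto
    qed
    ultimately have range: "g ` space M \<in> sets borel" by (simp add: spM)
    have ball: "{x \<in> V. d x (p i) < q} = mball (p i) q" for i q
      using pV by (auto simp: commute)
    have gm: "g \<in> measurable M borel"
    proof (rule measurable_coordinatewise_then_product)
      fix i
      show "(\<lambda>x. g x i) \<in> borel_measurable M"
      proof (subst borel_measurable_iff_less, intro allI)
        fix q
        have "{x \<in> space M. g x i < q} = mball (p i) q" by (simp add: g_def spM ball)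
        then show "{x \<in> space M. g x i < q} \<in> sets M" using openX by (simp add: V(3))
      qed
    qed
    have "A \<in> sets M \<longleftrightarrow> (\<exists>B\<in>sets borel. A = g -` B \<inter> space M)" for A
    proof
      assume "A \<in> sets M"
      then have "A \<in> sigma_sets V {U. openin X U}" using sM tX by simp
      then show "\<exists>B\<in>sets borel. A = g -` B \<inter> space M"
      proof induction
        case (Basic U)
        then have U: "openin mtopology U" by (simp add: V(3))
        define I where "I = {(i, q :: rat). mball (p i) (of_rat q) \<subseteq> U}"
        define B where "B = (\<Union>(i, q)\<in>I. {z :: nat \<Rightarrow> real. z i < of_rat q})"
        have "open {z :: nat \<Rightarrow> real. z i < of_rat q}" for i and q :: rat
          by (intro open_Collect_less continuous_intros continuous_on_product_coordinates)
        then have "open B" unfolding B_def by (intro open_UN) auto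
        moreover have "U = g -` B \<inter> space M"
        proof (intro equalityI subsetI)
          fix x assume x: "x \<in> U"
          then have xV: "x \<in> V" using U openin_subset by fastforce
          obtain r where r: "r > 0" "mball x r \<subseteq> U" using U x by (auto simp: openin_mtopology)
          obtain i where i: "d x (p i) < r / 2" using dense[OF xV, of "r/2"] r by auto
          obtain q :: rat where q: "d x (p i) < of_rat q" "of_rat q < r / 2"
            using of_rat_dense[OF i] by auto
          have "mball (p i) (of_rat q) \<subseteq> mball x r"
            using i q xV pV by (intro mball_subset) (auto simp: commute)
          then have "(i, q) \<in> I" using r by (auto simp: I_def)
          moreover have "g x \<in> {z. z i < of_rat q}" using q(1) by (simp add: g_def)
          ultimately have "g x \<in> B" unfolding B_def by blast
          then show "x \<in> g -` B \<inter> space M" using xV by (simp add: spM)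
        next
          fix x assume "x \<in> g -` B \<inter> space M"
          then show "x \<in> U" using pV by (auto simp: B_def I_def g_def spM commute subset_iff)
        qed
        ultimately show ?case using borel_open by blast
      next
        case Empty
        show ?case by (rule bexI[of _ "{}"]) auto
      next
        case (Compl A)
        then obtain B where "B \<in> sets borel" "A = g -` B \<inter> space M" by auto
        then show ?case by (intro bexI[of _ "- B"]) (auto simp: spM)
      next
        case (Union A)
        then have "\<forall>i. \<exists>B\<in>sets borel. A i = g -` B \<inter> space M" by blast
        then obtain B where "\<forall>i. B i \<in> sets borel \<and> A i = g -` B i \<inter> space M" by metis
        then show ?case by (intro bexI[of _ "\<Union>i. B i"]) auto
      qed
    next
      assume "\<exists>B\<in>sets borel. A = g -` B \<inter> space M"
      then show "A \<in> sets M" using gm by (auto simp: measurable_sets)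
    qed
    then show ?thesis using that inj range by blast
  qed
qed


text \<open>Later \<open>F\<close> is a ball without its centre: some \<open>U n\<close> then
  contains the centre and no other point of the ball, which starts the construction of separated
  sets.\<close>

lemma standard_borel_separating_sets:
  assumes "standard_borel_space M"
  obtains U :: "nat \<Rightarrow> 'a set"
  where "\<forall>n. U n \<in> sets M"
    "\<forall>x\<in>space M. \<forall>F. finite F \<longrightarrow> F \<subseteq> space M \<longrightarrow> x \<notin> F \<longrightarrow> (\<exists>n. x \<in> U n \<and> F \<inter> U n = {})"
proof -
  obtain g :: "'a \<Rightarrow> nat \<Rightarrow> real" where inj: "inj_on g (space M)"
    and sM: "\<forall>A. A \<in> sets M \<longleftrightarrow> (\<exists>B\<in>sets borel. A = g -` B \<inter> space M)"
    using standard_borel_embedding[OF assms] by metis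
  obtain \<B> :: "(nat \<Rightarrow> real) set set" where \<B>: "countable \<B>" "topological_basis \<B>"
    using ex_countable_basis by blast
  then have ne: "\<B> \<noteq> {}" using topological_basisE[OF \<B>(2) open_UNIV UNIV_I] by blast
  define U where "U n = g -` from_nat_into \<B> n \<inter> space M" for n
  have "from_nat_into \<B> n \<in> sets borel" for n
    using topological_basis_open[OF \<B>(2) from_nat_into[OF ne]] by simp
  then have 1: "\<forall>n. U n \<in> sets M" using sM unfolding U_def by blast
  have "\<exists>n. x \<in> U n \<and> F \<inter> U n = {}" if x: "x \<in> space M" and F: "finite F" "F \<subseteq> space M" "x \<notin> F" for x F
  proof -
    have "open (- (g ` F))" using F(1) by (intro open_Compl finite_imp_closed finite_imageI)
    moreover have "g x \<in> - (g ` F)" using inj x F by (auto simp: inj_on_def)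
    ultimately obtain B where B: "B \<in> \<B>" "g x \<in> B" "B \<subseteq> - (g ` F)"
      by (rule topological_basisE[OF \<B>(2)])
    obtain n where n: "B = from_nat_into \<B> n" using from_nat_into_surj[OF \<B>(1) B(1)] by metis
    show ?thesis using B x by (intro exI[of _ n]) (auto simp: U_def n)
  qed
  then have 2: "\<forall>x\<in>space M. \<forall>F. finite F \<longrightarrow> F \<subseteq> space M \<longrightarrow> x \<notin> F \<longrightarrow> (\<exists>n. x \<in> U n \<and> F \<inter> U n = {})"
    by blast
  show ?thesis by (rule that[OF 1 2])
qed

text \<open>The edge relation is carried to a Borel set of pairs in
  \<open>nat \<Rightarrow> real\<close>, where the sections have selectors, and these are pulled
  back. A function stays at \<open>x\<close> where its selector gives no neighbour, so iterates
  never leave the component of \<open>x\<close>.\<close>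

lemma borel_graph_neighbour_functions:
  assumes M: "standard_borel_space M" and E: "E \<in> sets (pair_sets_space M)"
    and deg: "\<And>x. finite {u. {x, u} \<in> E}" "\<And>x. card {u. {x, u} \<in> E} \<le> d"
  obtains f :: "nat \<Rightarrow> 'a \<Rightarrow> 'a"
  where "\<forall>n. f n \<in> measurable M M" "\<forall>n x. f n x = x \<or> {x, f n x} \<in> E"
    "\<forall>x y. {x, y} \<in> E \<longrightarrow> (\<exists>n. y = f n x)"
    "Measurable.pred (M \<Otimes>\<^sub>M M) (\<lambda>(x, y). {x, y} \<in> E)"
    "Measurable.pred (M \<Otimes>\<^sub>M M) (\<lambda>(x, y). x = y)"
proof -
  obtain g :: "'a \<Rightarrow> nat \<Rightarrow> real" where inj: "inj_on g (space M)" and rng: "g ` space M \<in> sets borel"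
    and all_sM: "\<forall>A. A \<in> sets M \<longleftrightarrow> (\<exists>B\<in>sets borel. A = g -` B \<inter> space M)"
    by (rule standard_borel_embedding[OF M])
  note sM = all_sM[rule_format]
  have g[measurable]: "g \<in> measurable M borel"
    using sM by (intro measurableI) auto
  have EV: "x \<in> space M \<and> y \<in> space M \<and> x \<noteq> y" if "{x, y} \<in> E" for x y
    using E that by (auto simp: sets_pair_sets_space nsets_def doubleton_eq_iff card_2_iff subset_iff)
  define Ep where "Ep = {(x, y) \<in> space M \<times> space M. {x, y} \<in> E}"
  have eq[measurable]: "Measurable.pred (M \<Otimes>\<^sub>M M) (\<lambda>z. fst z = snd z)"
  proof -
    have "Measurable.pred (M \<Otimes>\<^sub>M M) (\<lambda>z. \<forall>i. g (fst z) i = g (snd z) i)"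
    proof -
      have [measurable]: "(\<lambda>x. g x i) \<in> borel_measurable M" for i
        using measurable_compose[OF g measurable_product_coordinates] by simp
      show ?thesis by measurable
    qed
    moreover have "(\<forall>i. g (fst z) i = g (snd z) i) \<longleftrightarrow> fst z = snd z" if "z \<in> space (M \<Otimes>\<^sub>M M)" for z
      using that inj by (auto simp: space_pair_measure inj_on_def fun_eq_iff)
    ultimately show ?thesis by (subst measurable_cong[symmetric]) auto
  qed
  have Ep: "Ep \<in> sets (M \<Otimes>\<^sub>M M)"
  proof -
    have D: "{(x, y). x \<noteq> y} \<inter> space (M \<Otimes>\<^sub>M M) \<in> sets (M \<Otimes>\<^sub>M M)"
    proof -
      have "{z \<in> space (M \<Otimes>\<^sub>M M). \<not> fst z = snd z} \<in> sets (M \<Otimes>\<^sub>M M)"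
        using eq by (simp add: pred_def[symmetric] del: eq) measurable
      moreover have "{z \<in> space (M \<Otimes>\<^sub>M M). \<not> fst z = snd z} = {(x, y). x \<noteq> y} \<inter> space (M \<Otimes>\<^sub>M M)" by auto
      ultimately show ?thesis by simp
    qed
    have "{(x, y) \<in> space (off_diagonal M). {x, y} \<in> E} \<in> sets (off_diagonal M)"
      using E by (simp add: sets_pair_sets_space)
    moreover have "{(x, y) \<in> space (off_diagonal M). {x, y} \<in> E} = Ep"
      using EV by (auto simp: Ep_def off_diagonal_def space_restrict_space space_pair_measure)
    ultimately show ?thesis
      unfolding off_diagonal_def by (simp add: sets_restrict_space_iff[OF D])
  qed
  \<comment> \<open>Every Borel set of \<open>M\<close> is a preimage under \<open>g\<close>; this
    passes to rectangles and from them to the sets they generate.\<close>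
  have pair: "\<exists>B\<in>sets (borel \<Otimes>\<^sub>M borel). A = {(x, y) \<in> space M \<times> space M. (g x, g y) \<in> B}"
    if "A \<in> sets (M \<Otimes>\<^sub>M M)" for A
  proof -
    have "A \<in> sigma_sets (space M \<times> space M) {a \<times> b |a b. a \<in> sets M \<and> b \<in> sets M}"
      using that by (simp add: sets_pair_measure)
    then show ?thesis
    proof induction
      case (Basic A)
      then obtain a b where ab: "A = a \<times> b" "a \<in> sets M" "b \<in> sets M" by blast
      then obtain a' b' where "a' \<in> sets borel" "b' \<in> sets borel" "a = g -` a' \<inter> space M" "b = g -` b' \<inter> space M"
        using sM by meson
      then show ?case using ab by (intro bexI[of _ "a' \<times> b'"]) auto
    next
      case Empty
      show ?case by (rule bexI[of _ "{}"]) auto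
    next
      case (Compl A)
      then obtain B where B: "B \<in> sets (borel \<Otimes>\<^sub>M borel)" "A = {(x, y) \<in> space M \<times> space M. (g x, g y) \<in> B}"
        by blast
      have "space (borel \<Otimes>\<^sub>M borel) - B \<in> sets (borel \<Otimes>\<^sub>M borel)" using B(1) by (rule sets.compl_sets)
      then show ?case using B(2) by (intro bexI[of _ "space (borel \<Otimes>\<^sub>M borel) - B"]) (auto simp: space_pair_measure)
    next
      case (Union A)
      then have "\<forall>i. \<exists>B. B \<in> sets (borel \<Otimes>\<^sub>M borel) \<and> A i = {(x, y) \<in> space M \<times> space M. (g x, g y) \<in> B}"
        by blast
      then obtain B where "\<forall>i. B i \<in> sets (borel \<Otimes>\<^sub>M borel) \<and> A i = {(x, y) \<in> space M \<times> space M. (g x, g y) \<in> B i}"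
        by (rule choice[THEN exE])
      then show ?case by (intro bexI[of _ "\<Union>i. B i"]) auto
    qed
  qed
  obtain B where B: "B \<in> sets (borel \<Otimes>\<^sub>M borel)" "Ep = {(x, y) \<in> space M \<times> space M. (g x, g y) \<in> B}"
    using pair[OF Ep] by blast
  \<comment> \<open>Off the image of \<open>g\<close> the set \<open>B\<close> is arbitrary; cutting
    it down makes every section finite.\<close>
  define P where "P = B \<inter> (g ` space M \<times> g ` space M)"
  have P: "P \<in> sets (borel \<Otimes>\<^sub>M borel)" using B(1) rng by (auto simp: P_def)
  then have P': "P \<in> sets borel" unfolding borel_prod .
  have P_iff: "(g x, g y) \<in> P \<longleftrightarrow> {x, y} \<in> E" if "x \<in> space M" "y \<in> space M" for x y
  proof -
    have "(g x, g y) \<in> P \<longleftrightarrow> (x, y) \<in> Ep" using that by (auto simp: P_def B(2))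
    then show ?thesis using that by (simp add: Ep_def)
  qed
  have sect: "{y. (g x, y) \<in> P} = g ` {u. {x, u} \<in> E}" if "x \<in> space M" for x
    using P_iff[OF that] EV by (auto simp: P_def)
  have fin: "finite {y. (z, y) \<in> P} \<and> card {y. (z, y) \<in> P} \<le> d" for z
  proof (cases "z \<in> g ` space M")
    case True
    then obtain x where x: "x \<in> space M" "z = g x" by blast
    then show ?thesis
      using sect[OF x(1)] deg[of x] by (auto intro: card_image_le[THEN order_trans])
  next
    case False
    then have "{y. (z, y) \<in> P} = {}" by (auto simp: P_def)
    then show ?thesis by simp
  qed
  obtain F :: "nat \<Rightarrow> (nat \<Rightarrow> real) \<Rightarrow> nat \<Rightarrow> real" where "\<forall>n. F n \<in> borel_measurable borel" "\<forall>x y. (x, y) \<in> P \<longrightarrow> (\<exists>n. y = F n x)"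
    by (rule borel_section_selectors[OF P' conjunct1[OF fin] conjunct2[OF fin]])
  note F = this[rule_format]
  define f where "f n x = (if x \<in> space M \<and> (g x, F n (g x)) \<in> P then the_inv_into (space M) g (F n (g x)) else x)" for n x
  have gf: "f n x \<in> space M \<and> g (f n x) = F n (g x)" if "x \<in> space M" "(g x, F n (g x)) \<in> P" for n x
    using that f_the_inv_into_f[OF inj] the_inv_into_into[OF inj _ order_refl] by (auto simp: f_def P_def)
  show thesis
  proof (rule that)
    show "\<forall>n. f n \<in> measurable M M"
    proof (intro allI measurableI)
      fix n
      show "f n x \<in> space M" if "x \<in> space M" for x
        using gf[of x n] that by (cases "(g x, F n (g x)) \<in> P") (auto simp: f_def)
      fix A assume "A \<in> sets M"
      then obtain B where B: "B \<in> sets borel" "A = g -` B \<inter> space M" using sM by blast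
      note F(1)[measurable] P[measurable] B(1)[measurable]
      have "f n -` A \<inter> space M =
          {x \<in> space M. (g x, F n (g x)) \<in> P \<and> F n (g x) \<in> B \<or> (g x, F n (g x)) \<notin> P \<and> g x \<in> B}"
      proof (intro equalityI subsetI)
        fix x assume "x \<in> f n -` A \<inter> space M"
        then show "x \<in> {x \<in> space M. (g x, F n (g x)) \<in> P \<and> F n (g x) \<in> B \<or> (g x, F n (g x)) \<notin> P \<and> g x \<in> B}"
          using gf[of x n] by (cases "(g x, F n (g x)) \<in> P") (auto simp: B(2) f_def)
      next
        fix x assume "x \<in> {x \<in> space M. (g x, F n (g x)) \<in> P \<and> F n (g x) \<in> B \<or> (g x, F n (g x)) \<notin> P \<and> g x \<in> B}"
        then show "x \<in> f n -` A \<inter> space M"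
          using gf[of x n] by (cases "(g x, F n (g x)) \<in> P") (auto simp: B(2) f_def)
      qed
      moreover have "Measurable.pred M
          (\<lambda>x. (g x, F n (g x)) \<in> P \<and> F n (g x) \<in> B \<or> (g x, F n (g x)) \<notin> P \<and> g x \<in> B)"
        by measurable
      ultimately show "f n -` A \<inter> space M \<in> sets M" by (simp add: pred_def)
    qed
    show "\<forall>n x. f n x = x \<or> {x, f n x} \<in> E"
    proof (intro allI)
      fix n x
      show "f n x = x \<or> {x, f n x} \<in> E"
      proof (cases "x \<in> space M \<and> (g x, F n (g x)) \<in> P")
        case True
        then show ?thesis using gf[of x n] P_iff[of x "f n x"] by simp
      qed (auto simp: f_def)
    qed
    show "\<forall>x y. {x, y} \<in> E \<longrightarrow> (\<exists>n. y = f n x)"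
    proof (intro allI impI)
      fix x y assume xy: "{x, y} \<in> E"
      have V: "x \<in> space M" "y \<in> space M" using EV[OF xy] by auto
      then have "(g x, g y) \<in> P" using P_iff xy by simp
      then obtain n where n: "g y = F n (g x)" using F(2) by blast
      then have "f n x = y"
        using \<open>(g x, g y) \<in> P\<close> V the_inv_into_f_f[OF inj V(2)] by (simp add: f_def)
      then show "\<exists>n. y = f n x" by blast
    qed
    have "{z \<in> space (M \<Otimes>\<^sub>M M). (\<lambda>(x, y). {x, y} \<in> E) z} = Ep"
      by (auto simp: Ep_def space_pair_measure)
    then show "Measurable.pred (M \<Otimes>\<^sub>M M) (\<lambda>(x, y). {x, y} \<in> E)"
      using Ep by (simp add: pred_def)
    show "Measurable.pred (M \<Otimes>\<^sub>M M) (\<lambda>(x, y). x = y)"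
      using eq by (simp add: case_prod_beta)
  qed
qed

section \<open>Partial edge-colorings, Vizing fans and alternating walks\<close>

locale bounded_graph =
  fixes E :: "'a set set" and d :: nat
  assumes edgeE': "e \<in> E \<Longrightarrow> \<exists>x y. x \<noteq> y \<and> e = {x, y}"
    and finite_nbrs: "finite {u. {v, u} \<in> E}"
    and card_nbrs: "card {u. {v, u} \<in> E} \<le> d"
begin

definition nbrs :: "'a \<Rightarrow> 'a set" where
  "nbrs v = {u. {v, u} \<in> E}"

lemma mem_nbrs: "u \<in> nbrs v \<longleftrightarrow> {v, u} \<in> E"
  by (simp add: nbrs_def)

lemma no_loop: "{v, v} \<notin> E"
  using edgeE'[of "{v, v}"] by auto

lemma finite_nbrs' [simp]: "finite (nbrs v)" and card_nbrs': "card (nbrs v) \<le> d"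
  using finite_nbrs card_nbrs by (auto simp: nbrs_def)

definition pcol :: "('a set \<Rightarrow> nat option) \<Rightarrow> bool" where
  "pcol \<phi> \<longleftrightarrow> (\<forall>e i. \<phi> e = Some i \<longrightarrow> e \<in> E \<and> i \<le> d) \<and>
     (\<forall>x y z i. \<phi> {x, y} = Some i \<longrightarrow> \<phi> {x, z} = Some i \<longrightarrow> y = z)"

definition miss :: "('a set \<Rightarrow> nat option) \<Rightarrow> 'a \<Rightarrow> nat \<Rightarrow> bool" where
  "miss \<phi> x i \<longleftrightarrow> i \<le> d \<and> (\<forall>y. \<phi> {x, y} \<noteq> Some i)"

lemma pcol_edge: "pcol \<phi> \<Longrightarrow> \<phi> e = Some i \<Longrightarrow> e \<in> E"
  by (auto simp: pcol_def)

lemma pcol_le: "pcol \<phi> \<Longrightarrow> \<phi> e = Some i \<Longrightarrow> i \<le> d"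
  by (auto simp: pcol_def)

lemma pcol_unique: "pcol \<phi> \<Longrightarrow> \<phi> {x, y} = Some i \<Longrightarrow> \<phi> {x, z} = Some i \<Longrightarrow> y = z"
  by (auto simp: pcol_def)

lemma pcol_unique': "pcol \<phi> \<Longrightarrow> \<phi> {y, x} = Some i \<Longrightarrow> \<phi> {z, x} = Some i \<Longrightarrow> y = z"
  using pcol_unique[of \<phi> x y i z] by (simp add: insert_commute)

lemma missD: "miss \<phi> x i \<Longrightarrow> \<phi> {x, y} \<noteq> Some i" "miss \<phi> x i \<Longrightarrow> \<phi> {y, x} \<noteq> Some i"
  by (auto simp: miss_def insert_commute)

lemma miss_ex:
  assumes "pcol \<phi>"
  obtains i where "miss \<phi> x i"
proof -
  have "(\<lambda>u. the (\<phi> {x, u})) ` nbrs x \<noteq> {..d}"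
  proof
    assume "(\<lambda>u. the (\<phi> {x, u})) ` nbrs x = {..d}"
    then have "card {..d} \<le> card (nbrs x)" by (metis card_image_le finite_nbrs')
    then show False using card_nbrs'[of x] by simp
  qed
  moreover have "{..d} \<subseteq> (\<lambda>u. the (\<phi> {x, u})) ` nbrs x" if none: "\<And>i. \<not> miss \<phi> x i"
  proof
    fix i assume "i \<in> {..d}"
    then obtain y where "\<phi> {x, y} = Some i" using none[of i] by (auto simp: miss_def)
    then show "i \<in> (\<lambda>u. the (\<phi> {x, u})) ` nbrs x"
      using pcol_edge[OF assms] by (intro image_eqI[of _ _ y]) (auto simp: mem_nbrs)
  qed
  moreover have "card ((\<lambda>u. the (\<phi> {x, u})) ` nbrs x) \<le> d"
    using card_image_le[OF finite_nbrs'[of x], of "\<lambda>u. the (\<phi> {x, u})"] card_nbrs'[of x] by simp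
  then have "\<not> {..d} \<subseteq> (\<lambda>u. the (\<phi> {x, u})) ` nbrs x"
    using card_mono[of "(\<lambda>u. the (\<phi> {x, u})) ` nbrs x" "{..d}"] by auto
  ultimately show ?thesis using that by blast
qed

text \<open>An endpoint of an uncolored edge sees at most \<open>d - 1\<close> of the
  \<open>d + 1\<close> colors, so at least two are missing. This frees a color at the fan centre
  that differs from one of the previous chain.\<close>

lemma miss_ex_other:
  assumes "pcol \<phi>" "{x, y} \<in> E" "\<phi> {x, y} = None"
  obtains i where "miss \<phi> x i" "i \<noteq> b"
proof -
  have y: "y \<in> nbrs x" using assms by (simp add: mem_nbrs)
  define C where "C = insert b ((\<lambda>u. the (\<phi> {x, u})) ` (nbrs x - {y}))"
  have "card (nbrs x - {y}) < card (nbrs x)" using y by (intro card_Diff1_less) auto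
  then have "card ((\<lambda>u. the (\<phi> {x, u})) ` (nbrs x - {y})) < d"
    using card_image_le[of "nbrs x - {y}" "\<lambda>u. the (\<phi> {x, u})"] card_nbrs'[of x] by simp
  then have "card C \<le> d"
    unfolding C_def by (intro order_trans[OF card_insert_le_m1]) (auto simp: card_insert_if)
  moreover have "finite C" by (simp add: C_def)
  ultimately have "\<not> {..d} \<subseteq> C" using card_mono[of C "{..d}"] by auto
  then obtain i where i: "i \<le> d" "i \<notin> C" by auto
  have "\<phi> {x, u} \<noteq> Some i" for u
  proof
    assume u: "\<phi> {x, u} = Some i"
    then have "u \<in> nbrs x" using pcol_edge[OF assms(1)] by (auto simp: mem_nbrs)
    moreover have "u \<noteq> y" using u assms(3) by auto
    ultimately show False using i(2) u by (force simp: C_def)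
  qed
  then have "miss \<phi> x i" using i(1) by (simp add: miss_def)
  then show ?thesis using that i(2) by (auto simp: C_def)
qed

text \<open>The elementary move: the uncolored edge walks from \<open>uv\<close> to \<open>vw\<close>. Shifting a fan or a Kempe chain
  is a sequence of such moves.\<close>

lemma pcol_move:
  assumes "pcol \<phi>" "{u, v} \<in> E" "\<phi> {u, v} = None" "miss \<phi> u c" "\<phi> {v, w} = Some c"
  shows "pcol (\<phi>({u, v} := Some c, {v, w} := None))" (is "pcol ?\<psi>")
proof -
  have uv: "u \<noteq> v" using assms(2) no_loop by auto
  have "?\<psi> e = Some i \<Longrightarrow> e \<in> E \<and> i \<le> d" for e i
    using assms(1,2,4) by (auto simp: pcol_def miss_def split: if_splits)
  moreover have "y = z" if *: "?\<psi> {x, y} = Some i" "?\<psi> {x, z} = Some i" for x y z i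
  proof (cases "{x, y} = {u, v}")
    case True
    then have [simp]: "i = c" using *(1) by (auto split: if_splits)
    show ?thesis
    proof (cases "{x, z} = {u, v}")
      case True
      then show ?thesis using \<open>{x, y} = {u, v}\<close> by (auto simp: doubleton_eq_iff)
    next
      case False
      then have z: "\<phi> {x, z} = Some c" "{x, z} \<noteq> {v, w}" using *(2) by (auto split: if_splits)
      have "x = u \<or> x = v" using \<open>{x, y} = {u, v}\<close> by (auto simp: doubleton_eq_iff)
      then show ?thesis using missD[OF assms(4)] z pcol_unique[OF assms(1,5)] by auto
    qed
  next
    case False
    then have y: "\<phi> {x, y} = Some i" "{x, y} \<noteq> {v, w}" using *(1) by (auto split: if_splits)
    show ?thesis
    proof (cases "{x, z} = {u, v}")
      case True
      then have [simp]: "i = c" using *(2) by (auto split: if_splits)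
      have "x = u \<or> x = v" using True by (auto simp: doubleton_eq_iff)
      then show ?thesis using missD[OF assms(4)] y pcol_unique[OF assms(1,5)] by auto
    next
      case False
      then have "\<phi> {x, z} = Some i" using *(2) by (auto split: if_splits)
      then show ?thesis using y pcol_unique[OF assms(1)] by blast
    qed
  qed
  ultimately show ?thesis unfolding pcol_def by blast
qed

lemma pcol_fill:
  assumes "pcol \<phi>" "{u, v} \<in> E" "miss \<phi> u c" "miss \<phi> v c"
  shows "pcol (\<phi>({u, v} := Some c))" (is "pcol ?\<psi>")
proof -
  have "?\<psi> e = Some i \<Longrightarrow> e \<in> E \<and> i \<le> d" for e i
    using assms by (auto simp: pcol_def miss_def split: if_splits)
  moreover have "y = z" if *: "?\<psi> {x, y} = Some i" "?\<psi> {x, z} = Some i" for x y z i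
  proof -
    have "\<phi> {x, t} \<noteq> Some c" if "x = u \<or> x = v" for t
      using that assms missD by blast
    then show ?thesis
      using * pcol_unique[OF assms(1), of x y i z]
      by (auto simp: doubleton_eq_iff split: if_splits)
  qed
  ultimately show ?thesis unfolding pcol_def by blast
qed

section \<open>Alternating walks and the recovery of their starts\<close>

definition awalk :: "('a set \<Rightarrow> nat option) \<Rightarrow> nat \<Rightarrow> nat \<Rightarrow> (nat \<Rightarrow> 'a) \<Rightarrow> nat \<Rightarrow> bool" where
  "awalk \<phi> c c' p n \<longleftrightarrow> (\<forall>i<n. \<phi> {p i, p (Suc i)} = Some (if even i then c else c'))"

lemma awalkD: "awalk \<phi> c c' p n \<Longrightarrow> i < n \<Longrightarrow> \<phi> {p i, p (Suc i)} = Some (if even i then c else c')"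
  by (auto simp: awalk_def)

lemma awalk_mono: "awalk \<phi> c c' p n \<Longrightarrow> m \<le> n \<Longrightarrow> awalk \<phi> c c' p m"
  by (auto simp: awalk_def)

lemma awalk_0 [simp]: "awalk \<phi> c c' p 0"
  by (simp add: awalk_def)

lemma awalk_extend:
  assumes "awalk \<phi> c c' p n" "\<phi> {p n, w} = Some (if even n then c else c')"
  shows "awalk \<phi> c c' (p(Suc n := w)) (Suc n)"
  using assms by (auto simp: awalk_def less_Suc_eq)

lemma awalk_unique:
  assumes "pcol \<phi>" "awalk \<phi> c c' p n" "awalk \<phi> c c' q m" "p 0 = q 0" "i \<le> n" "i \<le> m"
  shows "p i = q i"
  using assms(5,6)
proof (induction i)
  case (Suc i)
  then show ?case
    using awalkD[OF assms(2), of i] awalkD[OF assms(3), of i] pcol_unique[OF assms(1)] by simp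
qed (use assms in simp)

text \<open>Equal ends and equal parity give the same last color, hence the same last edge, and so
  on backwards.\<close>

lemma awalk_backwards:
  assumes "pcol \<phi>" "awalk \<phi> c c' p n" "awalk \<phi> c c' q m" "p n = q m" "even n = even m" "i \<le> n" "i \<le> m"
  shows "p (n - i) = q (m - i)"
  using assms(6,7)
proof (induction i)
  case (Suc i)
  have "Suc (n - Suc i) = n - i" "Suc (m - Suc i) = m - i" using Suc by auto
  moreover have "even (n - Suc i) = even (m - Suc i)" using Suc assms(5) by auto
  ultimately show ?case
    using Suc awalkD[OF assms(2), of "n - Suc i"] awalkD[OF assms(3), of "m - Suc i"]
      pcol_unique'[OF assms(1)] by auto
qed (use assms in simp)

text \<open>Traced back together, the shorter walk arrives at its start \<open>p 0\<close> first. If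
  the longer one had further edges, the next would be an edge of color \<open>c'\<close> at
  \<open>p 0\<close>, where this color is missing.\<close>

lemma awalk_end_unique_le:
  assumes "pcol \<phi>" "awalk \<phi> c c' p n" "awalk \<phi> c c' q m" "p n = q m" "even n = even m" "n \<le> m"
    "miss \<phi> (p 0) c'"
  shows "p 0 = q 0 \<and> n = m"
proof -
  have 0: "p 0 = q (m - n)" using awalk_backwards[OF assms(1-5), of n] assms(6) by simp
  have "n = m"
  proof (rule ccontr)
    assume "n \<noteq> m"
    then have "m - n - 1 < m" "Suc (m - n - 1) = m - n" "odd (m - n - 1)" using assms(5,6) by auto
    then have "\<phi> {q (m - n - 1), p 0} = Some c'" using awalkD[OF assms(3), of "m - n - 1"] 0 by simp
    then show False using missD[OF assms(7)] by blast
  qed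
  then show ?thesis using 0 by simp
qed

text \<open>The end, the two colors and the parity determine the start: all bounds on the number of
  predecessors rest on this.\<close>

lemma awalk_end_unique:
  assumes "pcol \<phi>" "awalk \<phi> c c' p n" "awalk \<phi> c c' q m" "p n = q m" "even n = even m"
    "miss \<phi> (p 0) c'" "miss \<phi> (q 0) c'"
  shows "p 0 = q 0 \<and> n = m"
proof (cases "n \<le> m")
  case True
  then show ?thesis using awalk_end_unique_le[OF assms(1-5) True assms(6)] by blast
next
  case False
  then show ?thesis using awalk_end_unique_le[OF assms(1,3,2) assms(4,5)[symmetric] _ assms(7)] by auto
qed

text \<open>At a return after an odd number of steps, the first and the last edge between the two
  visits have the same color at the same vertex. They coincide, which gives a return with a gap
  smaller by two, and finally a loop.\<close>

lemma awalk_odd_gap: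
  assumes "pcol \<phi>" "awalk \<phi> c c' p n" "i + 2 * k + 1 \<le> n"
  shows "p i \<noteq> p (i + 2 * k + 1)"
  using assms(3)
proof (induction k arbitrary: i)
  case 0
  then show ?case using awalkD[OF assms(2), of i] pcol_edge[OF assms(1)] no_loop by fastforce
next
  case (Suc k)
  show ?case
  proof
    assume eq: "p i = p (i + 2 * Suc k + 1)"
    have "\<phi> {p i, p (Suc i)} = Some (if even i then c else c')"
      using awalkD[OF assms(2), of i] Suc by simp
    moreover have "\<phi> {p (i + 2 * k + 2), p (i + 2 * k + 3)} = Some (if even i then c else c')"
      using awalkD[OF assms(2), of "i + 2 * k + 2"] Suc by (simp add: numeral_3_eq_3)
    ultimately have "p (Suc i) = p (i + 2 * k + 2)"
      using eq pcol_unique[OF assms(1), of "p i" "p (Suc i)"]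
      by (simp add: insert_commute numeral_3_eq_3)
    moreover have "p (Suc i) \<noteq> p (Suc i + 2 * k + 1)" using Suc(1)[of "Suc i"] Suc(2) by simp
    ultimately show False by simp
  qed
qed

lemma awalk_inj:
  assumes "pcol \<phi>" "awalk \<phi> c c' p n" "miss \<phi> (p 0) c'" "i \<le> n" "j \<le> n" "p i = p j"
  shows "i = j"
proof (cases "even i = even j")
  case True
  then show ?thesis
    using awalk_end_unique[OF assms(1) awalk_mono[OF assms(2,4)] awalk_mono[OF assms(2,5)] assms(6)] assms(3)
    by simp
next
  case False
  have *: "p i \<noteq> p j" if "i < j" "j \<le> n" "even i \<noteq> even j" for i j
  proof -
    have "odd (j - i)" using that by auto
    then obtain k where "j - i = 2 * k + 1" by (rule oddE)
    then have "j = i + 2 * k + 1" using that by simp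
    then show ?thesis using awalk_odd_gap[OF assms(1,2), of i k] that by simp
  qed
  show ?thesis using *[of i j] *[of j i] False assms by (metis linorder_neqE_nat)
qed

text \<open>The edge either continues the walk or is the one it arrived by; at the start itself the
  second color is missing.\<close>

lemma awalk_component_closed:
  assumes "pcol \<phi>" "miss \<phi> z c'" "p 0 = z" "awalk \<phi> c c' p n" "\<phi> {p n, w} = Some k" "k = c \<or> k = c'"
  obtains q m where "q 0 = z" "awalk \<phi> c c' q m" "q m = w"
proof (cases "k = (if even n then c else c')")
  case True
  then show ?thesis
    using that[of "p(Suc n := w)" "Suc n"] awalk_extend[OF assms(4), of w] assms by auto
next
  case False
  have "n > 0"
    using False assms(2,3,5,6) missD(1)[OF assms(2), of w] by (cases n) auto
  then have "\<phi> {p (n - 1), p n} = Some k"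
    using False assms(6) awalkD[OF assms(4), of "n - 1"] by (auto split: if_splits)
  then have "p (n - 1) = w"
    using pcol_unique[OF assms(1) _ assms(5)] by (simp add: insert_commute)
  then show ?thesis
    using that[of p "n - 1"] assms(3) awalk_mono[OF assms(4), of "n - 1"] by simp
qed

section \<open>Vizing fans\<close>

definition fan :: "('a set \<Rightarrow> nat option) \<Rightarrow> 'a \<Rightarrow> 'a \<Rightarrow> nat set \<Rightarrow> (nat \<Rightarrow> 'a) \<Rightarrow> (nat \<Rightarrow> nat) \<Rightarrow> nat \<Rightarrow> bool" where
  "fan \<phi> x y A Y \<eta> k \<longleftrightarrow> Y 0 = y \<and> inj_on Y {..k} \<and>
     (\<forall>i<k. \<phi> {x, Y (Suc i)} = Some (\<eta> i) \<and> miss \<phi> (Y i) (\<eta> i) \<and> \<eta> i \<notin> A)"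

primrec fan_shift :: "('a set \<Rightarrow> nat option) \<Rightarrow> 'a \<Rightarrow> (nat \<Rightarrow> 'a) \<Rightarrow> (nat \<Rightarrow> nat) \<Rightarrow> nat \<Rightarrow> 'a set \<Rightarrow> nat option" where
  "fan_shift \<phi> x Y \<eta> 0 = \<phi>"
| "fan_shift \<phi> x Y \<eta> (Suc i) = (fan_shift \<phi> x Y \<eta> i)({x, Y i} := Some (\<eta> i), {x, Y (Suc i)} := None)"

lemma fan_edge:
  assumes "pcol \<phi>" "fan \<phi> x y A Y \<eta> k" "{x, y} \<in> E" "i \<le> k"
  shows "{x, Y i} \<in> E"
proof (cases i)
  case 0
  then show ?thesis using assms by (simp add: fan_def)
next
  case (Suc m)
  then have "\<phi> {x, Y i} = Some (\<eta> m)" using assms by (simp add: fan_def)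
  then show ?thesis by (rule pcol_edge[OF assms(1)])
qed

lemma fan_shift_props:
  assumes "pcol \<phi>" "fan \<phi> x y A Y \<eta> k" "{x, y} \<in> E" "\<phi> {x, y} = None" "i \<le> k"
  shows "pcol (fan_shift \<phi> x Y \<eta> i) \<and> fan_shift \<phi> x Y \<eta> i {x, Y i} = None
    \<and> (\<forall>m<i. fan_shift \<phi> x Y \<eta> i {x, Y m} = Some (\<eta> m))
    \<and> (\<forall>e. (\<forall>m\<le>i. e \<noteq> {x, Y m}) \<longrightarrow> fan_shift \<phi> x Y \<eta> i e = \<phi> e)
    \<and> dom (fan_shift \<phi> x Y \<eta> i) = insert {x, y} (dom \<phi>) - {{x, Y i}}"
  using assms(5)
proof (induction i)
  case 0
  have "dom \<phi> = insert {x, y} (dom \<phi>) - {{x, y}}" using assms(4) by auto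
  moreover have "Y 0 = y" using assms(2) by (simp add: fan_def)
  ultimately show ?case using assms by simp
next
  case (Suc i)
  let ?f = "fan_shift \<phi> x Y \<eta> i"
  have IH: "pcol ?f" "?f {x, Y i} = None" "\<forall>m<i. ?f {x, Y m} = Some (\<eta> m)"
    "\<forall>e. (\<forall>m\<le>i. e \<noteq> {x, Y m}) \<longrightarrow> ?f e = \<phi> e" "dom ?f = insert {x, y} (dom \<phi>) - {{x, Y i}}"
    using Suc by auto
  have f: "\<phi> {x, Y (Suc i)} = Some (\<eta> i)" "miss \<phi> (Y i) (\<eta> i)"
    using assms(2) Suc(2) by (auto simp: fan_def)
  have xY: "{x, Y m} \<in> E" "x \<noteq> Y m" if "m \<le> k" for m
    using fan_edge[OF assms(1-3) that] no_loop by auto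
  have Yinj: "Y m = Y m' \<longleftrightarrow> m = m'" if "m \<le> k" "m' \<le> k" for m m'
    using assms(2) that by (auto simp: fan_def inj_on_def)
  have neq: "{x, Y m} = {x, Y m'} \<longleftrightarrow> m = m'" if "m \<le> k" "m' \<le> k" for m m'
    using Yinj[OF that] xY that by (auto simp: doubleton_eq_iff)
  have col: "?f {x, Y (Suc i)} = Some (\<eta> i)"
    using IH(4) f(1) neq Suc(2) by simp
  have "miss ?f (Y i) (\<eta> i)"
    unfolding miss_def
  proof (intro conjI allI)
    show "\<eta> i \<le> d" using f(2) by (simp add: miss_def)
    fix u
    show "?f {Y i, u} \<noteq> Some (\<eta> i)"
    proof (cases "u = x")
      case True
      then show ?thesis using IH(2) by (simp add: insert_commute)
    next
      case False
      then have "{Y i, u} \<noteq> {x, Y m}" for m using xY(2)[of i] Suc(2) by (auto simp: doubleton_eq_iff)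
      then show ?thesis using IH(4) missD[OF f(2)] by simp
    qed
  qed
  then have "pcol (fan_shift \<phi> x Y \<eta> (Suc i))"
    using pcol_move[of ?f "Y i" x "\<eta> i" "Y (Suc i)"] IH(1,2) xY(1)[of i] col Suc(2)
    by (simp add: insert_commute)
  moreover have "fan_shift \<phi> x Y \<eta> (Suc i) {x, Y m} = Some (\<eta> m)" if "m < Suc i" for m
    using that IH(3) neq Suc(2) by (auto simp: less_Suc_eq)
  moreover have "fan_shift \<phi> x Y \<eta> (Suc i) e = \<phi> e" if "\<forall>m\<le>Suc i. e \<noteq> {x, Y m}" for e
    using that IH(4) by auto
  moreover have "dom (fan_shift \<phi> x Y \<eta> (Suc i)) = insert {x, y} (dom \<phi>) - {{x, Y (Suc i)}}"
  proof -
    have "{x, Y i} \<in> insert {x, y} (dom \<phi>)"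
    proof (cases i)
      case 0
      then show ?thesis using assms(2) by (simp add: fan_def)
    next
      case (Suc m)
      then have "\<phi> {x, Y i} = Some (\<eta> m)" using assms(2) \<open>Suc i \<le> k\<close> by (simp add: fan_def)
      then show ?thesis by blast
    qed
    then have "insert {x, Y i} (insert {x, y} (dom \<phi>) - {{x, Y i}}) = insert {x, y} (dom \<phi>)"
      by (rule insert_Diff)
    then show ?thesis
      using IH(5) by (simp add: insert_Diff_if)
  qed
  moreover have "fan_shift \<phi> x Y \<eta> (Suc i) {x, Y (Suc i)} = None" by simp
  ultimately show ?case by blast
qed

text \<open>The colors \<open>\<alpha>, \<beta>\<close> of the previous chain are avoided as long as possible. The last
  disjunct is the case where this fails; then the walk from \<open>z\<close> may lead back to \<open>x\<close>.\<close>

definition fan_out ::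
  "('a set \<Rightarrow> nat option) \<Rightarrow> 'a \<Rightarrow> 'a \<Rightarrow> nat \<Rightarrow> nat \<Rightarrow> ('a set \<Rightarrow> nat option) \<Rightarrow> 'a \<Rightarrow> nat \<Rightarrow> nat \<Rightarrow> bool" where
  "fan_out \<phi> x y \<alpha> \<beta> \<xi> z \<gamma> \<delta> \<longleftrightarrow>
     pcol \<xi> \<and> {x, z} \<in> E \<and> \<xi> {x, z} = None \<and> miss \<xi> x \<gamma> \<and> miss \<xi> z \<delta> \<and> miss \<phi> z \<delta> \<and> \<gamma> \<noteq> \<delta> \<and>
     (\<forall>e. x \<notin> e \<longrightarrow> \<xi> e = \<phi> e) \<and> dom \<xi> = insert {x, y} (dom \<phi>) - {{x, z}} \<and>
     {x, z} \<in> insert {x, y} (dom \<phi>) \<and>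
     (\<forall>p n. p 0 = z \<longrightarrow> awalk \<xi> \<gamma> \<delta> p n \<longrightarrow> awalk \<phi> \<gamma> \<delta> p n) \<and>
     (\<gamma> \<notin> {\<alpha>, \<beta>} \<and> \<delta> \<notin> {\<alpha>, \<beta>} \<and> (\<forall>p n. p 0 = z \<longrightarrow> awalk \<phi> \<gamma> \<delta> p n \<longrightarrow> p n \<noteq> x) \<or>
      \<gamma> = \<beta> \<and> \<delta> = \<alpha> \<and> (\<forall>i. miss \<phi> z i \<longrightarrow> i \<in> {\<alpha>, \<beta>}))"

lemma fan_outD:
  assumes "fan_out \<phi> x y \<alpha> \<beta> \<xi> z \<gamma> \<delta>"
  shows "pcol \<xi>" "{x, z} \<in> E" "\<xi> {x, z} = None" "miss \<xi> x \<gamma>" "miss \<xi> z \<delta>" "miss \<phi> z \<delta>" "\<gamma> \<noteq> \<delta>"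
    "x \<notin> e \<Longrightarrow> \<xi> e = \<phi> e" "dom \<xi> = insert {x, y} (dom \<phi>) - {{x, z}}"
    "q 0 = z \<Longrightarrow> awalk \<xi> \<gamma> \<delta> q n \<Longrightarrow> awalk \<phi> \<gamma> \<delta> q n" "{x, z} \<in> insert {x, y} (dom \<phi>)"
    "\<gamma> \<notin> {\<alpha>, \<beta>} \<and> \<delta> \<notin> {\<alpha>, \<beta>} \<and> (\<forall>p n. p 0 = z \<longrightarrow> awalk \<phi> \<gamma> \<delta> p n \<longrightarrow> p n \<noteq> x) \<or>
      \<gamma> = \<beta> \<and> \<delta> = \<alpha> \<and> (\<forall>i. miss \<phi> z i \<longrightarrow> i \<in> {\<alpha>, \<beta>})"
  using assms unfolding fan_out_def by (elim conjE, assumption | simp)+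

definition fan_done :: "('a set \<Rightarrow> nat option) \<Rightarrow> 'a \<Rightarrow> 'a \<Rightarrow> bool" where
  "fan_done \<phi> x y \<longleftrightarrow>
     (\<exists>\<xi>. pcol \<xi> \<and> dom \<xi> = insert {x, y} (dom \<phi>) \<and> (\<forall>e. x \<notin> e \<longrightarrow> \<xi> e = \<phi> e))"

lemma ex_maximal_fan:
  assumes "pcol \<phi>" "{x, y} \<in> E"
  obtains Y \<eta> k where "fan \<phi> x y A Y \<eta> k" "\<And>Y' \<eta>'. \<not> fan \<phi> x y A Y' \<eta>' (Suc k)"
proof -
  define P where "P k \<longleftrightarrow> (\<exists>Y \<eta>. fan \<phi> x y A Y \<eta> k)" for k
  have "P 0" unfolding P_def by (intro exI[of _ "\<lambda>_. y"]) (simp add: fan_def)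
  moreover have "\<forall>k. P k \<longrightarrow> k \<le> d"
  proof (intro allI impI)
    fix k assume "P k"
    then obtain Y \<eta> where f: "fan \<phi> x y A Y \<eta> k" by (auto simp: P_def)
    have "Y ` {..k} \<subseteq> nbrs x" using fan_edge[OF assms(1) f assms(2)] by (auto simp: mem_nbrs)
    then have "card {..k} \<le> card (nbrs x)"
      using f by (intro card_inj_on_le[of Y]) (auto simp: fan_def)
    then show "k \<le> d" using card_nbrs'[of x] by simp
  qed
  ultimately obtain k where "P k" "\<forall>j. P j \<longrightarrow> j \<le> k"
    using ex_has_greatest_nat[of P 0 "\<lambda>k. k" "Suc d"] by (auto simp: less_Suc_eq_le)
  then show ?thesis using that unfolding P_def by (metis Suc_n_not_le_n)
qed

text \<open>A fan avoiding \<open>\<alpha>\<close> and \<open>\<beta>\<close> is taken maximal. If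
  its last leaf misses only these colors, it is shifted entirely and the old colors are reused.
  Otherwise the leaf misses a fresh \<open>\<delta>\<close>; by maximality the
  \<open>\<delta>\<close>-edge at \<open>x\<close> leads to a leaf \<open>Y (Suc j)\<close>, so
  \<open>Y j\<close> and \<open>Y k\<close> both miss \<open>\<delta>\<close>, while
  \<open>x\<close> misses \<open>\<gamma>\<close>. These three vertices are ends of Kempe
  components, so one of \<open>Y j\<close>, \<open>Y k\<close> is not connected to \<open>x\<close>,
  and the fan is shifted to that one.\<close>

lemma vizing_fan:
  assumes \<phi>: "pcol \<phi>" and xy: "{x, y} \<in> E" "\<phi> {x, y} = None"
    and ab: "\<alpha> \<le> d \<longleftrightarrow> \<beta> \<le> d" "\<beta> \<le> d \<Longrightarrow> miss \<phi> x \<beta>" "\<alpha> \<le> d \<Longrightarrow> miss \<phi> y \<alpha>"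
  shows "fan_done \<phi> x y \<or> (\<exists>\<xi> z \<gamma> \<delta>. fan_out \<phi> x y \<alpha> \<beta> \<xi> z \<gamma> \<delta>)"
proof (cases "fan_done \<phi> x y")
  case notdone: False
  obtain \<gamma> where \<gamma>: "miss \<phi> x \<gamma>" "\<gamma> \<noteq> \<beta>" using miss_ex_other[OF \<phi> xy] by blast
  obtain Y \<eta> k where fan: "fan \<phi> x y {\<alpha>, \<beta>} Y \<eta> k" and max: "\<And>Y' \<eta>'. \<not> fan \<phi> x y {\<alpha>, \<beta>} Y' \<eta>' (Suc k)"
    using ex_maximal_fan[OF \<phi> xy(1)] by blast
  let ?s = "fan_shift \<phi> x Y \<eta>"
  note props = fan_shift_props[OF \<phi> fan xy]
  have Y0: "Y 0 = y" using fan by (simp add: fan_def)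
  have xY: "{x, Y m} \<in> E" "x \<noteq> Y m" if "m \<le> k" for m
    using fan_edge[OF \<phi> fan xy(1) that] no_loop by auto
  have Yinj: "Y m = Y m' \<Longrightarrow> m = m'" if "m \<le> k" "m' \<le> k" for m m'
    using fan that by (auto simp: fan_def inj_on_def)
  have \<eta>: "\<phi> {x, Y (Suc m)} = Some (\<eta> m)" "miss \<phi> (Y m) (\<eta> m)" "\<eta> m \<notin> {\<alpha>, \<beta>}" if "m < k" for m
    using fan that by (auto simp: fan_def)
  have off: "?s i e = \<phi> e" if "x \<notin> e" "i \<le> k" for i e
    using props[OF that(2)] that(1) by auto
  have col: "\<phi> e = Some t \<or> (\<exists>m<i. e = {x, Y m} \<and> t = \<eta> m)" if "?s i e = Some t" "i \<le> k" for i e t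
  proof (cases "\<exists>m\<le>i. e = {x, Y m}")
    case True
    then obtain m where m: "m \<le> i" "e = {x, Y m}" by blast
    then have "m < i" using that props[OF that(2)] by (cases "m = i") auto
    moreover from this have "?s i e = Some (\<eta> m)" using props[OF that(2)] m by auto
    ultimately show ?thesis using m that(1) by auto
  next
    case False
    then show ?thesis using that props[OF that(2)] by auto
  qed
  have missx: "miss (?s i) x t" if "miss \<phi> x t" "i \<le> k" for i t
    unfolding miss_def
  proof (intro conjI allI notI)
    show "t \<le> d" using that(1) by (simp add: miss_def)
    fix u assume "?s i {x, u} = Some t"
    then obtain m where "m < i" "t = \<eta> m" using col[OF _ \<open>i \<le> k\<close>] missD[OF \<open>miss \<phi> x t\<close>] by blast
    then have "\<phi> {x, Y (Suc m)} = Some t" using \<eta>(1)[of m] \<open>i \<le> k\<close> by simp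
    then show False using missD[OF \<open>miss \<phi> x t\<close>] by blast
  qed
  have missY: "miss (?s i) (Y i) t" if "miss \<phi> (Y i) t" "i \<le> k" for i t
    unfolding miss_def
  proof (intro conjI allI notI)
    show "t \<le> d" using that(1) by (simp add: miss_def)
    fix u assume u: "?s i {Y i, u} = Some t"
    then obtain m where m: "m < i" "{Y i, u} = {x, Y m}"
      using col[OF _ \<open>i \<le> k\<close>] missD[OF \<open>miss \<phi> (Y i) t\<close>] by blast
    then have "u = x" using xY(2)[OF that(2)] by (auto simp: doubleton_eq_iff)
    then show False using props[OF that(2)] u by (simp add: insert_commute)
  qed
  have Ydom: "{x, Y i} \<in> insert {x, y} (dom \<phi>)" if "i \<le> k" for i
    using \<eta>(1)[of "i - 1"] Y0 that by (cases i) auto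
  have finish: False if "miss \<phi> (Y i) t" "miss \<phi> x t" "i \<le> k" for i t
  proof -
    let ?c = "(?s i)({x, Y i} := Some t)"
    have "pcol ?c" using props[OF that(3)] missx[OF that(2,3)] missY[OF that(1,3)] xY[OF that(3)]
      by (intro pcol_fill) auto
    moreover have "dom ?c = insert {x, y} (dom \<phi>)"
      using props[OF that(3)] insert_Diff[OF Ydom[OF that(3)]] by simp
    moreover have "\<forall>e. x \<notin> e \<longrightarrow> ?c e = \<phi> e" using off[OF _ that(3)] by auto
    ultimately show False using notdone unfolding fan_done_def by blast
  qed
  have \<gamma>': "\<gamma> \<notin> {\<alpha>, \<beta>}"
  proof -
    have "\<gamma> \<noteq> \<alpha>" using finish[of 0 \<alpha>] ab(3) \<gamma> Y0 by (auto simp: miss_def)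
    then show ?thesis using \<gamma> by simp
  qed
  have out: "fan_out \<phi> x y \<alpha> \<beta> (?s i) (Y i) g t"
    if "i \<le> k" "miss \<phi> x g" "miss \<phi> (Y i) t" "g \<noteq> t"
      "\<And>p n. p 0 = Y i \<Longrightarrow> awalk (?s i) g t p n \<Longrightarrow> awalk \<phi> g t p n"
      "g \<notin> {\<alpha>, \<beta>} \<and> t \<notin> {\<alpha>, \<beta>} \<and> (\<forall>p n. p 0 = Y i \<longrightarrow> awalk \<phi> g t p n \<longrightarrow> p n \<noteq> x) \<or>
      g = \<beta> \<and> t = \<alpha> \<and> (\<forall>j. miss \<phi> (Y i) j \<longrightarrow> j \<in> {\<alpha>, \<beta>})" for i g t
  proof -
    have "pcol (?s i)" "?s i {x, Y i} = None" "dom (?s i) = insert {x, y} (dom \<phi>) - {{x, Y i}}"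
      using props[OF that(1)] by simp_all
    moreover have "{x, Y i} \<in> E" using xY[OF that(1)] by simp
    moreover have "{x, Y i} \<in> insert {x, y} (dom \<phi>)" using Ydom[OF that(1)] .
    moreover have "miss (?s i) x g" using missx[OF that(2,1)] .
    moreover have "miss (?s i) (Y i) t" using missY[OF that(3,1)] .
    moreover have "\<forall>e. x \<notin> e \<longrightarrow> ?s i e = \<phi> e" using off[OF _ that(1)] by simp
    moreover have "\<forall>p n. p 0 = Y i \<longrightarrow> awalk (?s i) g t p n \<longrightarrow> awalk \<phi> g t p n" using that(5) by simp
    ultimately show ?thesis unfolding fan_out_def using that(3,4,6) by (intro conjI)
  qed
  show ?thesis
  proof (cases "\<forall>i. miss \<phi> (Y k) i \<longrightarrow> i \<in> {\<alpha>, \<beta>}")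
    case True
    obtain i where i: "miss \<phi> (Y k) i" using miss_ex[OF \<phi>] by blast
    have "i \<noteq> \<beta>" using finish[of k \<beta>] ab(2) i by (auto simp: miss_def)
    then have ia: "i = \<alpha>" "\<alpha> \<noteq> \<beta>" using True i by auto
    have "miss \<phi> x \<beta>" using ab i ia by (auto simp: miss_def)
    moreover have "\<phi> e = Some t" if "?s k e = Some t" "t = \<beta> \<or> t = \<alpha>" for e t
      using col[OF that(1)] that(2) \<eta>(3) by auto
    then have w: "awalk \<phi> \<beta> \<alpha> p n" if "awalk (?s k) \<beta> \<alpha> p n" for p n
      using that by (simp add: awalk_def)
    ultimately have "fan_out \<phi> x y \<alpha> \<beta> (?s k) (Y k) \<beta> \<alpha>"
      by (intro out[OF order_refl]) (use i ia True in simp_all)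
    then show ?thesis by blast
  next
    case False
    then obtain \<delta> where \<delta>: "miss \<phi> (Y k) \<delta>" "\<delta> \<notin> {\<alpha>, \<beta>}" by blast
    have nx: "\<not> miss \<phi> x \<delta>" using finish[of k \<delta>] \<delta> by auto
    then have \<gamma>\<delta>: "\<gamma> \<noteq> \<delta>" using \<gamma> by auto
    obtain w where w: "\<phi> {x, w} = Some \<delta>" using nx \<delta>(1) by (auto simp: miss_def)
    have "w \<in> Y ` {..k}"
    proof (rule ccontr)
      assume w': "w \<notin> Y ` {..k}"
      have "fan \<phi> x y {\<alpha>, \<beta>} (Y(Suc k := w)) (\<eta>(k := \<delta>)) (Suc k)"
        unfolding fan_def
      proof (intro conjI allI impI)
        show "(Y(Suc k := w)) 0 = y" using Y0 by simp
        show "inj_on (Y(Suc k := w)) {..Suc k}"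
          using fan w' by (auto simp: fan_def inj_on_def atMost_Suc)
        fix i assume "i < Suc k"
        then show "\<phi> {x, (Y(Suc k := w)) (Suc i)} = Some ((\<eta>(k := \<delta>)) i)"
          "miss \<phi> ((Y(Suc k := w)) i) ((\<eta>(k := \<delta>)) i)" "(\<eta>(k := \<delta>)) i \<notin> {\<alpha>, \<beta>}"
          using \<eta> w \<delta> by (auto simp: less_Suc_eq)
      qed
      then show False using max by blast
    qed
    moreover have "w \<noteq> Y 0" using w xy(2) Y0 by auto
    ultimately obtain j where j: "w = Y (Suc j)" "j < k"
      by (metis Suc_le_eq atMost_iff image_iff not0_implies_Suc)
    have \<eta>j: "\<eta> j = \<delta>" using \<eta>(1)[OF j(2)] w j(1) by simp
    have \<delta>j: "miss \<phi> (Y j) \<delta>" using \<eta>(2)[OF j(2)] \<eta>j by simp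
    show ?thesis
    proof (cases "\<forall>p n. p 0 = Y j \<longrightarrow> awalk \<phi> \<gamma> \<delta> p n \<longrightarrow> p n \<noteq> x")
      case True
      \<comment> \<open>Shifting only up to \<open>j\<close> moves neither color:
        \<open>\<gamma>\<close> is missing at \<open>x\<close>, and the only
        \<open>\<delta>\<close>-edge at \<open>x\<close> is the later
        \<open>{x, Y (Suc j)}\<close>.\<close>
      have "\<eta> m \<noteq> \<gamma> \<and> \<eta> m \<noteq> \<delta>" if "m < j" for m
      proof -
        have e: "\<phi> {x, Y (Suc m)} = Some (\<eta> m)" using \<eta>(1) that j by simp
        have "\<eta> m \<noteq> \<delta>"
        proof
          assume "\<eta> m = \<delta>"
          then have "Y (Suc m) = Y (Suc j)" using e w j(1) pcol_unique[OF \<phi>] by blast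
          then show False using Yinj[of "Suc m" "Suc j"] that j by simp
        qed
        then show ?thesis using e missD[OF \<gamma>(1)] by auto
      qed
      then have "\<phi> e = Some t" if "?s j e = Some t" "t = \<gamma> \<or> t = \<delta>" for e t
        using col[OF that(1)] that(2) j(2) by auto
      then have w: "awalk \<phi> \<gamma> \<delta> p n" if "awalk (?s j) \<gamma> \<delta> p n" for p n
        using that by (simp add: awalk_def)
      have "fan_out \<phi> x y \<alpha> \<beta> (?s j) (Y j) \<gamma> \<delta>"
        by (rule out[OF less_imp_le[OF j(2)] \<gamma>(1) \<delta>j \<gamma>\<delta> w]) (use \<gamma>' \<delta>(2) True in simp_all)
      then show ?thesis by blast
    next
      case False
      then obtain p n where p: "p 0 = Y j" "awalk \<phi> \<gamma> \<delta> p n" "p n = x" by blast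
      \<comment> \<open>A walk from elsewhere can enter \<open>x\<close> by color
        \<open>\<delta>\<close> only. The equal parities are what \<open>awalk_end_unique\<close>
        needs.\<close>
      have evenx: "even n" if "q 0 \<noteq> x" "awalk \<phi> \<gamma> \<delta> q n" "q n = x" for q n
      proof (rule ccontr)
        assume "odd n"
        then have "n - 1 < n" "Suc (n - 1) = n" "even (n - 1)" by (auto elim: oddE)
        then have "\<phi> {q (n - 1), x} = Some \<gamma>" using awalkD[OF that(2), of "n - 1"] that(3) by simp
        then show False using missD[OF \<gamma>(1)] by blast
      qed
      have "x \<noteq> Y j" using xY(2)[of j] j(2) by simp
      then have en: "even n" using evenx[of p n] p by auto
      have nohit: "q m \<noteq> x" if q: "q 0 = Y k" "awalk \<phi> \<gamma> \<delta> q m" for q m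
      proof
        assume "q m = x"
        moreover have "even m" using evenx[of q m] q xY(2)[of k] \<open>q m = x\<close> by auto
        ultimately have "p 0 = q 0"
          using awalk_end_unique[OF \<phi> p(2) q(2)] p en \<delta>(1) \<delta>j q(1) by auto
        then show False using Yinj[of j k] p(1) q(1) j(2) by simp
      qed
      \<comment> \<open>The shift to \<open>k\<close> gives \<open>{x, Y j}\<close> the color
        \<open>\<delta>\<close>, so a new walk from \<open>Y k\<close> could enter \<open>x\<close>
        there. But it would have to come through \<open>Y j\<close>, which is connected to
        \<open>x\<close> in \<open>\<phi>\<close>, whereas \<open>Y k\<close> is not.\<close>
      have "awalk \<phi> \<gamma> \<delta> q i" if q: "q 0 = Y k" "awalk (?s k) \<gamma> \<delta> q i" for q i
        using q(2)
      proof (induction i)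
        case (Suc i)
        have IH: "awalk \<phi> \<gamma> \<delta> q i" using Suc awalk_mono by auto
        let ?t = "if even i then \<gamma> else \<delta>"
        have e: "?s k {q i, q (Suc i)} = Some ?t" using Suc(2) by (simp add: awalk_def)
        have "\<phi> {q i, q (Suc i)} = Some ?t"
        proof (cases "x \<in> {q i, q (Suc i)}")
          case False
          then show ?thesis using e off[of _ k] by simp
        next
          case True
          then have x: "q (Suc i) = x" using nohit[OF q(1) IH] by auto
          have "?t \<noteq> \<gamma>" using e x missD(2)[OF missx[OF \<gamma>(1), of k]] by auto
          then have odd: "odd i" by auto
          have "?s k {x, q i} = Some \<delta>" using e x odd by (simp add: insert_commute)
          moreover have "?s k {x, Y j} = Some \<delta>" using props[of k] j(2) \<eta>j by auto
          ultimately have qi: "q i = Y j" using pcol_unique[of "?s k" x "q i" \<delta> "Y j"] props[of k] by simp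
          \<comment> \<open>\<open>r\<close> is \<open>q\<close> reversed, again alternating because
            \<open>i\<close> is odd. Both \<open>r\<close> and \<open>p\<close> start at
            \<open>Y j\<close>, so they agree as long as both last: either \<open>r\<close> meets
            \<open>x\<close>, or \<open>p\<close> leaves \<open>Y k\<close> by a
            \<open>\<delta>\<close>-edge.\<close>
          define r where "r s = q (i - s)" for s
          have r: "awalk \<phi> \<gamma> \<delta> r i"
            unfolding awalk_def
          proof (intro allI impI)
            fix s assume s: "s < i"
            then have "i - s = Suc (i - Suc s)" "even (i - Suc s) = even s" using odd by auto
            then show "\<phi> {r s, r (Suc s)} = Some (if even s then \<gamma> else \<delta>)"
              using awalkD[OF IH, of "i - Suc s"] s by (simp add: r_def insert_commute)
          qed
          have r0: "r 0 = p 0" "r i = Y k" using qi p(1) q(1) by (auto simp: r_def)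
          show ?thesis
          proof (cases "n \<le> i")
            case True
            then have "r n = x" using awalk_unique[OF \<phi> p(2) r r0(1)[symmetric], of n] p(3) by simp
            moreover have "r n = q (i - n)" by (simp add: r_def)
            ultimately show ?thesis using nohit[OF q(1) awalk_mono[OF IH, of "i - n"]] by simp
          next
            case False
            then have "p i = Y k" using awalk_unique[OF \<phi> p(2) r r0(1)[symmetric], of i] r0(2) by simp
            then have "\<phi> {Y k, p (Suc i)} = Some \<delta>" using awalkD[OF p(2), of i] False odd by simp
            with missD(1)[OF \<delta>(1)] show ?thesis by simp
          qed
        qed
        then show ?case using IH by (auto simp: awalk_def less_Suc_eq)
      qed simp
      then have "fan_out \<phi> x y \<alpha> \<beta> (?s k) (Y k) \<gamma> \<delta>"
        by (intro out[OF order_refl \<gamma>(1) \<delta>(1) \<gamma>\<delta>]) (use \<gamma>' \<delta>(2) nohit in simp_all)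
      then show ?thesis by blast
    qed
  qed
qed simp

text \<open>\<open>{P i, p i}\<close> is the \<open>i\<close>-th edge of the walk \<open>x, p 0, p 1, \<dots>\<close>, whose first edge is uncolored.\<close>

lemma kempe_shift:
  fixes p :: "nat \<Rightarrow> 'a" and x :: 'a and \<gamma> \<delta> :: nat
  defines "P \<equiv> \<lambda>i. if i = 0 then x else p (i - 1)" and "col \<equiv> \<lambda>i. if even i then \<gamma> else \<delta>"
  assumes \<xi>: "pcol \<xi>" "{x, p 0} \<in> E" "\<xi> {x, p 0} = None" "miss \<xi> x \<gamma>" "miss \<xi> (p 0) \<delta>" "\<gamma> \<noteq> \<delta>"
    and p: "awalk \<xi> \<gamma> \<delta> p n" "\<And>i. i \<le> n \<Longrightarrow> p i \<noteq> x"
  shows "\<exists>\<xi>'. pcol \<xi>' \<and> \<xi>' {P n, p n} = None \<and> dom \<xi>' = insert {x, p 0} (dom \<xi>) - {{P n, p n}} \<and>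
    miss \<xi>' (P n) (col n) \<and> miss \<xi>' (p n) (col (Suc n)) \<and>
    (\<forall>i<n. \<xi>' {P i, p i} = Some (col i)) \<and> (\<forall>e. (\<forall>i\<le>n. e \<noteq> {P i, p i}) \<longrightarrow> \<xi>' e = \<xi> e)"
  using p
proof (induction n)
  case 0
  have "dom \<xi> = insert {x, p 0} (dom \<xi>) - {{x, p 0}}" using \<xi>(3) by auto
  then show ?case using \<xi> by (intro exI[of _ \<xi>]) (auto simp: P_def col_def)
next
  case (Suc n)
  have pn: "awalk \<xi> \<gamma> \<delta> p n" using Suc(2) awalk_mono by auto
  obtain \<xi>' where IH: "pcol \<xi>'" "\<xi>' {P n, p n} = None" "dom \<xi>' = insert {x, p 0} (dom \<xi>) - {{P n, p n}}"
    "miss \<xi>' (P n) (col n)" "miss \<xi>' (p n) (col (Suc n))"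
    "\<forall>i<n. \<xi>' {P i, p i} = Some (col i)" "\<forall>e. (\<forall>i\<le>n. e \<noteq> {P i, p i}) \<longrightarrow> \<xi>' e = \<xi> e"
    using Suc.IH[OF pn] Suc(3) by auto
  have inj: "p i = p j \<longleftrightarrow> i = j" if "i \<le> Suc n" "j \<le> Suc n" for i j
    using awalk_inj[OF \<xi>(1) Suc(2) \<xi>(5)] that by blast
  have px: "p i \<noteq> x" if "i \<le> Suc n" for i using Suc(3) that by blast
  have PS: "P (Suc i) = p i" for i by (simp add: P_def)
  have neq: "{P i, p i} = {P j, p j} \<longleftrightarrow> i = j" if "i \<le> Suc n" "j \<le> Suc n" for i j
    using that inj px by (auto simp: P_def doubleton_eq_iff split: if_splits)
  have Pp: "P i \<noteq> p i" if "i \<le> Suc n" for i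
    using inj[of "i - 1" i] px[OF that] that by (auto simp: P_def)
  have e: "\<xi>' {p n, p (Suc n)} = Some (col n)"
  proof -
    have "\<forall>i\<le>n. {P (Suc n), p (Suc n)} \<noteq> {P i, p i}"
      using neq by (metis Suc_n_not_le_n le_Suc_eq order_refl)
    then have "\<xi>' {p n, p (Suc n)} = \<xi> {p n, p (Suc n)}" using IH(7) PS by simp
    then show ?thesis using awalkD[OF Suc(2), of n] by (simp add: col_def)
  qed
  have PnE: "{P n, p n} \<in> E"
  proof (cases n)
    case 0
    then show ?thesis using \<xi> by (simp add: P_def)
  next
    case (Suc m)
    then have "\<xi> {P n, p n} = Some (col m)" using awalkD[OF pn, of m] by (simp add: P_def col_def)
    then show ?thesis by (rule pcol_edge[OF \<xi>(1)])
  qed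
  have Pnd: "{P n, p n} \<in> insert {x, p 0} (dom \<xi>)"
  proof (cases n)
    case 0
    then show ?thesis by (simp add: P_def)
  next
    case (Suc m)
    then have "\<xi> {P n, p n} = Some (col m)" using awalkD[OF pn, of m] by (simp add: P_def col_def)
    then show ?thesis by blast
  qed
  define \<psi> where "\<psi> = \<xi>'({P n, p n} := Some (col n), {p n, p (Suc n)} := None)"
  have colS: "col (Suc (Suc n)) = col n" "col (Suc n) \<noteq> col n" using \<xi>(6) by (auto simp: col_def)
  have ne: "{P n, p n} \<noteq> {p n, p (Suc n)}" using neq[of n "Suc n"] PS by auto
  have "pcol \<psi>" unfolding \<psi>_def by (rule pcol_move[OF IH(1) PnE IH(2,4) e])
  moreover have "\<psi> {P (Suc n), p (Suc n)} = None" by (simp add: \<psi>_def PS)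
  moreover have "dom \<psi> = insert {x, p 0} (dom \<xi>) - {{P (Suc n), p (Suc n)}}"
  proof -
    have "dom \<psi> = insert {P n, p n} (dom \<xi>') - {{p n, p (Suc n)}}" by (simp add: \<psi>_def)
    also have "insert {P n, p n} (dom \<xi>') = insert {x, p 0} (dom \<xi>)"
      unfolding IH(3) by (rule insert_Diff[OF Pnd])
    finally show ?thesis by (simp add: PS)
  qed
  moreover have "miss \<psi> (P (Suc n)) (col (Suc n))"
    using IH(5) colS(2) by (auto simp: miss_def \<psi>_def PS)
  moreover have "miss \<psi> (p (Suc n)) (col (Suc (Suc n)))"
    unfolding miss_def colS(1)
  proof (intro conjI allI notI)
    show "col n \<le> d" using IH(4) by (simp add: miss_def)
    fix u assume u: "\<psi> {p (Suc n), u} = Some (col n)"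
    have "p (Suc n) \<notin> {P n, p n}" using inj px by (auto simp: P_def)
    then have "{p (Suc n), u} \<noteq> {P n, p n}" by auto
    then have "\<xi>' {p (Suc n), u} = Some (col n)" "{p (Suc n), u} \<noteq> {p n, p (Suc n)}"
      using u by (auto simp: \<psi>_def split: if_splits)
    moreover from this(1) have "u = p n"
      using pcol_unique[OF IH(1), of "p (Suc n)" u "col n" "p n"] e by (simp add: insert_commute)
    ultimately show False by (simp add: insert_commute)
  qed
  moreover have "\<psi> {P i, p i} = Some (col i)" if "i < Suc n" for i
    using that IH(6) neq[of i "Suc n"] neq[of i n] PS[of n] by (auto simp: \<psi>_def less_Suc_eq)
  moreover have "\<psi> e = \<xi> e" if "\<forall>i\<le>Suc n. e \<noteq> {P i, p i}" for e
    using that IH(7) PS[of n] by (auto simp: \<psi>_def)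
  ultimately show ?case by blast
qed

text \<open>Once shifted to a proper end of the walk, the uncolored edge has \<open>col n\<close>
  missing at both ends: at \<open>p n\<close> because the shift has not touched the other edges
  there.\<close>

lemma kempe_shift_complete:
  fixes p :: "nat \<Rightarrow> 'a" and x :: 'a and \<gamma> \<delta> :: nat
  defines "P \<equiv> \<lambda>i. if i = 0 then x else p (i - 1)" and "col \<equiv> \<lambda>i. if even i then \<gamma> else \<delta>"
  assumes \<xi>: "pcol \<xi>" "{x, p 0} \<in> E" "\<xi> {x, p 0} = None" "miss \<xi> x \<gamma>" "miss \<xi> (p 0) \<delta>" "\<gamma> \<noteq> \<delta>"
    and p: "awalk \<xi> \<gamma> \<delta> p n" "\<And>i. i \<le> n \<Longrightarrow> p i \<noteq> x" and last: "miss \<xi> (p n) (col n)"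
  shows "\<exists>\<xi>'. pcol \<xi>' \<and> dom \<xi>' = insert {x, p 0} (dom \<xi>) \<and>
    (\<forall>e. (\<forall>i\<le>n. e \<noteq> {P i, p i}) \<longrightarrow> \<xi>' e = \<xi> e)"
proof -
  have "\<exists>\<xi>'. pcol \<xi>' \<and> \<xi>' {P n, p n} = None \<and> dom \<xi>' = insert {x, p 0} (dom \<xi>) - {{P n, p n}} \<and>
    miss \<xi>' (P n) (col n) \<and> miss \<xi>' (p n) (col (Suc n)) \<and>
    (\<forall>i<n. \<xi>' {P i, p i} = Some (col i)) \<and> (\<forall>e. (\<forall>i\<le>n. e \<noteq> {P i, p i}) \<longrightarrow> \<xi>' e = \<xi> e)"
    unfolding P_def col_def by (rule kempe_shift[OF \<xi> p])
  then obtain \<xi>' where \<xi>': "pcol \<xi>'" "\<xi>' {P n, p n} = None"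
    "dom \<xi>' = insert {x, p 0} (dom \<xi>) - {{P n, p n}}"
    "miss \<xi>' (P n) (col n)" "\<forall>i<n. \<xi>' {P i, p i} = Some (col i)"
    "\<forall>e. (\<forall>i\<le>n. e \<noteq> {P i, p i}) \<longrightarrow> \<xi>' e = \<xi> e"
    by (elim exE conjE) (rule that)
  have inj: "p i = p j \<longleftrightarrow> i = j" if "i \<le> n" "j \<le> n" for i j
    using awalk_inj[OF \<xi>(1) p(1) \<xi>(5)] that by blast
  have "{P n, p n} \<in> insert {x, p 0} (dom \<xi>) \<and> {P n, p n} \<in> E"
  proof (cases n)
    case 0
    then show ?thesis using \<xi> by (simp add: P_def)
  next
    case (Suc m)
    then have "\<xi> {P n, p n} = Some (col m)" using awalkD[OF p(1), of m] by (simp add: P_def col_def)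
    then show ?thesis using pcol_edge[OF \<xi>(1)] by blast
  qed
  moreover have "miss \<xi>' (p n) (col n)"
    unfolding miss_def
  proof (intro conjI allI)
    show "col n \<le> d" using last by (simp add: miss_def)
    fix u
    show "\<xi>' {p n, u} \<noteq> Some (col n)"
    proof (cases "\<exists>i\<le>n. {p n, u} = {P i, p i}")
      case True
      then obtain i where i: "i \<le> n" "{p n, u} = {P i, p i}" by blast
      have "i = n"
      proof (rule ccontr)
        assume "i \<noteq> n"
        then have "p n \<noteq> p i" "p n \<noteq> P i" using i(1) inj p(2)[of n] by (auto simp: P_def)
        then show False using i(2) by (auto simp: doubleton_eq_iff)
      qed
      then show ?thesis using \<xi>'(2) i(2) by simp
    next
      case False
      then show ?thesis using \<xi>'(6) missD[OF last] by simp
    qed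
  qed
  ultimately have "pcol (\<xi>'({P n, p n} := Some (col n)))" "dom (\<xi>'({P n, p n} := Some (col n))) = insert {x, p 0} (dom \<xi>)"
    using pcol_fill[OF \<xi>'(1) _ \<xi>'(4)] \<xi>'(3) by auto
  then show ?thesis using \<xi>'(6) by (intro exI[of _ "\<xi>'({P n, p n} := Some (col n))"]) auto
qed

end

section \<open>Multi-step Vizing chains\<close>

text \<open>\<open>{sx, sy}\<close> is the uncolored edge. The two colors of the last chain are \<open>sa\<close>, missing at
  \<open>sy\<close>, and \<open>sb\<close>, missing at \<open>sx\<close>; initially both are the non-color \<open>Suc d\<close>.\<close>

datatype 'a state = State (sc: "'a set \<Rightarrow> nat option") (sx: 'a) (sy: 'a) (sa: nat) (sb: nat)

context bounded_graph
begin

section \<open>Balls, and bounds on the possible predecessors of a chain\<close>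

primrec gball :: "nat \<Rightarrow> 'a \<Rightarrow> 'a set" where
  "gball 0 x = {x}"
| "gball (Suc n) x = gball n x \<union> (\<Union>u\<in>gball n x. nbrs u)"

lemma gball_centre [simp]: "x \<in> gball n x"
  by (induction n) auto

lemma gball_mono: "m \<le> n \<Longrightarrow> gball m x \<subseteq> gball n x"
  by (induction n) (auto simp: le_Suc_eq)

lemma gball_step: "u \<in> gball n x \<Longrightarrow> {u, w} \<in> E \<Longrightarrow> w \<in> gball (Suc n) x"
  by (auto simp: mem_nbrs)

lemma gball_trans: "u \<in> gball n x \<Longrightarrow> w \<in> gball m u \<Longrightarrow> w \<in> gball (n + m) x"
  by (induction m arbitrary: w) auto

lemma gball_sym: "u \<in> gball n x \<Longrightarrow> x \<in> gball n u"
proof (induction n arbitrary: u)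
  case (Suc n)
  then consider "u \<in> gball n x" | v where "v \<in> gball n x" "{v, u} \<in> E" by (auto simp: mem_nbrs)
  then show ?case
  proof cases
    case 1
    then show ?thesis using Suc by auto
  next
    case 2
    then have "v \<in> gball 1 u" by (auto simp: mem_nbrs insert_commute)
    then show ?thesis using gball_trans[of v 1 u x n] Suc.IH[OF 2(1)] by simp
  qed
qed simp

lemma finite_gball [simp]: "finite (gball n x)"
  by (induction n) auto

declare gball.simps(2) [simp del]

lemma gball_Suc_mono: "gball n x \<subseteq> gball (Suc n) x"
  by (rule gball_mono) simp

text \<open>Where a Kempe chain through \<open>v\<close> may have begun, judged in the coloring
  \<open>\<psi>\<close>. The start misses the second color, as the fan leaf that starts a chain
  does.\<close>

definition ends_at :: "('a set \<Rightarrow> nat option) \<Rightarrow> 'a \<Rightarrow> 'a set" where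
  "ends_at \<psi> v = insert v
     {z. \<exists>c c' p n. c \<le> d \<and> c' \<le> d \<and> p 0 = z \<and> awalk \<psi> c c' p n \<and> p n = v \<and> miss \<psi> z c'}"

text \<open>The holes, that is oriented uncolored edges, whose chain may run through
  \<open>v\<close>: \<open>z\<close> is the leaf at which the walk starts and \<open>x\<close> the
  fan centre.\<close>

definition pred_holes :: "('a set \<Rightarrow> nat option) \<Rightarrow> 'a \<Rightarrow> ('a \<times> 'a) set" where
  "pred_holes \<psi> v = {(x, y). \<exists>z\<in>ends_at \<psi> v. {z, x} \<in> E \<and> {x, y} \<in> E}"

text \<open>By \<open>awalk_end_unique\<close> there is at most one start for each of the
  \<open>(d + 1) ^ 2\<close> color pairs and each parity; the remaining one is \<open>v\<close>
  itself.\<close>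

definition ends_bound :: nat where "ends_bound = 2 * (d + 1) ^ 2 + 1"

lemma card_UN_bound:
  assumes "finite I" "\<And>i. i \<in> I \<Longrightarrow> card (A i) \<le> k" "card I \<le> n"
  shows "card (\<Union>i\<in>I. A i) \<le> n * k"
proof -
  have "card (\<Union>i\<in>I. A i) \<le> (\<Sum>i\<in>I. card (A i))" using assms(1) by (rule card_UN_le)
  also have "\<dots> \<le> card I * k" using sum_bounded_above[of I "\<lambda>i. card (A i)" k] assms(2) by simp
  also have "\<dots> \<le> n * k" using assms(3) by simp
  finally show ?thesis .
qed

lemma ends_at_bound:
  assumes "pcol \<psi>"
  shows "finite (ends_at \<psi> v)" "card (ends_at \<psi> v) \<le> ends_bound"
proof -
  define A where "A t = (case t of (c, c', b) \<Rightarrow>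
    {z. \<exists>p n. p 0 = z \<and> awalk \<psi> c c' p n \<and> p n = v \<and> miss \<psi> z c' \<and> even n = b})" for t
  let ?I = "{..d} \<times> {..d} \<times> (UNIV :: bool set)"
  have single: "\<exists>a. A t \<subseteq> {a}" for t
  proof (cases "A t = {}")
    case False
    obtain c c' b where t: "t = (c, c', b)" by (cases t)
    obtain a where a: "a \<in> A t" using False by blast
    have "z = a" if zA: "z \<in> A t" for z
    proof -
      obtain p n where p: "p 0 = z" "awalk \<psi> c c' p n" "p n = v" "miss \<psi> z c'" "even n = b"
        using zA unfolding A_def t by auto
      obtain q k where q: "q 0 = a" "awalk \<psi> c c' q k" "q k = v" "miss \<psi> a c'" "even k = b"
        using a unfolding A_def t by auto
      show ?thesis using awalk_end_unique[OF assms p(2) q(2)] p q by simp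
    qed
    then show ?thesis by auto
  qed auto
  have fA: "finite (A t)" "card (A t) \<le> 1" for t
  proof -
    obtain a where "A t \<subseteq> {a}" using single by blast
    then show "finite (A t)" "card (A t) \<le> 1"
      using finite_subset[of "A t" "{a}"] card_mono[of "{a}" "A t"] by auto
  qed
  have eq: "ends_at \<psi> v = insert v (\<Union>t\<in>?I. A t)"
    unfolding ends_at_def A_def by auto
  show "finite (ends_at \<psi> v)" unfolding eq using fA by auto
  have "card (\<Union>t\<in>?I. A t) \<le> 2 * (d + 1) ^ 2 * 1"
    by (rule card_UN_bound) (use fA in \<open>auto simp: card_cartesian_product power2_eq_square\<close>)
  then show "card (ends_at \<psi> v) \<le> ends_bound"
    unfolding eq ends_bound_def using card_insert_le_m1[of "2 * (d + 1) ^ 2 + 1" "\<Union>t\<in>?I. A t" v] fA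
    by (auto simp: card_insert_if)
qed

lemma pred_holes_bound:
  assumes "pcol \<psi>"
  shows "finite (pred_holes \<psi> v)" "card (pred_holes \<psi> v) \<le> ends_bound * (d * d)"
proof -
  have eq: "pred_holes \<psi> v = (\<Union>z\<in>ends_at \<psi> v. \<Union>x\<in>nbrs z. {x} \<times> nbrs x)"
    by (auto simp: pred_holes_def mem_nbrs)
  show "finite (pred_holes \<psi> v)" unfolding eq using ends_at_bound[OF assms] by auto
  have "card (\<Union>x\<in>nbrs z. {x} \<times> nbrs x) \<le> d * d" for z
    by (rule card_UN_bound) (auto simp: card_nbrs' card_cartesian_product)
  then show "card (pred_holes \<psi> v) \<le> ends_bound * (d * d)"
    unfolding eq by (rule card_UN_bound[OF ends_at_bound(1)[OF assms] _ ends_at_bound(2)[OF assms]])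
qed

end

text \<open>This locale hosts an argument by contradiction: for suitable \<open>L\<close> and \<open>R\<close> it has no models.\<close>

locale stuck = bounded_graph +
  fixes \<phi> :: "'a set \<Rightarrow> nat option" and x0 y0 :: 'a and L R :: nat
  assumes \<phi>: "pcol \<phi>" and xy0: "{x0, y0} \<in> E" "\<phi> {x0, y0} = None"
    and stuck: "\<And>\<psi>. pcol \<psi> \<Longrightarrow> dom \<psi> = insert {x0, y0} (dom \<phi>) \<Longrightarrow>
      \<exists>e. \<psi> e \<noteq> \<phi> e \<and> \<not> e \<subseteq> gball R x0"
begin

text \<open>\<open>m\<close> bounds how far the changes have spread. The domain conditions ensure
  that filling the hole yields exactly the domain that \<open>stuck\<close> forbids for small
  changes; the color conditions are those of \<open>vizing_fan\<close>.\<close>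

definition ok :: "nat \<Rightarrow> 'a state \<Rightarrow> bool" where
  "ok m s \<longleftrightarrow> pcol (sc s) \<and> {sx s, sy s} \<in> E \<and> sc s {sx s, sy s} = None \<and>
    (sa s \<le> d \<longleftrightarrow> sb s \<le> d) \<and> (sb s \<le> d \<longrightarrow> miss (sc s) (sx s) (sb s)) \<and>
    (sa s \<le> d \<longrightarrow> miss (sc s) (sy s) (sa s)) \<and>
    dom (sc s) = insert {x0, y0} (dom \<phi>) - {{sx s, sy s}} \<and> {sx s, sy s} \<in> insert {x0, y0} (dom \<phi>) \<and>
    sx s \<in> gball m x0 \<and> (\<forall>e. sc s e \<noteq> \<phi> e \<longrightarrow> e \<subseteq> gball m x0)"

text \<open>Here and in \<open>wk\<close> and \<open>child\<close> all choices are fixed by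
  \<open>SOME\<close>, so that the sequence of cuts alone determines the state and counting
  sequences makes sense.\<close>

definition out :: "'a state \<Rightarrow> ('a set \<Rightarrow> nat option) \<times> 'a \<times> nat \<times> nat" where
  "out s = (SOME (\<xi>, z, \<gamma>, \<delta>). fan_out (sc s) (sx s) (sy s) (sa s) (sb s) \<xi> z \<gamma> \<delta>)"

definition "fc s = fst (out s)"
definition "fz s = fst (snd (out s))"
definition "fg s = fst (snd (snd (out s)))"
definition "fd s = snd (snd (snd (out s)))"
definition "fcol s i = (if even (i::nat) then fg s else fd s)"

text \<open>\<open>kempe_shift\<close> needs a walk that does not return to the fan centre.
  \<open>fan_out\<close> provides this only in its first alternative; for the second see
  \<open>stuck_step_bicolor\<close>.\<close>

definition nohit :: "'a state \<Rightarrow> bool" where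
  "nohit s \<longleftrightarrow> (\<forall>p n. p 0 = fz s \<longrightarrow> awalk (sc s) (fg s) (fd s) p n \<longrightarrow> p n \<noteq> sx s)"

definition wk :: "'a state \<Rightarrow> nat \<Rightarrow> 'a" where
  "wk s = (SOME p. p 0 = fz s \<and> awalk (fc s) (fg s) (fd s) p (Suc L))"

definition cut :: "'a state \<Rightarrow> nat \<Rightarrow> ('a set \<Rightarrow> nat option) \<Rightarrow> bool" where
  "cut s l \<psi> \<longleftrightarrow> pcol \<psi> \<and> \<psi> {wk s l, wk s (Suc l)} = None \<and>
    dom \<psi> = insert {sx s, wk s 0} (dom (fc s)) - {{wk s l, wk s (Suc l)}} \<and>
    miss \<psi> (wk s l) (fcol s (Suc l)) \<and> miss \<psi> (wk s (Suc l)) (fcol s l) \<and>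
    (\<forall>i<l. \<psi> {wk s i, wk s (Suc i)} = Some (fcol s (Suc i))) \<and>
    (\<forall>e. e \<noteq> {sx s, wk s 0} \<longrightarrow> (\<forall>i\<le>l. e \<noteq> {wk s i, wk s (Suc i)}) \<longrightarrow> \<psi> e = fc s e)"

definition child :: "'a state \<Rightarrow> nat \<Rightarrow> 'a state" where
  "child s l = State (SOME \<psi>. cut s l \<psi>) (wk s l) (wk s (Suc l)) (fcol s l) (fcol s (Suc l))"

lemma child_simps [simp]: "sx (child s l) = wk s l" "sy (child s l) = wk s (Suc l)"
  "sa (child s l) = fcol s l" "sb (child s l) = fcol s (Suc l)"
  by (simp_all add: child_def)

abbreviation is_fan_out :: "'a state \<Rightarrow> bool" where
  "is_fan_out s \<equiv> fan_out (sc s) (sx s) (sy s) (sa s) (sb s) (fc s) (fz s) (fg s) (fd s)"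

lemma okD:
  assumes "ok m s"
  shows "pcol (sc s)" "{sx s, sy s} \<in> E" "sc s {sx s, sy s} = None" "sa s \<le> d \<longleftrightarrow> sb s \<le> d"
    "sb s \<le> d \<Longrightarrow> miss (sc s) (sx s) (sb s)" "sa s \<le> d \<Longrightarrow> miss (sc s) (sy s) (sa s)"
    "dom (sc s) = insert {x0, y0} (dom \<phi>) - {{sx s, sy s}}" "{sx s, sy s} \<in> insert {x0, y0} (dom \<phi>)"
    "sx s \<in> gball m x0" "sc s e \<noteq> \<phi> e \<Longrightarrow> e \<subseteq> gball m x0"
  using assms unfolding ok_def by simp_all

lemma stuck_contr:
  assumes "pcol \<psi>" "dom \<psi> = insert {x0, y0} (dom \<phi>)" "\<And>e. \<psi> e \<noteq> \<phi> e \<Longrightarrow> e \<subseteq> gball m x0" "m \<le> R"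
  shows False
  using stuck[OF assms(1,2)] assms(3) gball_mono[OF assms(4)] by blast

lemma edge_in_gball:
  assumes "e \<in> E" "x \<in> e" "x \<in> gball m x0"
  shows "e \<subseteq> gball (Suc m) x0"
proof -
  obtain a b where "e = {a, b}" using edgeE'[OF assms(1)] by blast
  then have "e = {x, a} \<or> e = {x, b}" using assms(2) by auto
  then obtain u where "e = {x, u}" by blast
  then show ?thesis using gball_step[OF assms(3), of u] gball_mono[of m "Suc m"] assms by auto
qed

text \<open>Otherwise the fan alone would color the hole, with changes within distance
  \<open>Suc m\<close>, against \<open>stuck\<close>.\<close>

lemma fan_out_ex:
  assumes "ok m s" "Suc m \<le> R"
  shows "is_fan_out s"
proof -
  note ok = okD[OF assms(1)]
  have "\<not> fan_done (sc s) (sx s) (sy s)"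
  proof
    assume "fan_done (sc s) (sx s) (sy s)"
    then obtain \<xi> where \<xi>: "pcol \<xi>" "dom \<xi> = insert {sx s, sy s} (dom (sc s))" "\<And>e. sx s \<notin> e \<Longrightarrow> \<xi> e = sc s e"
      unfolding fan_done_def by blast
    have "dom \<xi> = insert {x0, y0} (dom \<phi>)"
      unfolding \<xi>(2) ok(7) by (rule insert_Diff[OF ok(8)])
    then show False
    proof (rule stuck_contr[OF \<xi>(1) _ _ assms(2)])
      fix e assume e: "\<xi> e \<noteq> \<phi> e"
      show "e \<subseteq> gball (Suc m) x0"
      proof (cases "sx s \<in> e")
        case True
        have "e \<in> E" using e pcol_edge[OF \<xi>(1), of e] pcol_edge[OF \<phi>, of e]
          by (cases "\<xi> e"; cases "\<phi> e") auto
        then show ?thesis using edge_in_gball True ok(9) by blast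
      next
        case False
        then have "e \<subseteq> gball m x0" using \<xi>(3) e ok(10) by simp
        then show ?thesis using gball_Suc_mono by blast
      qed
    qed
  qed
  then have "\<exists>r. case r of (\<xi>, z, \<gamma>, \<delta>) \<Rightarrow> fan_out (sc s) (sx s) (sy s) (sa s) (sb s) \<xi> z \<gamma> \<delta>"
    using vizing_fan[OF ok(1-6)] by auto
  then have "case out s of (\<xi>, z, \<gamma>, \<delta>) \<Rightarrow> fan_out (sc s) (sx s) (sy s) (sa s) (sb s) \<xi> z \<gamma> \<delta>"
    unfolding out_def by (rule someI_ex)
  then show ?thesis by (simp add: fc_def fz_def fg_def fd_def split: prod.splits)
qed

end

text \<open>The leaf is at distance one from the fan centre and the walk has \<open>Suc L\<close>
  edges, so a step spreads the changes by at most \<open>L + 2\<close>.\<close>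

locale stuck_step = stuck +
  fixes s :: "'a state" and m :: nat
  assumes ok: "ok m s" and nohit: "nohit s" and mR: "m + L + 2 \<le> R"
begin

abbreviation "p \<equiv> wk s"

lemmas ok' = okD(1-3,7-10)[OF ok]

lemma is_fan_out: "is_fan_out s"
  using fan_out_ex[OF ok] mR by simp

lemmas fo = fan_outD[OF is_fan_out]

lemma hole_le: "fg s \<le> d" "fd s \<le> d"
  using fo(4,5) by (auto simp: miss_def)

lemma walk_avoids: "q 0 = fz s \<Longrightarrow> awalk (fc s) (fg s) (fd s) q n \<Longrightarrow> i \<le> n \<Longrightarrow> q i \<noteq> sx s"
  using nohit fo(10)[of q i] awalk_mono[of "fc s" "fg s" "fd s" q n i] unfolding nohit_def by blast

lemma walk_in_gball:
  assumes "q 0 = fz s" "awalk (fc s) (fg s) (fd s) q n" "i \<le> n"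
  shows "q i \<in> gball (m + i + 1) x0"
  using assms(3)
proof (induction i)
  case 0
  then show ?case using gball_step[OF ok'(6) fo(2)] assms(1) by simp
next
  case (Suc i)
  then have "{q i, q (Suc i)} \<in> E" using awalkD[OF assms(2), of i] pcol_edge[OF fo(1)] by simp
  then show ?case using gball_step[OF Suc.IH, of "q (Suc i)"] Suc.prems by simp
qed

lemma dom_fc: "insert {sx s, fz s} (dom (fc s)) = insert {x0, y0} (dom \<phi>)"
proof -
  have "insert {sx s, fz s} (dom (fc s)) = insert {sx s, sy s} (dom (sc s))"
    unfolding fo(9) by (rule insert_Diff[OF fo(11)])
  also have "\<dots> = insert {x0, y0} (dom \<phi>)"
    unfolding ok'(4) by (rule insert_Diff[OF ok'(5)])
  finally show ?thesis .
qed

lemma walk_edge_in_gball: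
  assumes "q 0 = fz s" "awalk (fc s) (fg s) (fd s) q n" "i \<le> n"
  shows "{if i = 0 then sx s else q (i - 1), q i} \<subseteq> gball (m + n + 1) x0"
proof -
  have "q j \<in> gball (m + n + 1) x0" if "j \<le> n" for j
    using walk_in_gball[OF assms(1,2) that] gball_mono[of "m + j + 1" "m + n + 1" x0] that by auto
  moreover have "sx s \<in> gball (m + n + 1) x0"
    using ok'(6) gball_mono[of m "m + n + 1" x0] by auto
  ultimately show ?thesis using assms(3) by auto
qed

lemma fc_change:
  assumes "fc s e \<noteq> \<phi> e"
  shows "e \<subseteq> gball (Suc m) x0"
proof (cases "sx s \<in> e")
  case True
  have "e \<in> E" using assms pcol_edge[OF fo(1), of e] pcol_edge[OF \<phi>, of e]
    by (cases "fc s e"; cases "\<phi> e") auto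
  then show ?thesis using edge_in_gball True ok'(6) by blast
next
  case False
  then have "sc s e \<noteq> \<phi> e" using assms fo(8) by simp
  then have "e \<subseteq> gball m x0" by (rule ok'(7))
  then show ?thesis using gball_Suc_mono by blast
qed

text \<open>At a vertex where the next color is missing, the walk could be shifted completely, which
  would color the hole within distance \<open>R\<close>.\<close>

lemma walk_ex: "n \<le> Suc L \<Longrightarrow> \<exists>q. q 0 = fz s \<and> awalk (fc s) (fg s) (fd s) q n"
proof (induction n)
  case 0
  show ?case by (intro exI[of _ "\<lambda>_. fz s"]) simp
next
  case (Suc n)
  then obtain q where q: "q 0 = fz s" "awalk (fc s) (fg s) (fd s) q n" by auto
  have "\<not> miss (fc s) (q n) (if even n then fg s else fd s)"
  proof
    assume last: "miss (fc s) (q n) (if even n then fg s else fd s)"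
    have q0: "{sx s, q 0} \<in> E" "fc s {sx s, q 0} = None" "miss (fc s) (q 0) (fd s)"
      using fo q(1) by simp_all
    obtain \<xi>' where \<xi>': "pcol \<xi>'" "dom \<xi>' = insert {sx s, q 0} (dom (fc s))"
        "\<forall>e. (\<forall>i\<le>n. e \<noteq> {if i = 0 then sx s else q (i - 1), q i}) \<longrightarrow> \<xi>' e = fc s e"
      using kempe_shift_complete[OF fo(1) q0(1,2) fo(4) q0(3) fo(7) q(2) walk_avoids[OF q] last]
      by blast
    have "dom \<xi>' = insert {x0, y0} (dom \<phi>)" using \<xi>'(2) dom_fc q(1) by simp
    then show False
    proof (rule stuck_contr[OF \<xi>'(1)])
      fix e assume e: "\<xi>' e \<noteq> \<phi> e"
      show "e \<subseteq> gball (m + n + 1) x0"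
      proof (cases "\<exists>i\<le>n. e = {if i = 0 then sx s else q (i - 1), q i}")
        case True
        then show ?thesis using walk_edge_in_gball[OF q] by blast
      next
        case False
        then have "fc s e \<noteq> \<phi> e" using \<xi>'(3) e by metis
        then have "e \<subseteq> gball (Suc m) x0" by (rule fc_change)
        then show ?thesis using gball_mono[of "Suc m" "m + n + 1" x0] by simp
      qed
    qed (use Suc.prems mR in auto)
  qed
  moreover have "(if even n then fg s else fd s) \<le> d" using hole_le by simp
  ultimately obtain w where "fc s {q n, w} = Some (if even n then fg s else fd s)"
    by (auto simp: miss_def split: if_splits)
  from awalk_extend[OF q(2) this] have "awalk (fc s) (fg s) (fd s) (q(Suc n := w)) (Suc n)" .
  moreover have "(q(Suc n := w)) 0 = fz s" using q(1) by simp
  ultimately show ?case by blast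
qed

lemma p0: "p 0 = fz s" and pwalk: "awalk (fc s) (fg s) (fd s) p (Suc L)"
proof -
  have "\<exists>q. q 0 = fz s \<and> awalk (fc s) (fg s) (fd s) q (Suc L)" using walk_ex by blast
  then have "p 0 = fz s \<and> awalk (fc s) (fg s) (fd s) p (Suc L)"
    unfolding wk_def by (rule someI_ex)
  then show "p 0 = fz s" "awalk (fc s) (fg s) (fd s) p (Suc L)" by auto
qed

lemma pwalk': "awalk (sc s) (fg s) (fd s) p (Suc L)"
  by (rule fo(10)[OF p0 pwalk])

lemma p_col: "i \<le> L \<Longrightarrow> sc s {p i, p (Suc i)} = Some (fcol s i)"
  using awalkD[OF pwalk', of i] by (simp add: fcol_def)

lemma p_col': "i \<le> L \<Longrightarrow> fc s {p i, p (Suc i)} = Some (fcol s i)"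
  using awalkD[OF pwalk, of i] by (simp add: fcol_def)

lemma px: "i \<le> Suc L \<Longrightarrow> p i \<noteq> sx s"
  by (rule walk_avoids[OF p0 pwalk])

lemma pinj: "i \<le> Suc L \<Longrightarrow> j \<le> Suc L \<Longrightarrow> p i = p j \<longleftrightarrow> i = j"
  using awalk_inj[OF fo(1) pwalk, of i j] fo(5) p0 by auto

lemma p_edge: "i \<le> L \<Longrightarrow> {p i, p (Suc i)} \<in> E"
  using p_col[of i] pcol_edge[OF ok'(1)] by blast

lemma cut_ex:
  assumes "l \<le> L"
  shows "cut s l (sc (child s l))"
proof -
  have q0: "{sx s, p 0} \<in> E" "fc s {sx s, p 0} = None" "miss (fc s) (p 0) (fd s)"
    using fo p0 by simp_all
  have w: "awalk (fc s) (fg s) (fd s) p (Suc l)" using awalk_mono[OF pwalk, of "Suc l"] assms by simp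
  \<comment> \<open>In \<open>kempe_shift\<close> edge number 0 is \<open>{sx s, p 0}\<close>, so
    the edge \<open>{p l, p (Suc l)}\<close> has number \<open>Suc l\<close>.\<close>
  have "\<exists>\<xi>'. pcol \<xi>' \<and> \<xi>' {p l, p (Suc l)} = None \<and> dom \<xi>' = insert {sx s, p 0} (dom (fc s)) - {{p l, p (Suc l)}} \<and>
    miss \<xi>' (p l) (fcol s (Suc l)) \<and> miss \<xi>' (p (Suc l)) (fcol s (Suc (Suc l))) \<and>
    (\<forall>i<Suc l. \<xi>' {if i = 0 then sx s else p (i - 1), p i} = Some (fcol s i)) \<and>
    (\<forall>e. (\<forall>i\<le>Suc l. e \<noteq> {if i = 0 then sx s else p (i - 1), p i}) \<longrightarrow> \<xi>' e = fc s e)"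
    using kempe_shift[OF fo(1) q0(1,2) fo(4) q0(3) fo(7) w px] assms unfolding fcol_def by simp
  then obtain \<xi>' where \<xi>': "pcol \<xi>'" "\<xi>' {p l, p (Suc l)} = None"
    "dom \<xi>' = insert {sx s, p 0} (dom (fc s)) - {{p l, p (Suc l)}}"
    "miss \<xi>' (p l) (fcol s (Suc l))" "miss \<xi>' (p (Suc l)) (fcol s (Suc (Suc l)))"
    "\<forall>i<Suc l. \<xi>' {if i = 0 then sx s else p (i - 1), p i} = Some (fcol s i)"
    "\<forall>e. (\<forall>i\<le>Suc l. e \<noteq> {if i = 0 then sx s else p (i - 1), p i}) \<longrightarrow> \<xi>' e = fc s e"
    by blast
  have "cut s l \<xi>'"
    unfolding cut_def
  proof (intro conjI allI impI)
    show "miss \<xi>' (p (Suc l)) (fcol s l)" using \<xi>'(5) by (simp add: fcol_def)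
    show "\<xi>' {p i, p (Suc i)} = Some (fcol s (Suc i))" if "i < l" for i
      using \<xi>'(6)[THEN spec, of "Suc i"] that by simp
    fix e assume e: "e \<noteq> {sx s, p 0}" "\<forall>i\<le>l. e \<noteq> {p i, p (Suc i)}"
    have "e \<noteq> {if i = 0 then sx s else p (i - 1), p i}" if "i \<le> Suc l" for i
      using e that by (cases i) auto
    then show "\<xi>' e = fc s e" using \<xi>'(7) by blast
  qed (fact \<xi>')+
  then have "cut s l (SOME \<psi>. cut s l \<psi>)" by (rule someI[of "cut s l"])
  then show ?thesis by (simp add: child_def)
qed

lemma child_change:
  assumes "l \<le> L" "sc (child s l) e \<noteq> sc s e"
  shows "e \<in> E \<and> sx s \<in> e \<or> (\<exists>i\<le>l. e = {p i, p (Suc i)})"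
proof (rule ccontr)
  assume n: "\<not> ?thesis"
  have c: "cut s l (sc (child s l))" using cut_ex[OF assms(1)] .
  have "e \<in> E" using assms(2) c pcol_edge[of "sc (child s l)" e] pcol_edge[OF ok'(1), of e]
    unfolding cut_def by (cases "sc (child s l) e"; cases "sc s e") auto
  then have "sx s \<notin> e" "\<forall>i\<le>l. e \<noteq> {p i, p (Suc i)}" using n by auto
  then have "sc (child s l) e = fc s e" using c unfolding cut_def by auto
  also have "\<dots> = sc s e" using \<open>sx s \<notin> e\<close> by (rule fo(8))
  finally show False using assms(2) by simp
qed

lemma child_path_col:
  assumes "l \<le> L" "i \<le> l"
  shows "sc (child s l) {p i, p (Suc i)} = (if i = l then None else Some (fcol s (Suc i)))"
  using cut_ex[OF assms(1)] assms(2) unfolding cut_def by auto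

lemma p_in_gball: "i \<le> Suc L \<Longrightarrow> p i \<in> gball (m + L + 2) x0"
  using walk_in_gball[OF p0 pwalk, of i] gball_mono[of "m + i + 1" "m + L + 2" x0] by auto

lemma child_ok:
  assumes "l \<le> L"
  shows "ok (m + L + 2) (child s l)"
proof -
  have c: "cut s l (sc (child s l))" using cut_ex[OF assms] .
  have d1: "insert {sx s, p 0} (dom (fc s)) = insert {x0, y0} (dom \<phi>)" using dom_fc p0 by simp
  have "{p l, p (Suc l)} \<in> dom (fc s)" using p_col'[OF assms] by blast
  then have "{p l, p (Suc l)} \<in> insert {x0, y0} (dom \<phi>)" unfolding d1[symmetric] by (rule insertI2)
  moreover have "e \<subseteq> gball (m + L + 2) x0" if e: "sc (child s l) e \<noteq> \<phi> e" for e
  proof (cases "sc (child s l) e = sc s e")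
    case True
    then have "e \<subseteq> gball m x0" using e ok'(7) by simp
    then show ?thesis using gball_mono[of m "m + L + 2" x0] by simp
  next
    case False
    from child_change[OF assms False] show ?thesis
    proof
      assume "e \<in> E \<and> sx s \<in> e"
      then have "e \<subseteq> gball (Suc m) x0" using edge_in_gball ok'(6) by blast
      then show ?thesis using gball_mono[of "Suc m" "m + L + 2" x0] by simp
    next
      assume "\<exists>i\<le>l. e = {p i, p (Suc i)}"
      then show ?thesis using p_in_gball assms by auto
    qed
  qed
  moreover have "fcol s i \<le> d" for i using hole_le by (simp add: fcol_def)
  ultimately show ?thesis
    using c p_edge[OF assms] p_in_gball[of l] assms unfolding ok_def cut_def d1 by simp
qed

abbreviation "T \<equiv> insert (sx s) (nbrs (sx s))"

lemma p0_T: "p 0 \<in> T"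
  using fo(2) p0 by (simp add: mem_nbrs)

text \<open>Edges at the fan centre stay inside \<open>T\<close>, so at a vertex outside
  \<open>T\<close> only the walk has changed anything.\<close>

lemma child_change_T:
  assumes "l \<le> L" "sc (child s l) e \<noteq> sc s e" "v \<in> e" "v \<notin> T"
  obtains i where "i \<le> l" "e = {p i, p (Suc i)}" "v = p i \<or> v = p (Suc i)"
proof -
  have "\<not> (e \<in> E \<and> sx s \<in> e)"
  proof
    assume e: "e \<in> E \<and> sx s \<in> e"
    then obtain a b where "e = {a, b}" using edgeE' by blast
    then have "v = sx s \<or> e = {sx s, v}" using e assms(3) by auto
    then show False using e assms(4) by (auto simp: mem_nbrs)
  qed
  then show ?thesis using child_change[OF assms(1,2)] that assms(3) by blast
qed

end

text \<open>If the fan at the cut vertex only offers the two colors of the previous walk, the next walk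
  starts at an end \<open>z'\<close> of a Kempe component of \<open>sc s\<close> in these colors. Unless \<open>z'\<close> is one of boundedly many
  ends related to the previous fan, that component is untouched by the previous step.\<close>

locale stuck_step_bicolor = stuck_step +
  fixes l :: nat and z' :: 'a
  assumes l: "l < L" and z': "miss (sc (child s l)) z' (fcol s l)" "{p l, z'} \<in> E"
    and only: "\<And>i. miss (sc (child s l)) z' i \<Longrightarrow> i = fcol s l \<or> i = fcol s (Suc l)"
    and notW: "\<And>v. v \<in> T \<Longrightarrow> z' \<notin> ends_at (sc s) v"
begin

lemma z'_T: "z' \<notin> T"
  using notW[of z'] by (auto simp: ends_at_def)

text \<open>An inner vertex of the shifted part carries both colors after the step, but
  \<open>z'\<close> misses \<open>fcol s l\<close>. The end \<open>p (Suc l)\<close> is different: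
  the step only removed a color there, so by \<open>only\<close> every color it missed before is one
  of the two; yet the walk, which continues beyond the cut because \<open>l < L\<close>, used both
  there.\<close>

lemma z'_p: "i \<le> Suc l \<Longrightarrow> z' \<noteq> p i"
proof
  assume i: "i \<le> Suc l" "z' = p i"
  have lL: "l \<le> L" using l by simp
  consider "i = 0" | "i = l" | "i = Suc l" | "0 < i" "i < l" using i(1) by linarith
  then show False
  proof cases
    case 1
    then show ?thesis using p0_T z'_T i by simp
  next
    case 2
    then show ?thesis using z'(2) i no_loop by simp
  next
    case 3
    obtain c where c: "miss (sc s) z' c" using miss_ex[OF ok'(1)] by blast
    have "miss (sc (child s l)) z' c"
      unfolding miss_def
    proof (intro conjI allI notI)
      show "c \<le> d" using c by (simp add: miss_def)
      fix y assume y: "sc (child s l) {z', y} = Some c"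
      then have "sc (child s l) {z', y} \<noteq> sc s {z', y}" using missD(1)[OF c, of y] by metis
      then obtain j where j: "j \<le> l" "{z', y} = {p j, p (Suc j)}" "z' = p j \<or> z' = p (Suc j)"
        using child_change_T[OF lL, of "{z', y}" z'] z'_T by blast
      then have "j = l" using i(2) 3 pinj l by auto
      then show False using j(2) y child_path_col[OF lL order_refl] by simp
    qed
    then have "c = fcol s l \<or> c = fcol s (Suc l)" by (rule only)
    then show ?thesis
      using missD[OF c] p_col[of l] p_col[of "Suc l"] i(2) 3 l by auto
  next
    case 4
    have "sc (child s l) {p (i - 1), z'} = Some (fcol s i)" "sc (child s l) {z', p (Suc i)} = Some (fcol s (Suc i))"
      using child_path_col[OF lL, of "i - 1"] child_path_col[OF lL, of i] 4 i(2) by auto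
    moreover have "fcol s l = fcol s i \<or> fcol s l = fcol s (Suc i)" by (simp add: fcol_def)
    ultimately show ?thesis using missD[OF z'(1)] by metis
  qed
qed

lemma unchanged:
  assumes "v \<notin> T" "\<And>i. i \<le> Suc l \<Longrightarrow> v \<noteq> p i" "v \<in> e"
  shows "sc (child s l) e = sc s e"
proof (rule ccontr)
  assume "sc (child s l) e \<noteq> sc s e"
  then obtain i where "i \<le> l" "v = p i \<or> v = p (Suc i)"
    using child_change_T[of l e v] l assms by auto
  then show False using assms(2)[of i] assms(2)[of "Suc i"] by auto
qed

lemma z'_miss: "miss (sc s) z' (fcol s l)"
  using z'(1) unchanged[OF z'_T z'_p] by (simp add: miss_def)

lemma walk_T:
  assumes "q 0 = z'" "awalk (sc s) (fcol s (Suc l)) (fcol s l) q n"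
  shows "q n \<notin> T"
proof
  assume "q n \<in> T"
  moreover have "fcol s i \<le> d" for i using hole_le by (simp add: fcol_def)
  then have "z' \<in> ends_at (sc s) (q n)"
    unfolding ends_at_def using assms z'_miss by blast
  ultimately show False using notW by blast
qed

text \<open>In \<open>sc s\<close> the previous walk alternates in the same two colors, so a
  component containing \<open>p (Suc i)\<close> also contains \<open>p i\<close>, and finally
  \<open>p 0\<close>, which lies in \<open>T\<close>.\<close>

lemma walk_p:
  assumes "i \<le> Suc l" "q 0 = z'" "awalk (sc s) (fcol s (Suc l)) (fcol s l) q n"
  shows "q n \<noteq> p i"
  using assms
proof (induction i arbitrary: q n)
  case 0
  then show ?case using walk_T p0_T by fastforce
next
  case (Suc i)
  show ?case
  proof
    assume qn: "q n = p (Suc i)"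
    have "sc s {q n, p i} = Some (fcol s i)"
      using p_col[of i] Suc.prems(1) l qn by (simp add: insert_commute)
    moreover have "fcol s i = fcol s (Suc l) \<or> fcol s i = fcol s l" by (simp add: fcol_def)
    ultimately obtain q' n' where "q' 0 = z'" "awalk (sc s) (fcol s (Suc l)) (fcol s l) q' n'" "q' n' = p i"
      using awalk_component_closed[OF ok'(1) z'_miss Suc.prems(2,3)] by blast
    then show False using Suc.IH[of q' n'] Suc.prems(1) by simp
  qed
qed

lemma walk_unchanged:
  assumes "q 0 = z'" "awalk (sc s) (fcol s (Suc l)) (fcol s l) q n" "q n \<in> e"
  shows "sc (child s l) e = sc s e"
  using unchanged[OF walk_T[OF assms(1,2)] walk_p[OF _ assms(1,2)] assms(3)] .

lemma child_walk:
  assumes "q 0 = z'" "awalk (sc (child s l)) (fcol s (Suc l)) (fcol s l) q n"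
  shows "awalk (sc s) (fcol s (Suc l)) (fcol s l) q n"
  using assms(2)
proof (induction n)
  case (Suc n)
  then have IH: "awalk (sc s) (fcol s (Suc l)) (fcol s l) q n" using awalk_mono by auto
  have "sc s {q n, q (Suc n)} = sc (child s l) {q n, q (Suc n)}"
    using walk_unchanged[OF assms(1) IH] by simp
  then show ?case using IH Suc.prems by (auto simp: awalk_def less_Suc_eq)
qed simp

lemma child_walk_avoids:
  assumes "q 0 = z'" "awalk (sc (child s l)) (fcol s (Suc l)) (fcol s l) q n"
  shows "q n \<noteq> p l"
  using walk_p[OF _ assms(1) child_walk[OF assms]] by simp

end

section \<open>Good cut sequences and the chains that meet older changes\<close>

context stuck
begin

text \<open>Cut sequences have the newest cut at the head.\<close>

primrec st :: "nat list \<Rightarrow> 'a state" where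
  "st [] = State \<phi> x0 y0 (Suc d) (Suc d)"
| "st (l # \<sigma>) = child (st \<sigma>) l"

definition hole :: "nat list \<Rightarrow> 'a \<times> 'a" where
  "hole \<sigma> = (sx (st \<sigma>), sy (st \<sigma>))"

definition centre_nbrs :: "'a state \<Rightarrow> 'a set" where
  "centre_nbrs s = insert (sx s) (nbrs (sx s))"

text \<open>Only the two colors of the chain are compared, since tracing its walk back in
  \<open>\<phi>\<close> depends on nothing else.\<close>

definition clean_at :: "'a state \<Rightarrow> nat \<Rightarrow> bool" where
  "clean_at s i \<longleftrightarrow> (\<forall>w. \<forall>c\<in>{fg s, fd s}. sc s {wk s i, w} = Some c \<longleftrightarrow> \<phi> {wk s i, w} = Some c)"

definition clean :: "'a state \<Rightarrow> bool" where
  "clean s \<longleftrightarrow> (\<forall>i\<le>L. clean_at s i)"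

text \<open>Contains every endpoint of an edge that a step from \<open>s\<close> can change, see
  \<open>touch_change\<close>.\<close>

definition touch :: "'a state \<Rightarrow> 'a set" where
  "touch s = centre_nbrs s \<union> wk s ` {..Suc L}"

text \<open>The first clause describes holes whose chain, while clean, may run into the fan just
  shifted; the second is the failure of \<open>notW\<close>. Both concern boundedly many cuts, see
  \<open>good_children\<close>.\<close>

definition bad_cut :: "nat list \<Rightarrow> nat \<Rightarrow> bool" where
  "bad_cut \<sigma> l \<longleftrightarrow> hole (l # \<sigma>) \<in> (\<Union>v\<in>centre_nbrs (st \<sigma>). pred_holes \<phi> v) \<or>
     fz (st (l # \<sigma>)) \<in> (\<Union>v\<in>centre_nbrs (st \<sigma>). ends_at (sc (st \<sigma>)) v)"

text \<open>Only clean states are extended, but the last state of a good sequence may be unclean: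
  \<open>unclean_dead\<close> accounts for these leaves of the tree.\<close>

primrec good :: "nat list \<Rightarrow> bool" where
  "good [] = True"
| "good (l # \<sigma>) = (good \<sigma> \<and> l < L \<and> clean (st \<sigma>) \<and> \<not> bad_cut \<sigma> l)"

lemma good_suffix: "good (\<rho> @ \<tau>) \<Longrightarrow> good \<tau>"
  by (induction \<rho>) auto

text \<open>An old color can only come from the second alternative of \<open>fan_out\<close>, in
  which both old colors return with exchanged roles.\<close>

lemma bicolor_step:
  assumes "stuck_step E d \<phi> x0 y0 L R (st \<sigma>) m" "l < L" "\<not> bad_cut \<sigma> l"
    and fout: "is_fan_out (st (l # \<sigma>))" and c3: "fg (st (l # \<sigma>)) \<in> {fcol (st \<sigma>) l, fcol (st \<sigma>) (Suc l)} \<or>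
      fd (st (l # \<sigma>)) \<in> {fcol (st \<sigma>) l, fcol (st \<sigma>) (Suc l)}"
  shows "stuck_step_bicolor E d \<phi> x0 y0 L R (st \<sigma>) m l (fz (st (l # \<sigma>)))"
    "fg (st (l # \<sigma>)) = fcol (st \<sigma>) (Suc l)" "fd (st (l # \<sigma>)) = fcol (st \<sigma>) l"
proof -
  interpret stuck_step E d \<phi> x0 y0 L R "st \<sigma>" m by fact
  have 3: "fg (st (l # \<sigma>)) = fcol (st \<sigma>) (Suc l)" "fd (st (l # \<sigma>)) = fcol (st \<sigma>) l"
      "\<forall>i. miss (sc (st (l # \<sigma>))) (fz (st (l # \<sigma>))) i \<longrightarrow> i \<in> {fcol (st \<sigma>) l, fcol (st \<sigma>) (Suc l)}"
    using fan_outD(12)[OF fout] c3 unfolding st.simps child_simps by blast+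
  then show "fg (st (l # \<sigma>)) = fcol (st \<sigma>) (Suc l)" "fd (st (l # \<sigma>)) = fcol (st \<sigma>) l" by auto
  have "miss (sc (st (l # \<sigma>))) (fz (st (l # \<sigma>))) (fd (st (l # \<sigma>)))" "{sx (st (l # \<sigma>)), fz (st (l # \<sigma>))} \<in> E"
    using fan_outD[OF fout] by blast+
  then show "stuck_step_bicolor E d \<phi> x0 y0 L R (st \<sigma>) m l (fz (st (l # \<sigma>)))"
    using 3 assms(2,3) unfolding bad_cut_def centre_nbrs_def
    by unfold_locales auto
qed

lemma good_inv:
  assumes "good \<sigma>" "(L + 2) * (length \<sigma> + 1) \<le> R"
  shows "stuck_step E d \<phi> x0 y0 L R (st \<sigma>) ((L + 2) * length \<sigma>)"
  using assms
proof (induction \<sigma>)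
  case Nil
  have ok: "ok 0 (st [])"
  proof -
    have "dom \<phi> = insert {x0, y0} (dom \<phi>) - {{x0, y0}}" using xy0(2) by auto
    then show ?thesis using \<phi> xy0 by (simp add: ok_def)
  qed
  have "is_fan_out (st [])" using fan_out_ex[OF ok] Nil by simp
  note fo = fan_outD[OF this]
  \<comment> \<open>At the root the old colors are the non-color \<open>Suc d\<close>, which rules
    out the second alternative of \<open>fan_out\<close>.\<close>
  have "fd (st []) \<noteq> Suc d" using fo(5) by (auto simp: miss_def)
  then have "nohit (st [])" using fo(12) by (simp add: nohit_def)
  then show ?case using ok Nil by unfold_locales auto
next
  case (Cons l \<sigma>)
  let ?m = "(L + 2) * length \<sigma>"
  have step: "stuck_step E d \<phi> x0 y0 L R (st \<sigma>) ?m" using Cons by simp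
  interpret stuck_step E d \<phi> x0 y0 L R "st \<sigma>" ?m by fact
  have l: "l < L" "\<not> bad_cut \<sigma> l" using Cons by auto
  have ok: "ok (?m + L + 2) (st (l # \<sigma>))" using child_ok[of l] l by simp
  have mR': "(?m + L + 2) + L + 2 \<le> R" using Cons.prems(2) by simp
  have fo': "is_fan_out (st (l # \<sigma>))" by (rule fan_out_ex[OF ok]) (use mR' in simp)
  have "nohit (st (l # \<sigma>))"
  proof (cases "fg (st (l # \<sigma>)) \<in> {fcol (st \<sigma>) l, fcol (st \<sigma>) (Suc l)} \<or>
      fd (st (l # \<sigma>)) \<in> {fcol (st \<sigma>) l, fcol (st \<sigma>) (Suc l)}")
    case True
    note b = bicolor_step[OF step l fo' True]
    interpret stuck_step_bicolor E d \<phi> x0 y0 L R "st \<sigma>" ?m l "fz (st (l # \<sigma>))" by (rule b(1))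
    show ?thesis unfolding nohit_def b(2,3) using child_walk_avoids by simp
  next
    case False
    then have "fg (st (l # \<sigma>)) \<noteq> fcol (st \<sigma>) (Suc l)" by blast
    then show ?thesis using fan_outD(12)[OF fo'] unfolding nohit_def by simp
  qed
  moreover have eq: "(L + 2) * length (l # \<sigma>) = ?m + L + 2" by simp
  ultimately show ?case unfolding eq using ok mR' by unfold_locales
qed

text \<open>As far as it is clean, the walk alternates in \<open>\<phi>\<close> as well, and its
  start misses the second color there. So the start lies in \<open>ends_at \<phi>\<close>, a small
  set that depends on the vertex reached and not on \<open>\<sigma>\<close>.\<close>

lemma hole_pred:
  assumes "stuck_step E d \<phi> x0 y0 L R (st \<sigma>) m" "i \<le> L" "\<And>j. j < i \<Longrightarrow> clean_at (st \<sigma>) j"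
  shows "hole \<sigma> \<in> pred_holes \<phi> (wk (st \<sigma>) i)"
proof -
  interpret stuck_step E d \<phi> x0 y0 L R "st \<sigma>" m by fact
  have "fz (st \<sigma>) \<in> ends_at \<phi> (wk (st \<sigma>) i)"
  proof (cases "i = 0")
    case True
    then show ?thesis using p0 by (simp add: ends_at_def)
  next
    case False
    have cl: "sc (st \<sigma>) {wk (st \<sigma>) j, w} = Some c \<longleftrightarrow> \<phi> {wk (st \<sigma>) j, w} = Some c"
      if "j < i" "c = fg (st \<sigma>) \<or> c = fd (st \<sigma>)" for j w c
      using assms(3)[OF that(1)] that(2) unfolding clean_at_def by auto
    have "miss \<phi> (fz (st \<sigma>)) (fd (st \<sigma>))"
      using fo(6) cl[of 0 "fd (st \<sigma>)"] False p0 by (simp add: miss_def)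
    moreover have "awalk \<phi> (fg (st \<sigma>)) (fd (st \<sigma>)) (wk (st \<sigma>)) i"
      unfolding awalk_def
    proof (intro allI impI)
      fix j assume "j < i"
      then show "\<phi> {wk (st \<sigma>) j, wk (st \<sigma>) (Suc j)} = Some (if even j then fg (st \<sigma>) else fd (st \<sigma>))"
        using awalkD[OF pwalk', of j] assms(2) cl[of j] by auto
    qed
    ultimately show ?thesis using p0 hole_le unfolding ends_at_def by blast
  qed
  then show ?thesis
    using fo(2) ok'(2) insert_commute[of "sx (st \<sigma>)" "fz (st \<sigma>)" "{}"]
    unfolding pred_holes_def hole_def by auto
qed

lemma hole_pred_Cons:
  assumes "good (l # \<sigma>)" "(L + 2) * (length \<sigma> + 1) \<le> R"
  shows "hole \<sigma> \<in> pred_holes \<phi> (fst (hole (l # \<sigma>)))"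
proof -
  have "stuck_step E d \<phi> x0 y0 L R (st \<sigma>) ((L + 2) * length \<sigma>)"
    using good_inv assms by simp
  from hole_pred[OF this, of l] show ?thesis
    using assms(1) by (simp add: hole_def clean_def)
qed

lemma change_origin:
  assumes "sc (st \<sigma>) e \<noteq> \<phi> e"
  obtains \<rho> l \<tau> where "\<sigma> = \<rho> @ l # \<tau>" "sc (st (l # \<tau>)) e \<noteq> sc (st \<tau>) e"
  using assms
proof (induction \<sigma> arbitrary: thesis)
  case (Cons l \<sigma>)
  show ?case
  proof (cases "sc (st \<sigma>) e = \<phi> e")
    case True
    then show ?thesis using Cons.prems(1)[of "[]" l \<sigma>] Cons.prems(2) by simp
  next
    case False
    show ?thesis
    proof (rule Cons.IH[OF _ False])
      fix \<rho> l' \<tau> assume "\<sigma> = \<rho> @ l' # \<tau>" "sc (st (l' # \<tau>)) e \<noteq> sc (st \<tau>) e"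
      then show ?thesis using Cons.prems(1)[of "l # \<rho>" l' \<tau>] by simp
    qed
  qed
qed simp

lemma touch_change:
  assumes "stuck_step E d \<phi> x0 y0 L R (st \<tau>) m" "l < L" "sc (st (l # \<tau>)) e \<noteq> sc (st \<tau>) e" "v \<in> e"
  shows "v \<in> touch (st \<tau>)"
proof -
  interpret stuck_step E d \<phi> x0 y0 L R "st \<tau>" m by fact
  show ?thesis
  proof (cases "v \<in> T")
    case True
    then show ?thesis unfolding touch_def centre_nbrs_def by blast
  next
    case False
    have "l \<le> L" using assms(2) by simp
    have "sc (child (st \<tau>) l) e \<noteq> sc (st \<tau>) e" using assms(3) by simp
    from child_change_T[OF \<open>l \<le> L\<close> this assms(4) False]
    obtain i where "i \<le> l" "v = wk (st \<tau>) i \<or> v = wk (st \<tau>) (Suc i)" by metis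
    then have "v \<in> wk (st \<tau>) ` {..Suc L}" using \<open>l \<le> L\<close> by auto
    then show ?thesis unfolding touch_def by (rule UnI2)
  qed
qed

text \<open>The walk is clean before its first unclean vertex, so this vertex restricts the hole.
  The discrepancy there was caused by earlier steps; if not by the last one alone, the ancestor that
  is hit lies at least two levels up. The last step alone cannot be responsible: its fan is excluded
  by \<open>bad_cut\<close>, and along its walk only its two colors change; a new chain affected by
  this reuses both and lies in an untouched component.\<close>

lemma unclean_dead:
  assumes good: "good \<sigma>" and R: "(L + 2) * (length \<sigma> + 1) \<le> R" and "\<not> clean (st \<sigma>)"
  obtains \<rho> \<tau> where "\<sigma> = \<rho> @ \<tau>" "2 \<le> length \<rho>" "hole \<sigma> \<in> (\<Union>v\<in>touch (st \<tau>). pred_holes \<phi> v)"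
proof -
  note goal_rule = that
  let ?s = "st \<sigma>"
  have step: "stuck_step E d \<phi> x0 y0 L R ?s ((L + 2) * length \<sigma>)" using good_inv[OF good R] .
  interpret S: stuck_step E d \<phi> x0 y0 L R ?s "(L + 2) * length \<sigma>" by fact
  obtain i where i: "i \<le> L" "\<not> clean_at ?s i" "\<And>j. j < i \<Longrightarrow> clean_at ?s j"
  proof -
    have "\<exists>i. i \<le> L \<and> \<not> clean_at ?s i" using assms(3) by (auto simp: clean_def)
    then obtain i where "i \<le> L \<and> \<not> clean_at ?s i" "\<And>j. j < i \<Longrightarrow> \<not> (j \<le> L \<and> \<not> clean_at ?s j)"
      unfolding exists_least_iff[of "\<lambda>i. i \<le> L \<and> \<not> clean_at ?s i"] by blast
    then show ?thesis using that[of i] by auto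
  qed
  have hP: "hole \<sigma> \<in> pred_holes \<phi> (wk ?s i)" by (rule hole_pred[OF step i(1,3)])
  obtain w c where wc: "c \<in> {fg ?s, fd ?s}" "(sc ?s {wk ?s i, w} = Some c) \<noteq> (\<phi> {wk ?s i, w} = Some c)"
    using i(2) unfolding clean_at_def by blast
  define e where "e = {wk ?s i, w}"
  have ve: "wk ?s i \<in> e" by (simp add: e_def)
  have sub: "stuck_step E d \<phi> x0 y0 L R (st \<tau>) ((L + 2) * length \<tau>) \<and> l < L \<and> good (l # \<tau>)"
    if "\<sigma> = \<rho> @ l # \<tau>" for \<rho> l \<tau>
  proof -
    have g: "good (l # \<tau>)" using good that good_suffix by blast
    have "(L + 2) * (length \<tau> + 1) \<le> (L + 2) * (length \<sigma> + 1)"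
      using that by (intro mult_le_mono2) simp
    then show ?thesis using good_inv[of \<tau>] g R by simp
  qed
  have deep: thesis if "\<sigma> = \<rho> @ l # \<tau>" "sc (st (l # \<tau>)) e \<noteq> sc (st \<tau>) e" "\<rho> \<noteq> []" for \<rho> l \<tau>
  proof -
    have "wk ?s i \<in> touch (st \<tau>)"
      using touch_change[OF _ _ that(2) ve] sub[OF that(1)] by blast
    then have "hole \<sigma> \<in> (\<Union>v\<in>touch (st \<tau>). pred_holes \<phi> v)" using hP by blast
    moreover have "\<sigma> = (\<rho> @ [l]) @ \<tau>" "2 \<le> length (\<rho> @ [l])" using that by (auto simp: Suc_le_eq)
    ultimately show thesis by (intro goal_rule)
  qed
  have "sc ?s e \<noteq> \<phi> e" using wc(2) by (auto simp: e_def)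
  then obtain \<rho> l \<tau> where 1: "\<sigma> = \<rho> @ l # \<tau>" "sc (st (l # \<tau>)) e \<noteq> sc (st \<tau>) e"
    by (rule change_origin)
  show thesis
  \<comment> \<open>If the last step changed \<open>e\<close> but \<open>e\<close> already differed
    from \<open>\<phi>\<close> before it, an earlier change is used instead.\<close>
  proof (cases "\<rho> = [] \<and> sc (st \<tau>) e = \<phi> e")
    case False
    show thesis
    proof (cases "\<rho> = []")
      case True
      then obtain \<rho>' l' \<tau>' where "\<tau> = \<rho>' @ l' # \<tau>'" "sc (st (l' # \<tau>')) e \<noteq> sc (st \<tau>') e"
        using False change_origin by blast
      then show thesis using deep[of "l # \<rho>'" l' \<tau>'] 1(1) True by simp
    qed (use deep[OF 1] in blast)
  next
    case True
    then have \<sigma>: "\<sigma> = l # \<tau>" and \<tau>e: "sc (st \<tau>) e = \<phi> e" using 1 by auto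
    have tau: "stuck_step E d \<phi> x0 y0 L R (st \<tau>) ((L + 2) * length \<tau>)" "l < L" "\<not> bad_cut \<tau> l"
      using sub[OF 1(1)] by auto
    interpret stuck_step E d \<phi> x0 y0 L R "st \<tau>" "(L + 2) * length \<tau>" by (rule tau(1))
    have lL: "l \<le> L" using tau(2) by simp
    have "hole (l # \<tau>) \<notin> (\<Union>v\<in>T. pred_holes \<phi> v)"
      using tau(3) unfolding bad_cut_def centre_nbrs_def by simp
    then have vT: "wk ?s i \<notin> T"
      using hP \<sigma> by (meson UN_I)
    have ch: "sc (child (st \<tau>) l) e \<noteq> sc (st \<tau>) e" using 1(2) by simp
    obtain j where j: "j \<le> l" "e = {wk (st \<tau>) j, wk (st \<tau>) (Suc j)}"
      using child_change_T[OF lL ch ve vT] by blast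
    have "sc (st \<tau>) e = Some (fcol (st \<tau>) j)" using p_col[of j] j lL by simp
    moreover have "sc ?s e = None \<or> sc ?s e = Some (fcol (st \<tau>) (Suc j))"
      using child_path_col[OF lL j(1)] j(2) \<sigma> by (simp split: if_splits)
    ultimately have "c = fcol (st \<tau>) j \<or> c = fcol (st \<tau>) (Suc j)"
      using wc(2) \<tau>e unfolding e_def[symmetric] by auto
    then have "c \<in> {fcol (st \<tau>) l, fcol (st \<tau>) (Suc l)}" by (auto simp: fcol_def)
    then have "fg (st (l # \<tau>)) \<in> {fcol (st \<tau>) l, fcol (st \<tau>) (Suc l)} \<or>
        fd (st (l # \<tau>)) \<in> {fcol (st \<tau>) l, fcol (st \<tau>) (Suc l)}"
      using wc(1) \<sigma> by auto
    note b = bicolor_step[OF tau S.is_fan_out[unfolded \<sigma>] this]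
    interpret B: stuck_step_bicolor E d \<phi> x0 y0 L R "st \<tau>" "(L + 2) * length \<tau>" l "fz (st (l # \<tau>))"
      by (rule b(1))
    have "awalk (sc (child (st \<tau>) l)) (fcol (st \<tau>) (Suc l)) (fcol (st \<tau>) l) (wk ?s) i"
      using awalk_mono[OF S.pwalk', of i] i(1) b(2,3) \<sigma> by simp
    moreover have "wk ?s 0 = fz (st (l # \<tau>))" using S.p0 \<sigma> by simp
    ultimately have "sc (child (st \<tau>) l) e = sc (st \<tau>) e"
      using B.walk_unchanged B.child_walk ve by blast
    then show thesis using ch by simp
  qed
qed

lemma hole_Cons_inj:
  assumes "good \<sigma>" "(L + 2) * (length \<sigma> + 1) \<le> R" "l \<le> L" "l' \<le> L" "hole (l # \<sigma>) = hole (l' # \<sigma>)"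
  shows "l = l'"
proof -
  interpret stuck_step E d \<phi> x0 y0 L R "st \<sigma>" "(L + 2) * length \<sigma>" using good_inv[OF assms(1,2)] .
  show ?thesis using assms(3-5) pinj[of l l'] by (simp add: hole_def)
qed

lemma card_centre_nbrs: "finite (centre_nbrs s)" "card (centre_nbrs s) \<le> d + 1"
  unfolding centre_nbrs_def using card_nbrs'[of "sx s"] by (auto simp: card_insert_if)

lemma card_touch: "finite (touch s)" "card (touch s) \<le> d + L + 3"
proof -
  show "finite (touch s)" unfolding touch_def using card_centre_nbrs by simp
  have "card (touch s) \<le> card (centre_nbrs s) + card (wk s ` {..Suc L})"
    unfolding touch_def by (rule card_Un_le)
  then show "card (touch s) \<le> d + L + 3"
    using card_centre_nbrs(2)[of s] card_image_le[of "{..Suc L}" "wk s"] by simp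
qed

text \<open>Different cuts give different holes, which bounds the cuts of the first bad kind by the
  number of listed holes. For the second kind, the cut vertex is adjacent to the new leaf, so each
  listed leaf excludes at most \<open>d\<close> cuts.\<close>

lemma good_children:
  assumes good: "good \<sigma>" and R: "(L + 2) * (length \<sigma> + 2) \<le> R" and clean: "clean (st \<sigma>)"
  shows "L \<le> card {l. good (l # \<sigma>)} + ((d + 1) * (ends_bound * (d * d)) + (d + 1) * ends_bound * d)"
proof -
  have R': "(L + 2) * (length \<sigma> + 1) \<le> R" using R by simp
  interpret stuck_step E d \<phi> x0 y0 L R "st \<sigma>" "(L + 2) * length \<sigma>" using good_inv[OF good R'] .
  let ?H = "\<Union>v\<in>centre_nbrs (st \<sigma>). pred_holes \<phi> v"
  let ?W = "\<Union>v\<in>centre_nbrs (st \<sigma>). ends_at (sc (st \<sigma>)) v"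
  define B1 where "B1 = {l. l < L \<and> hole (l # \<sigma>) \<in> ?H}"
  define B2 where "B2 = {l. l < L \<and> fz (st (l # \<sigma>)) \<in> ?W}"
  have H: "finite ?H" "card ?H \<le> (d + 1) * (ends_bound * (d * d))"
    by (rule finite_UN_I[OF card_centre_nbrs(1) pred_holes_bound(1)[OF \<phi>]],
      rule card_UN_bound[OF card_centre_nbrs(1) pred_holes_bound(2)[OF \<phi>] card_centre_nbrs(2)])
  have W: "finite ?W" "card ?W \<le> (d + 1) * ends_bound"
    by (rule finite_UN_I[OF card_centre_nbrs(1) ends_at_bound(1)[OF ok'(1)]],
      rule card_UN_bound[OF card_centre_nbrs(1) ends_at_bound(2)[OF ok'(1)] card_centre_nbrs(2)])
  have "card B1 \<le> card ?H"
  proof (rule card_inj_on_le[OF _ _ H(1)])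
    show "inj_on (\<lambda>l. hole (l # \<sigma>)) B1"
      using hole_Cons_inj[OF good R'] by (intro inj_onI) (simp add: B1_def)
    show "(\<lambda>l. hole (l # \<sigma>)) ` B1 \<subseteq> ?H" unfolding B1_def by blast
  qed
  then have B1: "card B1 \<le> (d + 1) * (ends_bound * (d * d))" using H by simp
  have fW: "finite (\<Union>w\<in>?W. nbrs w)" using W(1) finite_nbrs' by (rule finite_UN_I)
  have B2W: "wk (st \<sigma>) l \<in> (\<Union>w\<in>?W. nbrs w)" if "l \<in> B2" for l
  proof -
    have l: "l < L" "fz (st (l # \<sigma>)) \<in> ?W" using that by (auto simp: B2_def)
    have "ok ((L + 2) * length \<sigma> + L + 2) (st (l # \<sigma>))" using child_ok[of l] l by simp
    then have "is_fan_out (st (l # \<sigma>))" by (rule fan_out_ex) (use R in \<open>simp add: algebra_simps\<close>)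
    then have "{wk (st \<sigma>) l, fz (st (l # \<sigma>))} \<in> E" using fan_outD(2) by fastforce
    then have "wk (st \<sigma>) l \<in> nbrs (fz (st (l # \<sigma>)))" by (simp add: mem_nbrs insert_commute)
    then show ?thesis using l(2) by blast
  qed
  then have "card B2 \<le> card (\<Union>w\<in>?W. nbrs w)"
  proof (intro card_inj_on_le[OF _ _ fW])
    show "inj_on (wk (st \<sigma>)) B2" using pinj by (intro inj_onI) (simp add: B2_def)
    show "wk (st \<sigma>) ` B2 \<subseteq> (\<Union>w\<in>?W. nbrs w)" using B2W by (rule image_subsetI)
  qed
  also have "\<dots> \<le> (d + 1) * ends_bound * d"
    by (rule card_UN_bound[OF W(1) card_nbrs' W(2)])
  finally have B2: "card B2 \<le> (d + 1) * ends_bound * d" .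
  have fin: "finite {l. good (l # \<sigma>)}" by (rule finite_subset[of _ "{..<L}"]) auto
  have "{..<L} \<subseteq> {l. good (l # \<sigma>)} \<union> (B1 \<union> B2)"
    using good clean by (auto simp: B1_def B2_def bad_cut_def)
  then have "card {..<L} \<le> card ({l. good (l # \<sigma>)} \<union> (B1 \<union> B2))"
    by (rule card_mono[rotated]) (use fin in \<open>auto simp: B1_def B2_def\<close>)
  also have "\<dots> \<le> card {l. good (l # \<sigma>)} + card (B1 \<union> B2)" by (rule card_Un_le)
  also have "\<dots> \<le> card {l. good (l # \<sigma>)} + (card B1 + card B2)" using card_Un_le[of B1 B2] by simp
  finally show ?thesis using B1 B2 by simp
qed

lemma hole_in_gball:
  assumes "good \<sigma>" "(L + 2) * (length \<sigma> + 1) \<le> R"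
  shows "hole \<sigma> \<in> gball R x0 \<times> gball R x0"
proof -
  interpret stuck_step E d \<phi> x0 y0 L R "st \<sigma>" "(L + 2) * length \<sigma>" using good_inv[OF assms] .
  have "sy (st \<sigma>) \<in> gball (Suc ((L + 2) * length \<sigma>)) x0" by (rule gball_step[OF ok'(6,2)])
  then show ?thesis
    using ok'(6) gball_mono[of "(L + 2) * length \<sigma>" R x0] gball_mono[of "Suc ((L + 2) * length \<sigma>)" R x0] assms(2)
    by (auto simp: hole_def)
qed

end

section \<open>Counting in a tree whose nodes can be traced back with few choices\<close>

lemma sum_geometric_le:
  fixes r :: real
  assumes "0 \<le> r" "r \<le> 1 / 2"
  shows "(\<Sum>j<m. r ^ (m - j)) \<le> 2 * r"
proof (induction m)
  case (Suc m)
  have "(\<Sum>j<Suc m. r ^ (Suc m - j)) = (\<Sum>j<m. r * r ^ (m - j)) + r"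
    by (simp add: Suc_diff_le less_imp_le)
  also have "\<dots> = r * (\<Sum>j<m. r ^ (m - j)) + r" by (simp add: sum_distrib_left)
  also have "\<dots> \<le> r * (2 * r) + r" using Suc assms by (intro add_right_mono mult_left_mono) auto
  also have "\<dots> \<le> 2 * r" using assms mult_left_mono[of "2 * r" 1 r] by simp
  finally show ?case .
qed (use assms in simp)

text \<open>The distance of at least two levels to the hitting ancestor is essential: counting alone cannot
  exclude that all children of a node are hit from that node.\<close>

locale choice_tree =
  fixes G :: "nat list \<Rightarrow> bool" and h :: "nat list \<Rightarrow> 'h" and Pr :: "'h \<Rightarrow> 'h set"
    and Hit :: "nat list \<Rightarrow> 'h set" and L C HC K N :: nat
  assumes nil: "G []" and G_Cons: "G (l # \<sigma>) \<Longrightarrow> G \<sigma> \<and> l < L"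
    and pred: "G (l # \<sigma>) \<Longrightarrow> length \<sigma> < N \<Longrightarrow> h \<sigma> \<in> Pr (h (l # \<sigma>))"
    and Pr: "finite (Pr x)" "card (Pr x) \<le> C"
    and inj: "G (l # \<sigma>) \<Longrightarrow> G (l' # \<sigma>) \<Longrightarrow> length \<sigma> < N \<Longrightarrow> h (l # \<sigma>) = h (l' # \<sigma>) \<Longrightarrow> l = l'"
    and child: "G \<sigma> \<Longrightarrow> length \<sigma> < N \<Longrightarrow>
      K \<le> card {l. G (l # \<sigma>)} \<or> (\<exists>\<rho> \<tau>. \<sigma> = \<rho> @ \<tau> \<and> 2 \<le> length \<rho> \<and> h \<sigma> \<in> Hit \<tau>)"
    and Hit: "finite (Hit \<tau>)" "card (Hit \<tau>) \<le> HC"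
begin

definition level :: "nat \<Rightarrow> nat list set" where
  "level n = {\<sigma>. G \<sigma> \<and> length \<sigma> = n}"

definition ext :: "nat list \<Rightarrow> nat \<Rightarrow> 'h \<Rightarrow> nat list set" where
  "ext \<tau> n x = {\<sigma>. G \<sigma> \<and> (\<exists>\<rho>. \<sigma> = \<rho> @ \<tau> \<and> length \<rho> = n) \<and> h \<sigma> = x}"

lemma G_suffix: "G (\<rho> @ \<tau>) \<Longrightarrow> G \<tau>"
  by (induction \<rho>) (auto dest: G_Cons)

lemma finite_level: "finite (level n)"
proof (rule finite_subset)
  have "G \<sigma> \<Longrightarrow> set \<sigma> \<subseteq> {..<L}" for \<sigma> by (induction \<sigma>) (auto dest: G_Cons)
  then show "level n \<subseteq> {\<sigma>. set \<sigma> \<subseteq> {..<L} \<and> length \<sigma> = n}" by (auto simp: level_def)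
  show "finite {\<sigma>. set \<sigma> \<subseteq> {..<L} \<and> length \<sigma> = n}" by (rule finite_lists_length_eq) simp
qed

lemma finite_ext: "finite (ext \<tau> n x)"
  by (rule finite_subset[OF _ finite_level[of "n + length \<tau>"]]) (auto simp: ext_def level_def)

text \<open>A node is recovered from its label by going up through \<open>Pr\<close>, with at most
  \<open>C\<close> choices per level. The topmost step is free: by \<open>inj\<close> the label of a
  child of \<open>\<tau>\<close> determines the child. Hence the exponent \<open>k\<close> at depth
  \<open>Suc k\<close>.\<close>

lemma card_ext: "length \<tau> + Suc k \<le> N \<Longrightarrow> card (ext \<tau> (Suc k) x) \<le> C ^ k"
proof (induction k arbitrary: x)
  case 0
  have "\<sigma> = \<sigma>'" if "\<sigma> \<in> ext \<tau> (Suc 0) x" "\<sigma>' \<in> ext \<tau> (Suc 0) x" for \<sigma> \<sigma>'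
    using that inj[of _ \<tau>] 0 by (auto simp: ext_def length_Suc_conv)
  then have "card (ext \<tau> (Suc 0) x) \<le> Suc 0"
    using finite_ext by (subst card_le_Suc0_iff_eq) auto
  then show ?case by simp
next
  case (Suc k)
  have cons: "\<exists>l \<sigma>'. \<sigma> = l # \<sigma>' \<and> G \<sigma> \<and> length \<sigma>' < N \<and> h \<sigma> = x \<and> G \<sigma>' \<and> (\<exists>\<rho>. \<sigma>' = \<rho> @ \<tau> \<and> length \<rho> = Suc k)"
    if s: "\<sigma> \<in> ext \<tau> (Suc (Suc k)) x" for \<sigma>
  proof -
    obtain \<rho> where \<rho>: "G \<sigma>" "\<sigma> = \<rho> @ \<tau>" "length \<rho> = Suc (Suc k)" "h \<sigma> = x"
      using s by (auto simp: ext_def)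
    then obtain l \<rho>' where "\<rho> = l # \<rho>'" "length \<rho>' = Suc k" by (cases \<rho>) auto
    then show ?thesis using \<rho> Suc.prems G_Cons[of l "\<rho>' @ \<tau>"] by auto
  qed
  have "card (ext \<tau> (Suc (Suc k)) x) \<le> card (\<Union>x'\<in>Pr x. ext \<tau> (Suc k) x')"
  proof (rule card_inj_on_le)
    show "inj_on tl (ext \<tau> (Suc (Suc k)) x)"
    proof (rule inj_onI)
      fix \<sigma> \<sigma>' assume a: "\<sigma> \<in> ext \<tau> (Suc (Suc k)) x" "\<sigma>' \<in> ext \<tau> (Suc (Suc k)) x" "tl \<sigma> = tl \<sigma>'"
      show "\<sigma> = \<sigma>'" using cons[OF a(1)] cons[OF a(2)] a(3) inj by auto
    qed
    show "tl ` ext \<tau> (Suc (Suc k)) x \<subseteq> (\<Union>x'\<in>Pr x. ext \<tau> (Suc k) x')"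
    proof (rule image_subsetI)
      fix \<sigma> assume "\<sigma> \<in> ext \<tau> (Suc (Suc k)) x"
      from cons[OF this] obtain l \<sigma>' \<rho> where s: "\<sigma> = l # \<sigma>'" "G \<sigma>" "length \<sigma>' < N" "h \<sigma> = x" "G \<sigma>'"
        "\<sigma>' = \<rho> @ \<tau>" "length \<rho> = Suc k" by blast
      then have "h \<sigma>' \<in> Pr x" using pred[of l \<sigma>'] by simp
      moreover have "\<sigma>' \<in> ext \<tau> (Suc k) (h \<sigma>')" using s by (auto simp: ext_def)
      ultimately show "tl \<sigma> \<in> (\<Union>x'\<in>Pr x. ext \<tau> (Suc k) x')" using s(1) by auto
    qed
    show "finite (\<Union>x'\<in>Pr x. ext \<tau> (Suc k) x')" using Pr finite_ext by simp
  qed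
  also have "\<dots> \<le> (\<Sum>x'\<in>Pr x. card (ext \<tau> (Suc k) x'))" by (rule card_UN_le[OF Pr(1)])
  also have "\<dots> \<le> card (Pr x) * C ^ k"
    using sum_bounded_above[of "Pr x" "\<lambda>x'. card (ext \<tau> (Suc k) x')" "C ^ k"] Suc by simp
  also have "\<dots> \<le> C ^ Suc k" using Pr(2)[of x] by simp
  finally show ?case .
qed

lemma card_level_le:
  assumes "0 < n" "n \<le> N" "finite X" "\<And>\<sigma>. \<sigma> \<in> level n \<Longrightarrow> h \<sigma> \<in> X" "1 \<le> C"
  shows "card (level n) \<le> card X * C ^ n"
proof -
  obtain k where n: "n = Suc k" using assms(1) by (cases n) auto
  have "level n \<subseteq> (\<Union>x\<in>X. ext [] n x)" using assms(4) by (auto simp: level_def ext_def)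
  then have "card (level n) \<le> card (\<Union>x\<in>X. ext [] n x)"
    using assms(3) finite_ext by (intro card_mono) auto
  also have "\<dots> \<le> (\<Sum>x\<in>X. card (ext [] n x))" by (rule card_UN_le[OF assms(3)])
  also have "\<dots> \<le> card X * C ^ k"
    using sum_bounded_above[of X "\<lambda>x. card (ext [] n x)" "C ^ k"] card_ext[of "[]" k] n assms(2) by simp
  also have "\<dots> \<le> card X * C ^ n"
    using assms(5) n by (intro mult_left_mono power_increasing) auto
  finally show ?thesis .
qed

definition dead :: "nat \<Rightarrow> nat list set" where
  "dead n = {\<sigma>\<in>level n. \<exists>\<rho> \<tau>. \<sigma> = \<rho> @ \<tau> \<and> 2 \<le> length \<rho> \<and> h \<sigma> \<in> Hit \<tau>}"

lemma card_dead:
  assumes "n \<le> N"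
  shows "card (dead n) \<le> (\<Sum>j<n - 1. card (level j) * (HC * C ^ (n - 1 - j)))"
proof -
  \<comment> \<open>Dead nodes are sorted by the level \<open>j\<close> of the ancestor they hit;
    \<open>2 \<le> length \<rho>\<close> means \<open>j < n - 1\<close>.\<close>
  have "dead n \<subseteq> (\<Union>j\<in>{..<n - 1}. \<Union>\<tau>\<in>level j. \<Union>x\<in>Hit \<tau>. ext \<tau> (n - j) x)"
  proof
    fix \<sigma> assume "\<sigma> \<in> dead n"
    then obtain \<rho> \<tau> where *: "G \<sigma>" "length \<sigma> = n" "\<sigma> = \<rho> @ \<tau>" "2 \<le> length \<rho>" "h \<sigma> \<in> Hit \<tau>"
      by (auto simp: dead_def level_def)
    then have "\<tau> \<in> level (length \<tau>)" "length \<tau> < n - 1" "\<sigma> \<in> ext \<tau> (n - length \<tau>) (h \<sigma>)"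
      using G_suffix by (auto simp: level_def ext_def)
    then show "\<sigma> \<in> (\<Union>j\<in>{..<n - 1}. \<Union>\<tau>\<in>level j. \<Union>x\<in>Hit \<tau>. ext \<tau> (n - j) x)"
      using *(5) by blast
  qed
  then have "card (dead n) \<le> card (\<Union>j\<in>{..<n - 1}. \<Union>\<tau>\<in>level j. \<Union>x\<in>Hit \<tau>. ext \<tau> (n - j) x)"
    using finite_level Hit finite_ext by (intro card_mono) auto
  also have "\<dots> \<le> (\<Sum>j<n - 1. card (\<Union>\<tau>\<in>level j. \<Union>x\<in>Hit \<tau>. ext \<tau> (n - j) x))"
    by (rule card_UN_le) simp
  also have "\<dots> \<le> (\<Sum>j<n - 1. card (level j) * (HC * C ^ (n - 1 - j)))"
  proof (rule sum_mono)
    fix j assume j: "j \<in> {..<n - 1}"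
    have e: "card (ext \<tau> (n - j) x) \<le> C ^ (n - 1 - j)" if "\<tau> \<in> level j" for \<tau> x
    proof -
      have "n - j = Suc (n - 1 - j)" using j by auto
      then show ?thesis using card_ext[of \<tau> "n - 1 - j" x] that j assms by (auto simp: level_def)
    qed
    have "card (\<Union>x\<in>Hit \<tau>. ext \<tau> (n - j) x) \<le> HC * C ^ (n - 1 - j)" if "\<tau> \<in> level j" for \<tau>
    proof -
      have "card (\<Union>x\<in>Hit \<tau>. ext \<tau> (n - j) x) \<le> (\<Sum>x\<in>Hit \<tau>. card (ext \<tau> (n - j) x))"
        by (rule card_UN_le[OF Hit(1)])
      also have "\<dots> \<le> card (Hit \<tau>) * C ^ (n - 1 - j)"
        using sum_bounded_above[of "Hit \<tau>" "\<lambda>x. card (ext \<tau> (n - j) x)" "C ^ (n - 1 - j)"] e[OF that] by simp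
      also have "\<dots> \<le> HC * C ^ (n - 1 - j)" using Hit(2) by simp
      finally show ?thesis .
    qed
    then have "(\<Sum>\<tau>\<in>level j. card (\<Union>x\<in>Hit \<tau>. ext \<tau> (n - j) x)) \<le> card (level j) * (HC * C ^ (n - 1 - j))"
      using sum_bounded_above[of "level j" "\<lambda>\<tau>. card (\<Union>x\<in>Hit \<tau>. ext \<tau> (n - j) x)"] by simp
    then show "card (\<Union>\<tau>\<in>level j. \<Union>x\<in>Hit \<tau>. ext \<tau> (n - j) x) \<le> card (level j) * (HC * C ^ (n - 1 - j))"
      using card_UN_le[OF finite_level, of "\<lambda>\<tau>. \<Union>x\<in>Hit \<tau>. ext \<tau> (n - j) x" j] by linarith
  qed
  finally show ?thesis .
qed

lemma level_Suc:
  assumes "n < N"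
  shows "K * (card (level n) - card (dead n)) \<le> card (level (Suc n))"
proof -
  let ?A = "\<lambda>\<sigma>. (\<lambda>l. l # \<sigma>) ` {l. G (l # \<sigma>)}"
  have f: "finite {l. G (l # \<sigma>)}" for \<sigma>
    by (rule finite_subset[of _ "{..<L}"]) (auto dest: G_Cons)
  have dn: "dead n \<subseteq> level n" by (auto simp: dead_def)
  have "K * (card (level n) - card (dead n)) = (\<Sum>\<sigma>\<in>level n - dead n. K)"
    using card_Diff_subset[OF finite_subset[OF dn finite_level] dn] by simp
  also have "\<dots> \<le> (\<Sum>\<sigma>\<in>level n - dead n. card (?A \<sigma>))"
  proof (rule sum_mono)
    fix \<sigma> assume "\<sigma> \<in> level n - dead n"
    then have "K \<le> card {l. G (l # \<sigma>)}" using child[of \<sigma>] assms by (auto simp: level_def dead_def)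
    then show "K \<le> card (?A \<sigma>)" by (simp add: card_image inj_on_def)
  qed
  also have "\<dots> = card (\<Union>\<sigma>\<in>level n - dead n. ?A \<sigma>)"
    using finite_level f by (intro card_UN_disjoint[symmetric]) auto
  also have "\<dots> \<le> card (level (Suc n))"
    by (rule card_mono[OF finite_level]) (auto simp: level_def)
  finally show ?thesis .
qed

text \<open>Earlier levels are smaller by powers of \<open>q\<close>, so the dead nodes, counted by
  the ancestor they hit, form a geometric series of ratio \<open>C / q\<close>. It starts at two
  levels up and sums to at most \<open>2 * HC * C / q ^ 2\<close> of the level, hence to at most
  half. The other half has at least \<open>2 * q\<close> children each. A hit from one level up
  would add the fraction \<open>HC / q\<close>, which need not be small.\<close>

lemma level_growth:
  fixes q :: nat
  assumes q: "1 \<le> C" "2 * C \<le> q" "4 * HC * C \<le> q ^ 2" "2 * q \<le> K"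
  shows "q ^ N \<le> card (level N)"
proof -
  let ?g = "\<lambda>n. real (card (level n))"
  have qp: "real q > 0" using q(1,2) by simp
  have "(\<forall>j\<le>n. ?g j * q ^ (n - j) \<le> ?g n)" if "n \<le> N" for n
    using that
  proof (induction n)
    case (Suc n)
    then have IH: "?g j * q ^ (n - j) \<le> ?g n" if "j \<le> n" for j using that by auto
    define r where "r = real C / real q"
    have r: "0 \<le> r" "r \<le> 1 / 2" using q qp by (auto simp: r_def field_simps)
    have "real (card (dead n)) \<le> (\<Sum>j<n - 1. ?g j * (HC * C ^ (n - 1 - j)))"
    proof -
      have "real (card (dead n)) \<le> real (\<Sum>j<n - 1. card (level j) * (HC * C ^ (n - 1 - j)))"
        using card_dead[of n] Suc.prems by (simp only: of_nat_le_iff)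
      then show ?thesis by simp
    qed
    also have "\<dots> \<le> (\<Sum>j<n - 1. ?g n * (HC / q) * r ^ (n - 1 - j))"
    proof (rule sum_mono)
      fix j assume j: "j \<in> {..<n - 1}"
      then have nj: "n - j = Suc (n - 1 - j)" by auto
      have "?g j \<le> ?g n / q ^ (n - j)" using IH[of j] j qp by (simp add: field_simps)
      then have "?g j * (HC * C ^ (n - 1 - j)) \<le> ?g n / q ^ (n - j) * (HC * C ^ (n - 1 - j))"
        by (intro mult_right_mono) auto
      also have "\<dots> = ?g n * (HC / q) * r ^ (n - 1 - j)"
        unfolding nj r_def by (simp add: power_divide)
      finally show "?g j * (HC * C ^ (n - 1 - j)) \<le> ?g n * (HC / q) * r ^ (n - 1 - j)" by simp
    qed
    also have "\<dots> = ?g n * (HC / q) * (\<Sum>j<n - 1. r ^ (n - 1 - j))" by (simp add: sum_distrib_left)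
    also have "\<dots> \<le> ?g n * (HC / q) * (2 * r)"
      using sum_geometric_le[OF r, of "n - 1"] by (intro mult_left_mono) auto
    also have "\<dots> = ?g n * (real (2 * HC * C) / real (q ^ 2))" by (simp add: r_def power2_eq_square)
    also have "\<dots> \<le> ?g n * (1 / 2)"
    proof (rule mult_left_mono)
      have "real (4 * HC * C) \<le> real (q ^ 2)" using q(3) by (rule of_nat_mono)
      then show "real (2 * HC * C) / real (q ^ 2) \<le> 1 / 2" using qp by (simp add: field_simps)
    qed simp
    finally have dead: "real (card (dead n)) \<le> ?g n / 2" by simp
    have "q * ?g n = 2 * q * (?g n / 2)" by simp
    also have "\<dots> \<le> K * (?g n - card (dead n))"
      using dead q(4) by (intro mult_mono) auto
    also have "\<dots> = real (K * (card (level n) - card (dead n)))"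
      using dead by (simp add: of_nat_diff)
    also have "\<dots> \<le> ?g (Suc n)" using level_Suc[of n] Suc.prems by (simp only: of_nat_le_iff)
    finally have step: "q * ?g n \<le> ?g (Suc n)" by simp
    show ?case
    proof (intro allI impI)
      fix j assume "j \<le> Suc n"
      then consider "j = Suc n" | "j \<le> n" by linarith
      then show "?g j * q ^ (Suc n - j) \<le> ?g (Suc n)"
      proof cases
        case 2
        then have "?g j * q ^ (Suc n - j) = q * (?g j * q ^ (n - j))" by (simp add: Suc_diff_le)
        also have "\<dots> \<le> q * ?g n" using IH[OF 2] by (intro mult_left_mono) auto
        finally show ?thesis using step by simp
      qed simp
    qed
  qed simp
  from this[of N] have "?g 0 * q ^ N \<le> ?g N" by auto
  moreover have "level 0 = {[]}" using nil by (auto simp: level_def)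
  ultimately have "real (q ^ N) \<le> ?g N" by simp
  then show ?thesis by (simp only: of_nat_le_iff)
qed

end

section \<open>Local augmentation in graphs of subexponential growth\<close>

context bounded_graph
begin

text \<open>There are at least \<open>q ^ N\<close> good sequences of length \<open>N\<close>, while
  their holes lie in one ball and each hole belongs to at most \<open>C ^ N\<close> of them. As
  \<open>q \<ge> 3 * C\<close>, this would give \<open>3 ^ N \<le> f R ^ 2\<close>.\<close>

lemma local_augmentation:
  assumes f: "subexponential f" and growth: "\<And>n x. x \<in> \<Union>E \<Longrightarrow> card (gball n x) \<le> f n"
  obtains R where "\<And>\<phi> x y. pcol \<phi> \<Longrightarrow> {x, y} \<in> E \<Longrightarrow> \<phi> {x, y} = None \<Longrightarrow>
    \<exists>\<psi>. pcol \<psi> \<and> dom \<psi> = insert {x, y} (dom \<phi>) \<and> (\<forall>e. \<psi> e \<noteq> \<phi> e \<longrightarrow> e \<subseteq> gball R x)"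
proof -
  define C where "C = ends_bound * (d * d) + 1"
  define K0 where "K0 = (d + 1) * (ends_bound * (d * d)) + (d + 1) * ends_bound * d"
  define A where "A = d + 3 + K0"
  \<comment> \<open>\<open>HC = (A + 2 * q) * C\<close> is only linear in \<open>q\<close>, so
    \<open>4 * HC * C \<le> q ^ 2\<close> can be met: with \<open>A \<le> q\<close> it follows from
    \<open>12 * C ^ 2 \<le> q\<close>.\<close>
  define q where "q = 12 * C ^ 2 * A"
  \<comment> \<open>At most \<open>K0\<close> cuts of a clean state are bad, which leaves
    \<open>2 * q\<close> children.\<close>
  define L where "L = K0 + 2 * q"
  define HC where "HC = (d + L + 3) * C"
  have C1: "1 \<le> C" and A1: "1 \<le> A" by (auto simp: C_def A_def)
  have CC: "C \<le> C ^ 2" using C1 by (simp add: power2_eq_square)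
  have q3: "3 * C \<le> q"
  proof -
    have "3 * C \<le> 12 * C ^ 2" using CC by simp
    also have "\<dots> \<le> q" using A1 by (simp add: q_def)
    finally show ?thesis .
  qed
  have qA: "A \<le> q" using C1 by (simp add: q_def)
  have hc: "4 * HC * C \<le> q ^ 2"
  proof -
    have "4 * HC * C = 4 * C ^ 2 * (A + 2 * q)" by (simp add: HC_def L_def A_def power2_eq_square algebra_simps)
    also have "\<dots> \<le> 4 * C ^ 2 * (3 * q)" using qA by (intro mult_left_mono) auto
    also have "\<dots> = 12 * C ^ 2 * q" by simp
    also have "\<dots> \<le> 12 * C ^ 2 * A * q" using A1 by simp
    also have "\<dots> = q ^ 2" by (simp add: q_def power2_eq_square)
    finally show ?thesis .
  qed
  \<comment> \<open>Makes \<open>f R ^ 2\<close> smaller than \<open>exp ((N + 2) / 2)\<close> for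
    the \<open>R\<close> below, hence than \<open>exp N\<close> because
    \<open>N \<ge> 2\<close>.\<close>
  define \<epsilon> :: real where "\<epsilon> = 1 / (4 * (L + 2))"
  have "\<epsilon> > 0" by (simp add: \<epsilon>_def)
  then obtain R0 where R0: "\<And>n. R0 \<le> n \<Longrightarrow> real (f n) < exp (\<epsilon> * real n)"
    using f unfolding subexponential_def by blast
  define N where "N = R0 + 2"
  \<comment> \<open>A cut costs radius \<open>L + 2\<close>; beyond a sequence of length at most
    \<open>N\<close>, \<open>good_children\<close> needs room for two more steps.\<close>
  define R where "R = (L + 2) * (N + 2)"
  have "R0 \<le> R" by (simp add: R_def N_def)
  have fR: "real (f R) ^ 2 < exp (real N)"
  proof -
    have "real (f R) ^ 2 < exp (\<epsilon> * real R) ^ 2"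
      using R0[OF \<open>R0 \<le> R\<close>] by (intro power_strict_mono) auto
    also have "\<dots> = exp (2 * (\<epsilon> * real R))" by (simp flip: exp_of_nat_mult)
    also have "2 * (\<epsilon> * real R) = (real N + 2) / 2"
      by (simp add: \<epsilon>_def R_def field_simps)
    also have "exp ((real N + 2) / 2) \<le> exp (real N)" by (simp add: N_def)
    finally show ?thesis .
  qed
  show thesis
  proof (rule that[of R], rule ccontr)
    fix \<phi> x0 y0
    assume phi: "pcol \<phi>" "{x0, y0} \<in> E" "\<phi> {x0, y0} = None"
      and no: "\<not> (\<exists>\<psi>. pcol \<psi> \<and> dom \<psi> = insert {x0, y0} (dom \<phi>) \<and> (\<forall>e. \<psi> e \<noteq> \<phi> e \<longrightarrow> e \<subseteq> gball R x0))"
    interpret stuck E d \<phi> x0 y0 L R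
    proof
      show "\<exists>e. \<psi> e \<noteq> \<phi> e \<and> \<not> e \<subseteq> gball R x0"
        if "pcol \<psi>" "dom \<psi> = insert {x0, y0} (dom \<phi>)" for \<psi>
        using no that by metis
    qed (fact phi)+
    have lenR: "(L + 2) * (length \<sigma> + 2) \<le> R" if "length \<sigma> \<le> N" for \<sigma> :: "nat list"
      using that unfolding R_def by (intro mult_le_mono2) simp
    have lenR': "(L + 2) * (length \<sigma> + 1) \<le> R" if "length \<sigma> \<le> N" for \<sigma> :: "nat list"
      by (rule order_trans[OF _ lenR[OF that]]) (intro mult_le_mono2, simp)
    have HitB: "finite (\<Union>v\<in>touch (st \<tau>). pred_holes \<phi> v)" "card (\<Union>v\<in>touch (st \<tau>). pred_holes \<phi> v) \<le> HC" for \<tau>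
    proof -
      show "finite (\<Union>v\<in>touch (st \<tau>). pred_holes \<phi> v)"
        by (rule finite_UN_I[OF card_touch(1) pred_holes_bound(1)[OF \<phi>]])
      have "card (\<Union>v\<in>touch (st \<tau>). pred_holes \<phi> v) \<le> (d + L + 3) * (ends_bound * (d * d))"
        by (rule card_UN_bound[OF card_touch(1) pred_holes_bound(2)[OF \<phi>] card_touch(2)])
      also have "\<dots> \<le> HC" unfolding HC_def C_def by (intro mult_le_mono2) simp
      finally show "card (\<Union>v\<in>touch (st \<tau>). pred_holes \<phi> v) \<le> HC" .
    qed
    interpret choice_tree good hole "\<lambda>h. pred_holes \<phi> (fst h)" "\<lambda>\<tau>. \<Union>v\<in>touch (st \<tau>). pred_holes \<phi> v" L C HC "2 * q" N
    proof
      show "good []" by simp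
      show "good \<sigma> \<and> l < L" if "good (l # \<sigma>)" for l \<sigma> using that by simp
      show "hole \<sigma> \<in> pred_holes \<phi> (fst (hole (l # \<sigma>)))" if "good (l # \<sigma>)" "length \<sigma> < N" for l \<sigma>
        using hole_pred_Cons[OF that(1) lenR'] that(2) by simp
      show "finite (pred_holes \<phi> (fst x))" for x :: "'a \<times> 'a" by (rule pred_holes_bound(1)[OF \<phi>])
      show "card (pred_holes \<phi> (fst x)) \<le> C" for x :: "'a \<times> 'a"
        using pred_holes_bound(2)[OF \<phi>, of "fst x"] by (simp add: C_def)
      show "l = l'" if "good (l # \<sigma>)" "good (l' # \<sigma>)" "length \<sigma> < N" "hole (l # \<sigma>) = hole (l' # \<sigma>)" for l l' \<sigma>
        using hole_Cons_inj[of \<sigma> l l'] lenR'[of \<sigma>] that by simp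
      show "2 * q \<le> card {l. good (l # \<sigma>)} \<or>
          (\<exists>\<rho> \<tau>. \<sigma> = \<rho> @ \<tau> \<and> 2 \<le> length \<rho> \<and> hole \<sigma> \<in> (\<Union>v\<in>touch (st \<tau>). pred_holes \<phi> v))"
        if "good \<sigma>" "length \<sigma> < N" for \<sigma>
      proof (cases "clean (st \<sigma>)")
        case True
        have "L \<le> card {l. good (l # \<sigma>)} + K0"
          using good_children[OF that(1) lenR True] that(2) unfolding K0_def by simp
        then show ?thesis by (simp add: L_def)
      next
        case False
        show ?thesis
          by (rule unclean_dead[OF that(1) lenR' False]) (use that(2) in \<open>simp, blast\<close>)
      qed
    qed (rule HitB)+
    have lower: "q ^ N \<le> card (level N)"
      using C1 q3 hc by (intro level_growth) auto
    have "card (level N) \<le> card (gball R x0 \<times> gball R x0) * C ^ N"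
    proof (rule card_level_le)
      fix \<sigma> assume "\<sigma> \<in> level N"
      then have "good \<sigma>" "length \<sigma> \<le> N" by (auto simp: level_def)
      then show "hole \<sigma> \<in> gball R x0 \<times> gball R x0" using hole_in_gball lenR' by blast
    qed (use C1 in \<open>auto simp: N_def\<close>)
    also have "\<dots> \<le> f R ^ 2 * C ^ N"
    proof (rule mult_right_mono)
      have "card (gball R x0) * card (gball R x0) \<le> f R * f R"
        using growth[of x0 R] phi(2) by (intro mult_mono) auto
      then show "card (gball R x0 \<times> gball R x0) \<le> f R ^ 2"
        by (simp add: card_cartesian_product power2_eq_square)
    qed simp
    finally have "q ^ N \<le> f R ^ 2 * C ^ N" using lower by simp
    moreover have "(3 * C) ^ N \<le> q ^ N" using q3 by (intro power_mono) auto
    ultimately have "(3 * C) ^ N \<le> f R ^ 2 * C ^ N" by (rule order_trans[rotated])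
    then have "3 ^ N * C ^ N \<le> f R ^ 2 * C ^ N" by (simp only: power_mult_distrib)
    then have "3 ^ N \<le> f R ^ 2" using C1 by simp
    then have "(3::real) ^ N \<le> real (f R) ^ 2" by (metis of_nat_le_iff of_nat_numeral of_nat_power)
    moreover have "exp (real N) \<le> 3 ^ N"
    proof -
      have "exp (real N) = exp 1 ^ N" by (simp flip: exp_of_nat_mult)
      also have "\<dots> \<le> 3 ^ N" using exp_le by (intro power_mono) auto
      finally show ?thesis .
    qed
    ultimately show False using fR by simp
  qed
qed

text \<open>All edges treated share the endpoint \<open>x\<close>, so every augmentation is centred
  there and the radius does not grow.\<close>

lemma local_completion:
  assumes f: "subexponential f" and growth: "\<And>n x. x \<in> \<Union>E \<Longrightarrow> card (gball n x) \<le> f n"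
  obtains R where "\<And>\<phi> x. pcol \<phi> \<Longrightarrow>
    \<exists>\<psi>. pcol \<psi> \<and> dom \<phi> \<subseteq> dom \<psi> \<and> (\<forall>u\<in>nbrs x. {x, u} \<in> dom \<psi>) \<and> (\<forall>e. \<psi> e \<noteq> \<phi> e \<longrightarrow> e \<subseteq> gball R x)"
proof -
  obtain R where R: "\<And>\<phi> x y. pcol \<phi> \<Longrightarrow> {x, y} \<in> E \<Longrightarrow> \<phi> {x, y} = None \<Longrightarrow>
    \<exists>\<psi>. pcol \<psi> \<and> dom \<psi> = insert {x, y} (dom \<phi>) \<and> (\<forall>e. \<psi> e \<noteq> \<phi> e \<longrightarrow> e \<subseteq> gball R x)"
    using local_augmentation[OF f growth] by blast
  show thesis
  proof (rule that[of R])
    fix \<phi> x assume \<phi>: "pcol \<phi>"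
    have "\<exists>\<psi>. pcol \<psi> \<and> dom \<phi> \<subseteq> dom \<psi> \<and> (\<forall>u\<in>B. {x, u} \<in> dom \<psi>) \<and> (\<forall>e. \<psi> e \<noteq> \<phi> e \<longrightarrow> e \<subseteq> gball R x)"
      if "finite B" "B \<subseteq> nbrs x" for B
      using that
    proof (induction B rule: finite_induct)
      case empty
      show ?case using \<phi> by auto
    next
      case (insert y B)
      then obtain \<psi> where \<psi>: "pcol \<psi>" "dom \<phi> \<subseteq> dom \<psi>" "\<forall>u\<in>B. {x, u} \<in> dom \<psi>"
        "\<forall>e. \<psi> e \<noteq> \<phi> e \<longrightarrow> e \<subseteq> gball R x" by auto
      show ?case
      proof (cases "\<psi> {x, y} = None")
        case True
        have "{x, y} \<in> E" using insert by (simp add: mem_nbrs)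
        from R[OF \<psi>(1) this True] obtain \<psi>' where \<psi>': "pcol \<psi>'" "dom \<psi>' = Set.insert {x, y} (dom \<psi>)"
          "\<forall>e. \<psi>' e \<noteq> \<psi> e \<longrightarrow> e \<subseteq> gball R x" by (elim exE conjE)
        have "e \<subseteq> gball R x" if "\<psi>' e \<noteq> \<phi> e" for e
          using that \<psi>(4) \<psi>'(3) by metis
        then show ?thesis using \<psi> \<psi>' by (intro exI[of _ \<psi>']) auto
      next
        case False
        then show ?thesis using \<psi> by (intro exI[of _ \<psi>]) auto
      qed
    qed
    from this[of "nbrs x"] show "\<exists>\<psi>. pcol \<psi> \<and> dom \<phi> \<subseteq> dom \<psi> \<and> (\<forall>u\<in>nbrs x. {x, u} \<in> dom \<psi>) \<and>
        (\<forall>e. \<psi> e \<noteq> \<phi> e \<longrightarrow> e \<subseteq> gball R x)" by simp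
  qed
qed

text \<open>Balls are built from walks, \<open>neighborhood\<close> from paths; a path that already
  contains the new vertex is cut off at it.\<close>

lemma gball_subset_neighborhood: "gball n x \<subseteq> neighborhood E n x"
proof
  fix u assume "u \<in> gball n x"
  then have "\<exists>p. is_path E p \<and> hd p = x \<and> last p = u \<and> length p \<le> Suc n"
  proof (induction n arbitrary: u)
    case 0
    then show ?case by (intro exI[of _ "[x]"]) (simp add: is_path_def)
  next
    case (Suc n)
    show ?case
    proof (cases "u \<in> gball n x")
      case True
      then show ?thesis using Suc.IH[OF True] le_SucI by blast
    next
      case False
      then obtain v where v: "v \<in> gball n x" "{v, u} \<in> E"
        using Suc.prems by (auto simp: gball.simps(2) mem_nbrs)
      obtain p where p: "is_path E p" "hd p = x" "last p = v" "length p \<le> Suc n"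
        using Suc.IH[OF v(1)] by blast
      show ?thesis
      proof (cases "u \<in> set p")
        case True
        then obtain ys zs where s: "p = ys @ u # zs" by (meson split_list)
        have "is_path E (ys @ [u])" using p(1) unfolding s is_path_def
          by (auto simp: successively_append_iff)
        then show ?thesis using p s by (intro exI[of _ "ys @ [u]"]) (cases ys, auto)
      next
        case False
        have "is_path E (p @ [u])"
          using p(1,3) v(2) False unfolding is_path_def by (auto simp: successively_append_iff)
        then show ?thesis using p by (intro exI[of _ "p @ [u]"]) (auto simp: is_path_def)
      qed
    qed
  qed
  then obtain p where "is_path E p" "hd p = x" "last p = u" "length p \<le> Suc n" by blast
  then show "u \<in> neighborhood E n x" unfolding neighborhood_def by auto
qed

end

section \<open>Carrying out local modifications in a Borel way\<close>

locale borel_graph_functions = bounded_graph E d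
  for E :: "'a set set" and d :: nat +
  fixes M :: "'a measure" and f :: "nat \<Rightarrow> 'a \<Rightarrow> 'a" and U :: "nat \<Rightarrow> 'a set"
  assumes fm [measurable]: "\<And>n. f n \<in> measurable M M"
    and f_cases: "\<And>n x. f n x = x \<or> {x, f n x} \<in> E"
    and f_cover: "\<And>x y. {x, y} \<in> E \<Longrightarrow> \<exists>n. y = f n x"
    and E_pred: "Measurable.pred (M \<Otimes>\<^sub>M M) (\<lambda>(x, y). {x, y} \<in> E)"
    and eq_pred: "Measurable.pred (M \<Otimes>\<^sub>M M) (\<lambda>(x, y). x = y)"
    and U [measurable]: "\<And>n. U n \<in> sets M"
    and U_sep: "\<And>x F. x \<in> space M \<Longrightarrow> finite F \<Longrightarrow> F \<subseteq> space M \<Longrightarrow> x \<notin> F \<Longrightarrow> \<exists>n. x \<in> U n \<and> F \<inter> U n = {}"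
    and E_space: "\<And>e. e \<in> E \<Longrightarrow> e \<subseteq> space M"
begin

text \<open>There are only countably many words, and by \<open>gball_iff_word\<close> they reach
  every vertex of a ball. A quantifier over a ball thus becomes a countable one and preserves
  measurability.\<close>

primrec g :: "nat list \<Rightarrow> 'a \<Rightarrow> 'a" where
  "g [] x = x"
| "g (n # w) x = f n (g w x)"

lemma g_measurable [measurable]: "g w \<in> measurable M M"
proof (induction w)
  case Nil
  then show ?case by (simp add: measurable_ident cong: measurable_cong)
next
  case (Cons n w)
  have "(\<lambda>x. f n (g w x)) \<in> measurable M M" using Cons by measurable
  then show ?case by (simp cong: measurable_cong)
qed

lemma g_append: "g (v @ w) x = g v (g w x)"
  by (induction v) auto

lemma g_in_gball: "g w x \<in> gball (length w) x"
proof (induction w)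
  case (Cons n w)
  then show ?case
    using f_cases[of n "g w x"] gball_step[OF Cons, of "f n (g w x)"] gball_Suc_mono[of "length w" x] by auto
qed simp

lemma gball_word:
  assumes "y \<in> gball n x"
  obtains w where "length w \<le> n" "y = g w x"
proof -
  have "\<exists>w. length w \<le> n \<and> y = g w x"
    using assms
  proof (induction n arbitrary: y)
    case 0
    then show ?case by (intro exI[of _ "[]"]) simp
  next
    case (Suc n)
    then consider "y \<in> gball n x" | v where "v \<in> gball n x" "{v, y} \<in> E"
      by (auto simp: gball.simps(2) mem_nbrs)
    then show ?case
    proof cases
      case 1
      then show ?thesis using Suc.IH le_SucI by blast
    next
      case 2
      obtain w where w: "length w \<le> n" "v = g w x" using Suc.IH[OF 2(1)] by blast
      obtain k where "y = f k v" using f_cover[OF 2(2)] by blast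
      then show ?thesis using w by (intro exI[of _ "k # w"]) simp
    qed
  qed
  then show ?thesis using that by blast
qed

lemma gball_iff_word: "y \<in> gball n x \<longleftrightarrow> (\<exists>w. length w \<le> n \<and> y = g w x)"
  using gball_word[of y n x] g_in_gball gball_mono by (metis subsetD)

lemma gball_in_space: "x \<in> space M \<Longrightarrow> gball n x \<subseteq> space M"
  using measurable_space[OF g_measurable] by (auto simp: gball_iff_word)

lemma eq_measurable [measurable (raw)]:
  assumes "a \<in> measurable N M" "b \<in> measurable N M"
  shows "Measurable.pred N (\<lambda>x. a x = b x)"
  using measurable_compose[OF measurable_Pair[OF assms] eq_pred] by simp

lemma E_measurable [measurable (raw)]:
  assumes "a \<in> measurable N M" "b \<in> measurable N M"
  shows "Measurable.pred N (\<lambda>x. {a x, b x} \<in> E)"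
  using measurable_compose[OF measurable_Pair[OF assms] E_pred] by simp

lemma gball_measurable [measurable (raw)]:
  assumes [measurable]: "a \<in> measurable N M" "b \<in> measurable N M"
  shows "Measurable.pred N (\<lambda>x. a x \<in> gball n (b x))"
proof -
  have [measurable]: "(\<lambda>x. g w (b x)) \<in> measurable N M" for w
    using measurable_compose[OF assms(2) g_measurable] .
  show ?thesis unfolding gball_iff_word by measurable
qed

lemma ball_gball_measurable:
  assumes [measurable]: "Measurable.pred M P"
  shows "Measurable.pred M (\<lambda>x. \<forall>y\<in>gball n x. P y)"
proof -
  have [measurable]: "Measurable.pred M (\<lambda>x. P (g w x))" for w
    using measurable_compose[OF g_measurable assms] .
  have "(\<forall>y\<in>gball n x. P y) \<longleftrightarrow> (\<forall>w. length w \<le> n \<longrightarrow> P (g w x))" for x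
    by (metis gball_iff_word)
  then show ?thesis by simp
qed

section \<open>Borel separated sets\<close>

definition separated :: "nat \<Rightarrow> 'a set \<Rightarrow> bool" where
  "separated r I \<longleftrightarrow> (\<forall>x\<in>I. \<forall>y\<in>I. y \<in> gball r x \<longrightarrow> y = x)"

text \<open>Some \<open>U n\<close> contains \<open>x\<close> but no other point of its finite
  \<open>r\<close>-ball; the points with this property for a fixed \<open>n\<close> lie in
  \<open>U n\<close>, hence outside each other's balls.\<close>

lemma countable_separated_cover:
  obtains A :: "nat \<Rightarrow> 'a set"
  where "\<forall>n. A n \<in> sets M" "\<forall>n. separated r (A n)" "space M \<subseteq> (\<Union>n. A n)"
proof -
  define A where "A n = {x \<in> space M. x \<in> U n \<and> (\<forall>w. length w \<le> r \<longrightarrow> g w x = x \<or> g w x \<notin> U n)}" for n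
  have Aiff: "x \<in> A n \<longleftrightarrow> x \<in> space M \<and> x \<in> U n \<and> (\<forall>y\<in>gball r x. y = x \<or> y \<notin> U n)" for x n
    unfolding A_def mem_Collect_eq by (metis gball_iff_word)
  have 1: "\<forall>n. A n \<in> sets M"
    unfolding A_def by measurable
  have 2: "\<forall>n. separated r (A n)"
    unfolding separated_def using Aiff by blast
  have 3: "space M \<subseteq> (\<Union>n. A n)"
  proof
    fix x assume x: "x \<in> space M"
    have "\<exists>n. x \<in> U n \<and> (gball r x - {x}) \<inter> U n = {}"
      by (rule U_sep[OF x]) (use gball_in_space[OF x] in auto)
    then obtain n where "x \<in> U n" "(gball r x - {x}) \<inter> U n = {}" by blast
    then have "x \<in> A n" unfolding Aiff using x by auto
    then show "x \<in> (\<Union>n. A n)" by blast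
  qed
  show ?thesis by (rule that[OF 1 2 3])
qed

text \<open>Greedy choice along the countable cover: stage \<open>n\<close> adds at once all points
  of \<open>W\<close> in \<open>A n\<close> that are far from those chosen before. They do not
  conflict with each other because \<open>A n\<close> is separated.\<close>

lemma maximal_separated_set:
  assumes W [measurable]: "W \<in> sets M"
  obtains I where "I \<in> sets M" "I \<subseteq> W" "separated r I" "\<forall>x\<in>W. \<exists>y\<in>I. y \<in> gball r x"
proof -
  obtain A :: "nat \<Rightarrow> 'a set" where A: "\<forall>n. A n \<in> sets M" "\<forall>n. separated r (A n)" "space M \<subseteq> (\<Union>n. A n)"
    by (rule countable_separated_cover)
  define S where "S = rec_nat {} (\<lambda>n S. S \<union> {x \<in> space M. x \<in> W \<and> x \<in> A n \<and> (\<forall>y\<in>gball r x. y \<notin> S)})"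
  have S0: "S 0 = {}" by (simp add: S_def)
  have SS: "S (Suc n) = S n \<union> {x \<in> space M. x \<in> W \<and> x \<in> A n \<and> (\<forall>y\<in>gball r x. y \<notin> S n)}" for n
    by (simp add: S_def)
  have SM: "S n \<in> sets M" for n
  proof (induction n)
    case (Suc n)
    have [measurable]: "A n \<in> sets M" using A by blast
    have [measurable]: "Measurable.pred M (\<lambda>x. \<forall>y\<in>gball r x. y \<notin> S n)"
      by (rule ball_gball_measurable) (use Suc in measurable)
    have "{x \<in> space M. x \<in> W \<and> x \<in> A n \<and> (\<forall>y\<in>gball r x. y \<notin> S n)} \<in> sets M" by measurable
    then show ?case unfolding SS using Suc by auto
  qed (simp add: S0)
  have SW: "S n \<subseteq> W" for n by (induction n) (auto simp: S0 SS)
  have sep: "separated r (S n)" for n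
  proof (induction n)
    case (Suc n)
    show ?case
      unfolding separated_def
    proof (intro ballI impI)
      fix x y assume xy: "x \<in> S (Suc n)" "y \<in> S (Suc n)" "y \<in> gball r x"
      show "y = x"
      proof (cases "x \<in> S n")
        case True
        show ?thesis
        proof (cases "y \<in> S n")
          case False
          then have "\<forall>z\<in>gball r y. z \<notin> S n" using xy(2) by (simp add: SS)
          then show ?thesis using True gball_sym[OF xy(3)] by blast
        qed (use Suc True xy(3) in \<open>auto simp: separated_def\<close>)
      next
        case False
        then have x: "x \<in> A n" "\<forall>z\<in>gball r x. z \<notin> S n" using xy(1) by (auto simp: SS)
        then have "y \<in> A n" using xy(2,3) by (auto simp: SS)
        then show ?thesis using x(1) xy(3) A(2) by (auto simp: separated_def)
      qed
    qed
  qed (simp add: S0 separated_def)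
  have mono: "S m \<subseteq> S n" if "m \<le> n" for m n
    by (rule lift_Suc_mono_le[OF _ that]) (simp add: SS)
  define I where "I = (\<Union>n. S n)"
  have "I \<in> sets M" unfolding I_def using SM by blast
  moreover have "I \<subseteq> W" unfolding I_def using SW by blast
  moreover have "separated r I"
    unfolding separated_def
  proof (intro ballI impI)
    fix x y assume xy: "x \<in> I" "y \<in> I" "y \<in> gball r x"
    obtain m n where "x \<in> S m" "y \<in> S n" using xy by (auto simp: I_def)
    then have "x \<in> S (max m n)" "y \<in> S (max m n)" using mono[of m "max m n"] mono[of n "max m n"] by auto
    then show "y = x" using sep[of "max m n"] xy(3) by (auto simp: separated_def)
  qed
  moreover have "\<forall>x\<in>W. \<exists>y\<in>I. y \<in> gball r x"
  proof
    fix x assume x: "x \<in> W"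
    then have xM: "x \<in> space M" using sets.sets_into_space[OF W] by blast
    then obtain n where "x \<in> A n" using A(3) by blast
    then have "x \<in> S (Suc n) \<or> (\<exists>y\<in>gball r x. y \<in> S n)" using x xM by (auto simp: SS)
    then show "\<exists>y\<in>I. y \<in> gball r x" unfolding I_def using gball_centre by blast
  qed
  ultimately show ?thesis by (rule that)
qed

text \<open>Maximal separated sets are removed one after another. The ball of a point left after
  \<open>J\<close> rounds would contain a point of each of the \<open>J\<close> disjoint sets and
  the point itself.\<close>

lemma finite_separated_cover:
  assumes J: "\<And>x. x \<in> space M \<Longrightarrow> card (gball r x) \<le> J"
  obtains I :: "nat \<Rightarrow> 'a set"
  where "\<forall>k. I k \<in> sets M" "\<forall>k. separated r (I k)" "space M \<subseteq> (\<Union>k<J. I k)"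
proof -
  have "\<forall>W. \<exists>I. W \<in> sets M \<longrightarrow> I \<in> sets M \<and> I \<subseteq> W \<and> separated r I \<and> (\<forall>x\<in>W. \<exists>y\<in>I. y \<in> gball r x)"
    using maximal_separated_set by metis
  then obtain mis where mis: "\<forall>W. W \<in> sets M \<longrightarrow> mis W \<in> sets M \<and> mis W \<subseteq> W \<and> separated r (mis W) \<and>
      (\<forall>x\<in>W. \<exists>y\<in>mis W. y \<in> gball r x)"
    by (rule choice[THEN exE])
  define W where "W = rec_nat (space M) (\<lambda>k W. W - mis W)"
  define I where "I k = mis (W k)" for k
  have W0: "W 0 = space M" and WS: "W (Suc k) = W k - I k" for k by (simp_all add: W_def I_def)
  have WM: "W k \<in> sets M" for k
    by (induction k) (use mis in \<open>auto simp: W0 WS I_def\<close>)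
  have I: "I k \<in> sets M" "I k \<subseteq> W k" "separated r (I k)" "x \<in> W k \<Longrightarrow> \<exists>y\<in>I k. y \<in> gball r x" for k x
    using mis WM[of k] by (auto simp: I_def)
  have Wmono: "W n \<subseteq> W m" if "m \<le> n" for m n
    by (rule lift_Suc_antimono_le[OF _ that]) (auto simp: WS)
  have disj: "m = n" if "y \<in> I m" "y \<in> I n" for y m n
  proof -
    have "\<not> m < n" if "y \<in> I m" "y \<in> I n" for m n
      using that I(2)[of n] Wmono[of "Suc m" n] by (auto simp: WS Suc_le_eq)
    then show ?thesis using that by (metis linorder_neqE_nat)
  qed
  have "space M \<subseteq> (\<Union>k<J. I k)"
  proof
    fix x assume x: "x \<in> space M"
    show "x \<in> (\<Union>k<J. I k)"
    proof (rule ccontr)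
      assume n: "x \<notin> (\<Union>k<J. I k)"
      have "x \<in> W k" if "k \<le> J" for k
        using that by (induction k) (use x n in \<open>auto simp: W0 WS\<close>)
      then have "\<forall>k\<in>{..<J}. \<exists>y. y \<in> I k \<and> y \<in> gball r x" using I(4) by (meson less_imp_le lessThan_iff)
      then obtain y where y: "\<forall>k\<in>{..<J}. y k \<in> I k \<and> y k \<in> gball r x" by (rule bchoice[THEN exE])
      have "inj_on y {..<J}" using y disj by (intro inj_onI) metis
      moreover have "y ` {..<J} \<subseteq> gball r x - {x}" using y n by auto
      ultimately have "card {..<J} \<le> card (gball r x - {x})" by (intro card_inj_on_le) auto
      also have "\<dots> < card (gball r x)" by (intro card_Diff1_less) auto
      finally show False using J[OF x] by simp
    qed
  qed
  then show ?thesis using that[of I] I by blast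
qed

section \<open>Codes of finite recolorings and a single Borel stage\<close>

type_synonym code = "(nat list \<times> nat list \<times> nat) list"

text \<open>A code names edges by words relative to the centre \<open>x\<close>, so that countably
  many codes serve all centres. It can only assign colors, which suffices because a completed
  modification leaves no colored edge uncolored.\<close>

primrec patch :: "('a set \<Rightarrow> nat option) \<Rightarrow> 'a \<Rightarrow> code \<Rightarrow> 'a set \<Rightarrow> nat option" where
  "patch \<phi> x [] e = \<phi> e"
| "patch \<phi> x (t # a) e =
     (if e = {g (fst t) x, g (fst (snd t)) x} then Some (snd (snd t)) else patch \<phi> x a e)"

text \<open>Measurability is demanded for edges between two words at \<open>x\<close>, as a
  condition on the single vertex \<open>x\<close>. In this form it survives patching;
  \<open>borel_pcol_imp_coloring\<close> turns it into Borel color classes.\<close>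

definition borel_pcol :: "('a set \<Rightarrow> nat option) \<Rightarrow> bool" where
  "borel_pcol \<phi> \<longleftrightarrow> pcol \<phi> \<and> (\<forall>w w' i. Measurable.pred M (\<lambda>x. \<phi> {g w x, g w' x} = Some i))"

lemma patch_changed: "patch \<phi> x a e \<noteq> \<phi> e \<Longrightarrow> \<exists>w w'. e = {g w x, g w' x}"
  by (induction a) (auto split: if_splits)

lemma patch_eqI:
  assumes "\<And>w w' i. (w, w', i) \<in> set a \<Longrightarrow> \<psi> {g w x, g w' x} = Some i"
    and "\<And>e. \<psi> e \<noteq> \<phi> e \<Longrightarrow> \<exists>w w' i. (w, w', i) \<in> set a \<and> e = {g w x, g w' x}"
  shows "patch \<phi> x a = \<psi>"
proof
  fix e
  have "patch \<phi> x b e = (if \<exists>t\<in>set b. e = {g (fst t) x, g (fst (snd t)) x} then \<psi> e else \<phi> e)"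
    if "set b \<subseteq> set a" for b
    using that assms(1) by (induction b) auto
  from this[of a] show "patch \<phi> x a e = \<psi> e" using assms(2)[of e] by force
qed

lemma doubleton_eq_measurable [measurable (raw)]:
  assumes [measurable]: "a \<in> measurable N M" "b \<in> measurable N M" "a' \<in> measurable N M" "b' \<in> measurable N M"
  shows "Measurable.pred N (\<lambda>x. {a x, b x} = {a' x, b' x})"
  unfolding doubleton_eq_iff by measurable

lemma patch_measurable:
  assumes "borel_pcol \<phi>"
  shows "Measurable.pred M (\<lambda>x. patch \<phi> (g v x) a {g w x, g w' x} = Some i)"
proof (induction a)
  case Nil
  then show ?case using assms by (simp add: borel_pcol_def)
next
  case (Cons t a)
  note Cons [measurable]
  have [measurable]: "(\<lambda>x. g u (g v x)) \<in> measurable M M" for u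
    using measurable_compose[OF g_measurable g_measurable] .
  have "patch \<phi> (g v x) (t # a) {g w x, g w' x} = Some i \<longleftrightarrow>
      ({g w x, g w' x} = {g (fst t) (g v x), g (fst (snd t)) (g v x)} \<and> snd (snd t) = i) \<or>
      (\<not> {g w x, g w' x} = {g (fst t) (g v x), g (fst (snd t)) (g v x)} \<and>
        patch \<phi> (g v x) a {g w x, g w' x} = Some i)" for x by simp
  then show ?case by (simp only:) measurable
qed

text \<open>The conclusions of \<open>validD\<close>, phrased with quantifiers over words and colors
  only, so that they are Borel in \<open>x\<close>.\<close>

definition valid :: "nat \<Rightarrow> ('a set \<Rightarrow> nat option) \<Rightarrow> 'a \<Rightarrow> code \<Rightarrow> bool" where
  "valid R \<phi> x a \<longleftrightarrow>
    (\<forall>w w' i. patch \<phi> x a {g w x, g w' x} = Some i \<longrightarrow> {g w x, g w' x} \<in> E \<and> i \<le> d) \<and>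
    (\<forall>w w' w'' i. patch \<phi> x a {g w x, g w' x} = Some i \<longrightarrow> patch \<phi> x a {g w x, g w'' x} = Some i \<longrightarrow>
      g w' x = g w'' x) \<and>
    (\<forall>w w' i. \<phi> {g w x, g w' x} = Some i \<longrightarrow> (\<exists>j. patch \<phi> x a {g w x, g w' x} = Some j)) \<and>
    (\<forall>w. {x, g w x} \<in> E \<longrightarrow> (\<exists>j. patch \<phi> x a {x, g w x} = Some j)) \<and>
    (\<forall>w w'. (\<forall>i. patch \<phi> x a {g w x, g w' x} = Some i \<longleftrightarrow> \<phi> {g w x, g w' x} = Some i) \<or>
      g w x \<in> gball R x \<and> g w' x \<in> gball R x)"

lemma valid_measurable:
  assumes "borel_pcol \<phi>"
  shows "Measurable.pred M (\<lambda>x. valid R \<phi> (g v x) a)"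
proof -
  have [measurable]: "Measurable.pred M (\<lambda>x. patch \<phi> (g v x) a {g w (g v x), g w' (g v x)} = Some i)" for w w' i
    using patch_measurable[OF assms, of v a "w @ v" "w' @ v" i] by (simp add: g_append)
  have [measurable]: "Measurable.pred M (\<lambda>x. patch \<phi> (g v x) a {g v x, g w' (g v x)} = Some i)" for w' i
    using patch_measurable[OF assms, of v a v "w' @ v" i] by (simp add: g_append)
  have [measurable]: "Measurable.pred M (\<lambda>x. \<phi> {g w (g v x), g w' (g v x)} = Some i)" for w w' i
  proof -
    have "Measurable.pred M (\<lambda>x. \<phi> {g (w @ v) x, g (w' @ v) x} = Some i)"
      using assms unfolding borel_pcol_def by blast
    then show ?thesis by (simp add: g_append)
  qed
  have [measurable]: "(\<lambda>x. g u (g v x)) \<in> measurable M M" for u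
    using measurable_compose[OF g_measurable g_measurable] .
  show ?thesis unfolding valid_def by measurable
qed

text \<open>\<open>valid\<close> sees only vertices \<open>g w x\<close>. This is enough: every
  changed edge joins two of them, and by \<open>f_cover\<close> so does every edge that shares an
  endpoint with a changed one.\<close>

lemma validD:
  assumes "valid R \<phi> x a" "pcol \<phi>"
  shows "pcol (patch \<phi> x a)" "dom \<phi> \<subseteq> dom (patch \<phi> x a)"
    "\<And>u. {x, u} \<in> E \<Longrightarrow> {x, u} \<in> dom (patch \<phi> x a)"
    "\<And>e. patch \<phi> x a e \<noteq> \<phi> e \<Longrightarrow> e \<subseteq> gball R x"
proof -
  let ?p = "patch \<phi> x a"
  have v: "\<And>w w' i. ?p {g w x, g w' x} = Some i \<Longrightarrow> {g w x, g w' x} \<in> E \<and> i \<le> d"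
    "\<And>w w' w'' i. ?p {g w x, g w' x} = Some i \<Longrightarrow> ?p {g w x, g w'' x} = Some i \<Longrightarrow> g w' x = g w'' x"
    "\<And>w w' i. \<phi> {g w x, g w' x} = Some i \<Longrightarrow> \<exists>j. ?p {g w x, g w' x} = Some j"
    "\<And>w. {x, g w x} \<in> E \<Longrightarrow> \<exists>j. ?p {x, g w x} = Some j"
    "\<And>w w'. (\<forall>i. ?p {g w x, g w' x} = Some i \<longleftrightarrow> \<phi> {g w x, g w' x} = Some i) \<or>
      g w x \<in> gball R x \<and> g w' x \<in> gball R x"
    using assms(1) unfolding valid_def by meson+
  have E: "?p e = Some i \<Longrightarrow> e \<in> E \<and> i \<le> d" for e i
  proof (cases "?p e = \<phi> e")
    case True
    moreover assume "?p e = Some i"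
    ultimately have "\<phi> e = Some i" by simp
    then show ?thesis using pcol_edge[OF assms(2)] pcol_le[OF assms(2)] by blast
  next
    case False
    moreover assume "?p e = Some i"
    ultimately show ?thesis using patch_changed[of \<phi> x a e] v(1) by auto
  qed
  have uniq: "y = z" if a: "?p {u, y} = Some i" "?p {u, z} = Some i" "?p {u, y} \<noteq> \<phi> {u, y}" for u y z i
  proof -
    obtain w w' where "{u, y} = {g w x, g w' x}" using patch_changed[OF a(3)] by blast
    then obtain w w' where w: "u = g w x" "y = g w' x" by (auto simp: doubleton_eq_iff)
    obtain k where "z = f k u" using f_cover[of u z] E[OF a(2)] by blast
    then have "z = g (k # w) x" using w by simp
    then show ?thesis using v(2)[of w w' i "k # w"] a(1,2) w by simp
  qed
  have "y = z" if "?p {u, y} = Some i" "?p {u, z} = Some i" for u y z i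
  proof (cases "?p {u, y} = \<phi> {u, y} \<and> ?p {u, z} = \<phi> {u, z}")
    case True
    then have "\<phi> {u, y} = Some i" "\<phi> {u, z} = Some i" using that by auto
    then show ?thesis by (rule pcol_unique[OF assms(2)])
  next
    case False
    then show ?thesis using uniq[OF that] uniq[OF that(2,1)] by metis
  qed
  then show "pcol ?p" unfolding pcol_def using E by blast
  show "dom \<phi> \<subseteq> dom ?p"
  proof
    fix e assume "e \<in> dom \<phi>"
    then obtain i where i: "\<phi> e = Some i" by blast
    show "e \<in> dom ?p"
    proof (cases "?p e = \<phi> e")
      case False
      then obtain w w' where "e = {g w x, g w' x}" using patch_changed by blast
      then show ?thesis using v(3) i by blast
    qed (use i in auto)
  qed
  show "{x, u} \<in> dom ?p" if xu: "{x, u} \<in> E" for u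
  proof -
    obtain k where "u = f k x" using f_cover[OF xu] by blast
    then have "u = g [k] x" by simp
    then show ?thesis using v(4)[of "[k]"] xu by auto
  qed
  show "e \<subseteq> gball R x" if c: "?p e \<noteq> \<phi> e" for e
  proof -
    obtain w w' where e: "e = {g w x, g w' x}" using patch_changed[OF c] by blast
    have "\<not> (\<forall>i. ?p e = Some i \<longleftrightarrow> \<phi> e = Some i)" using c by (metis not_Some_eq)
    then show ?thesis using v(5)[of w w'] unfolding e by auto
  qed
qed

text \<open>The two colorings differ on finitely many edges, all inside the ball and all colored by
  \<open>\<psi>\<close>, so a finite code lists the differences.\<close>

lemma valid_ex:
  assumes \<psi>: "pcol \<psi>" "dom \<phi> \<subseteq> dom \<psi>" "\<forall>u\<in>nbrs x. {x, u} \<in> dom \<psi>" "\<forall>e. \<psi> e \<noteq> \<phi> e \<longrightarrow> e \<subseteq> gball R x"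
  obtains a where "valid R \<phi> x a"
proof -
  define D where "D = {e. \<psi> e \<noteq> \<phi> e}"
  have "finite D" by (rule finite_subset[of _ "Pow (gball R x)"]) (use \<psi>(4) in \<open>auto simp: D_def\<close>)
  have "\<forall>e\<in>D. \<exists>t. e = {g (fst t) x, g (fst (snd t)) x} \<and> \<psi> e = Some (snd (snd t))"
  proof
    fix e assume e: "e \<in> D"
    have "e \<in> dom \<psi>"
    proof (cases "\<phi> e")
      case None
      then show ?thesis using e by (auto simp: D_def)
    qed (use \<psi>(2) in blast)
    then obtain i where i: "\<psi> e = Some i" by blast
    then obtain p q where pq: "e = {p, q}" using pcol_edge[OF \<psi>(1)] edgeE' by blast
    have "p \<in> gball R x" "q \<in> gball R x" using \<psi>(4) e pq by (auto simp: D_def)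
    then obtain w w' where "p = g w x" "q = g w' x" unfolding gball_iff_word by blast
    then show "\<exists>t. e = {g (fst t) x, g (fst (snd t)) x} \<and> \<psi> e = Some (snd (snd t))"
      using i pq by (intro exI[of _ "(w, w', i)"]) simp
  qed
  then obtain t where t: "\<forall>e\<in>D. e = {g (fst (t e)) x, g (fst (snd (t e))) x} \<and> \<psi> e = Some (snd (snd (t e)))"
    by (rule bchoice[THEN exE])
  obtain a where a: "set a = t ` D" using finite_list[of "t ` D"] \<open>finite D\<close> by auto
  have p: "patch \<phi> x a = \<psi>"
  proof (rule patch_eqI)
    fix w w' i assume "(w, w', i) \<in> set a"
    then obtain e where "e \<in> D" "t e = (w, w', i)" unfolding a by auto
    then show "\<psi> {g w x, g w' x} = Some i" using t by fastforce
  next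
    fix e assume "\<psi> e \<noteq> \<phi> e"
    then have "e \<in> D" by (simp add: D_def)
    then show "\<exists>w w' i. (w, w', i) \<in> set a \<and> e = {g w x, g w' x}"
      using t a by (metis image_eqI prod.collapse)
  qed
  have "valid R \<phi> x a"
    unfolding valid_def p
  proof (intro conjI allI impI)
    fix w w' w'' i
    show "{g w x, g w' x} \<in> E" "i \<le> d" if "\<psi> {g w x, g w' x} = Some i"
      using that \<psi>(1) by (auto simp: pcol_def)
    show "g w' x = g w'' x" if "\<psi> {g w x, g w' x} = Some i" "\<psi> {g w x, g w'' x} = Some i"
      using pcol_unique[OF \<psi>(1) that] .
    show "\<exists>j. \<psi> {g w x, g w' x} = Some j" if "\<phi> {g w x, g w' x} = Some i"
      using \<psi>(2) that by blast
    show "\<exists>j. \<psi> {x, g w x} = Some j" if "{x, g w x} \<in> E"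
      using \<psi>(3) that by (auto simp: mem_nbrs)
    show "(\<forall>i. \<psi> {g w x, g w' x} = Some i \<longleftrightarrow> \<phi> {g w x, g w' x} = Some i) \<or>
        g w x \<in> gball R x \<and> g w' x \<in> gball R x"
      using \<psi>(4)[rule_format, of "{g w x, g w' x}"]
      by (cases "\<psi> {g w x, g w' x} = \<phi> {g w x, g w' x}") auto
  qed
  then show ?thesis by (rule that)
qed

text \<open>Balls of radius \<open>R\<close> around the points of a \<open>2 R\<close>-separated set are disjoint, so the least valid
  code can be applied at all of them simultaneously.\<close>

lemma borel_stage:
  assumes \<phi>: "borel_pcol \<phi>" and I: "I \<in> sets M" "separated (2 * R) I"
    and R: "\<And>x. \<exists>\<psi>. pcol \<psi> \<and> dom \<phi> \<subseteq> dom \<psi> \<and> (\<forall>u\<in>nbrs x. {x, u} \<in> dom \<psi>) \<and>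
      (\<forall>e. \<psi> e \<noteq> \<phi> e \<longrightarrow> e \<subseteq> gball R x)"
  obtains \<phi>' where "borel_pcol \<phi>'" "dom \<phi> \<subseteq> dom \<phi>'" "\<forall>x\<in>I. \<forall>u\<in>nbrs x. {x, u} \<in> dom \<phi>'"
proof -
  have p\<phi>: "pcol \<phi>" using \<phi> by (simp add: borel_pcol_def)
  define code where "code x = (LEAST n. valid R \<phi> x (from_nat n))" for x
  define p where "p x = patch \<phi> x (from_nat (code x))" for x
  have "\<exists>n. valid R \<phi> x (from_nat n)" for x
  proof -
    obtain a where "valid R \<phi> x a" using R[of x] valid_ex by meson
    then show ?thesis by (intro exI[of _ "to_nat a"]) simp
  qed
  then have v: "valid R \<phi> x (from_nat (code x))" for x
    unfolding code_def by (rule LeastI_ex)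
  have p: "pcol (p x)" "dom \<phi> \<subseteq> dom (p x)" "{x, u} \<in> E \<Longrightarrow> {x, u} \<in> dom (p x)"
    "p x e \<noteq> \<phi> e \<Longrightarrow> e \<subseteq> gball R x" for x u e
    using validD[OF v p\<phi>] unfolding p_def by blast+
  have same: "x = x'" if "x \<in> I" "x' \<in> I" "y \<in> gball R x" "y \<in> gball R x'" for x x' y
  proof -
    have "x' \<in> gball (R + R) x" using gball_trans[OF that(3) gball_sym[OF that(4)]] .
    then show ?thesis using I(2) that(1,2) unfolding separated_def by (metis mult_2)
  qed
  \<comment> \<open>The balls around the points of \<open>I\<close> are disjoint, so at most one of
    them changes a given edge and the choice is unambiguous.\<close>
  define \<phi>' where "\<phi>' e = (if \<exists>x\<in>I. p x e \<noteq> \<phi> e then p (SOME x. x \<in> I \<and> p x e \<noteq> \<phi> e) e else \<phi> e)" for e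
  have near: "\<phi>' {y, z} = p x {y, z}" if x: "x \<in> I" "y \<in> gball R x" for x y z
  proof (cases "\<exists>x\<in>I. p x {y, z} \<noteq> \<phi> {y, z}")
    case True
    then have "\<exists>x. x \<in> I \<and> p x {y, z} \<noteq> \<phi> {y, z}" by blast
    then have s: "(SOME x. x \<in> I \<and> p x {y, z} \<noteq> \<phi> {y, z}) \<in> I \<and>
        p (SOME x. x \<in> I \<and> p x {y, z} \<noteq> \<phi> {y, z}) {y, z} \<noteq> \<phi> {y, z}" (is "?s \<in> I \<and> _")
      by (rule someI_ex)
    then have "y \<in> gball R ?s" using p(4) by blast
    then have "?s = x" using same s x by blast
    then show ?thesis using True by (simp add: \<phi>'_def)
  next
    case False
    then show ?thesis using x by (simp add: \<phi>'_def)
  qed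
  have far: "\<phi>' {y, z} = \<phi> {y, z}" if "\<And>x. x \<in> I \<Longrightarrow> y \<notin> gball R x" for y z
    using that p(4) unfolding \<phi>'_def by auto
  have pcol': "pcol \<phi>'"
  proof -
    have "e \<in> E \<and> i \<le> d" if "\<phi>' e = Some i" for e i
      using that p\<phi> p(1) unfolding \<phi>'_def pcol_def by (auto split: if_splits)
    moreover have "a = b" if "\<phi>' {y, a} = Some i" "\<phi>' {y, b} = Some i" for y a b i
    proof (cases "\<exists>x\<in>I. y \<in> gball R x")
      case True
      then obtain x where "x \<in> I" "y \<in> gball R x" by blast
      then show ?thesis using near that pcol_unique[OF p(1), of x y a i b] by simp
    next
      case False
      then show ?thesis using far that pcol_unique[OF p\<phi>, of y a i b] by simp
    qed
    ultimately show ?thesis unfolding pcol_def by blast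
  qed
  have "Measurable.pred M (\<lambda>x. \<phi>' {g w x, g w' x} = Some i)" for w w' i
  proof -
    \<comment> \<open>Expresses \<open>n = code y\<close> by countably many conditions whose
      measurability is known.\<close>
    define least where "least y n \<longleftrightarrow>
      valid R \<phi> y (from_nat n) \<and> (\<forall>m. m < n \<longrightarrow> \<not> valid R \<phi> y (from_nat m))" for y n
    have least: "least y n \<longleftrightarrow> n = code y" for y n
    proof
      assume *: "least y n"
      show "n = code y"
      proof (rule antisym)
        show "n \<le> code y"
        proof (rule ccontr)
          assume "\<not> n \<le> code y"
          then show False using * v[of y] unfolding least_def by simp
        qed
        have "valid R \<phi> y (from_nat n)" using * by (simp add: least_def)
        then show "code y \<le> n" unfolding code_def by (rule Least_le)
      qed
    next
      assume n: "n = code y"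
      show "least y n"
        unfolding least_def n
      proof (intro conjI allI impI)
        show "valid R \<phi> y (from_nat (code y))" by (rule v)
        show "\<not> valid R \<phi> y (from_nat m)" if "m < code y" for m
          using that unfolding code_def by (rule not_less_Least)
      qed
    qed
    \<comment> \<open>A centre whose ball contains \<open>g w x\<close> is itself of the form
      \<open>g v x\<close>, so the search for it is a countable disjunction in
      \<open>x\<close>.\<close>
    have eq: "\<phi>' {g w x, g w' x} = Some i \<longleftrightarrow>
      (\<exists>v. g v x \<in> I \<and> g w x \<in> gball R (g v x) \<and>
        (\<exists>n. least (g v x) n \<and> patch \<phi> (g v x) (from_nat n) {g w x, g w' x} = Some i)) \<or>
      (\<forall>v. g v x \<in> I \<longrightarrow> g w x \<notin> gball R (g v x)) \<and> \<phi> {g w x, g w' x} = Some i" (is "_ \<longleftrightarrow> ?A x \<or> ?B x") for x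
    proof -
      have A: "?A x \<longleftrightarrow> (\<exists>v. g v x \<in> I \<and> g w x \<in> gball R (g v x) \<and> p (g v x) {g w x, g w' x} = Some i)"
        unfolding least p_def by simp
      show ?thesis
      proof (cases "\<exists>y\<in>I. g w x \<in> gball R y")
        case True
        then obtain y where y: "y \<in> I" "g w x \<in> gball R y" by blast
        obtain u where u: "y = g u (g w x)" using gball_word[OF gball_sym[OF y(2)]] by blast
        then have yv: "y = g (u @ w) x" by (simp add: g_append)
        have "?A x \<longleftrightarrow> p y {g w x, g w' x} = Some i"
          unfolding A using y yv same[OF y(1) _ y(2)] by metis
        moreover have "\<not> ?B x" using y yv by blast
        ultimately show ?thesis unfolding near[OF y] by (simp only: simp_thms)
      next
        case False
        then have "\<phi>' {g w x, g w' x} = \<phi> {g w x, g w' x}" using far by blast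
        moreover have "\<not> ?A x" using False by blast
        ultimately show ?thesis using False by auto
      qed
    qed
    have [measurable]: "Measurable.pred M (\<lambda>x. valid R \<phi> (g v x) (from_nat n))" for v n
      by (rule valid_measurable[OF \<phi>])
    have [measurable]: "Measurable.pred M (\<lambda>x. patch \<phi> (g v x) (from_nat n) {g w x, g w' x} = Some i)" for v n
      by (rule patch_measurable[OF \<phi>])
    have [measurable]: "Measurable.pred M (\<lambda>x. \<phi> {g w x, g w' x} = Some i)"
      using \<phi> by (simp add: borel_pcol_def)
    have [measurable]: "Measurable.pred M (\<lambda>x. g v x \<in> I)" for v
      using measurable_compose[OF g_measurable, of "\<lambda>x. x \<in> I"] I(1) by simp
    show ?thesis unfolding eq least_def by measurable
  qed
  then have "borel_pcol \<phi>'" using pcol' by (simp add: borel_pcol_def)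
  moreover have "dom \<phi> \<subseteq> dom \<phi>'"
  proof
    fix e assume e: "e \<in> dom \<phi>"
    then have "e \<in> dom (p x)" for x using p(2) by blast
    then show "e \<in> dom \<phi>'" using e unfolding \<phi>'_def by (auto simp: domIff)
  qed
  moreover have "\<forall>x\<in>I. \<forall>u\<in>nbrs x. {x, u} \<in> dom \<phi>'"
    using near[OF _ gball_centre] p(3) by (simp add: mem_nbrs domIff)
  ultimately show ?thesis by (rule that)
qed

lemma ex_borel_pcol:
  assumes "subexponential h" "\<And>n x. x \<in> space M \<Longrightarrow> card (gball n x) \<le> h n"
  obtains \<phi> where "borel_pcol \<phi>" "dom \<phi> = E"
proof -
  have "card (gball n x) \<le> h n" if "x \<in> \<Union>E" for n x
    using that assms(2) E_space by blast
  then obtain R where R: "\<And>\<phi> x. pcol \<phi> \<Longrightarrow>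
    \<exists>\<psi>. pcol \<psi> \<and> dom \<phi> \<subseteq> dom \<psi> \<and> (\<forall>u\<in>nbrs x. {x, u} \<in> dom \<psi>) \<and> (\<forall>e. \<psi> e \<noteq> \<phi> e \<longrightarrow> e \<subseteq> gball R x)"
    using local_completion[OF assms(1)] by metis
  obtain I where I: "\<forall>k. I k \<in> sets M" "\<forall>k. separated (2 * R) (I k)" "space M \<subseteq> (\<Union>k<h (2 * R). I k)"
    using finite_separated_cover[OF assms(2), of "2 * R"] by metis
  have "\<exists>\<phi>. borel_pcol \<phi> \<and> (\<forall>k<n. \<forall>x\<in>I k. \<forall>u\<in>nbrs x. {x, u} \<in> dom \<phi>)" for n
  proof (induction n)
    case 0
    have "borel_pcol (\<lambda>_. None)" by (simp add: borel_pcol_def pcol_def)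
    then show ?case by blast
  next
    case (Suc n)
    then obtain \<phi> where \<phi>: "borel_pcol \<phi>" "\<forall>k<n. \<forall>x\<in>I k. \<forall>u\<in>nbrs x. {x, u} \<in> dom \<phi>" by blast
    have "pcol \<phi>" using \<phi>(1) by (simp add: borel_pcol_def)
    obtain \<phi>' where \<phi>': "borel_pcol \<phi>'" "dom \<phi> \<subseteq> dom \<phi>'" "\<forall>x\<in>I n. \<forall>u\<in>nbrs x. {x, u} \<in> dom \<phi>'"
      using borel_stage[OF \<phi>(1) I(1)[rule_format] I(2)[rule_format] R[OF \<open>pcol \<phi>\<close>]] by metis
    have "\<forall>k<Suc n. \<forall>x\<in>I k. \<forall>u\<in>nbrs x. {x, u} \<in> dom \<phi>'"
      using \<phi>(2) \<phi>'(2,3) by (metis less_Suc_eq subsetD)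
    then show ?case using \<phi>'(1) by blast
  qed
  then obtain \<phi> where \<phi>: "borel_pcol \<phi>" "\<forall>k<h (2 * R). \<forall>x\<in>I k. \<forall>u\<in>nbrs x. {x, u} \<in> dom \<phi>" by blast
  have "dom \<phi> = E"
  proof
    show "dom \<phi> \<subseteq> E" using \<phi>(1) pcol_edge by (auto simp: borel_pcol_def)
    show "E \<subseteq> dom \<phi>"
    proof
      fix e assume e: "e \<in> E"
      obtain x u where xu: "e = {x, u}" using edgeE'[OF e] by blast
      then obtain k where "k < h (2 * R)" "x \<in> I k" using I(3) E_space[OF e] by auto
      then show "e \<in> dom \<phi>" using \<phi>(2) e unfolding xu by (simp add: mem_nbrs)
    qed
  qed
  then show ?thesis using that \<phi>(1) by blast
qed

lemma borel_pcol_imp_coloring: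
  assumes \<phi>: "borel_pcol \<phi>" "dom \<phi> = E"
  shows "borel_edge_coloring M E (d + 1) (\<lambda>e. the (\<phi> e))"
proof -
  have p: "pcol \<phi>" using \<phi>(1) by (simp add: borel_pcol_def)
  have some: "\<exists>i. \<phi> e = Some i" if "e \<in> E" for e using that \<phi>(2) by blast
  have "proper_edge_coloring E (d + 1) (\<lambda>e. the (\<phi> e))"
    unfolding proper_edge_coloring_def
  proof (intro conjI ballI impI)
    show "(\<lambda>e. the (\<phi> e)) \<in> E \<rightarrow> {..<d + 1}"
      using some pcol_le[OF p] by (fastforce simp: less_Suc_eq_le)
    fix e e' assume e: "e \<in> E" "e' \<in> E" "e \<noteq> e' \<and> e \<inter> e' \<noteq> {}"
    then obtain v where v: "v \<in> e" "v \<in> e'" by blast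
    obtain a where a: "e = {v, a}" using edgeE'[OF e(1)] v(1) by blast
    obtain b where b: "e' = {v, b}" using edgeE'[OF e(2)] v(2) by blast
    show "the (\<phi> e) \<noteq> the (\<phi> e')"
      using some[OF e(1)] some[OF e(2)] pcol_unique[OF p, of v a _ b] e(3) a b by force
  qed
  moreover have "(\<lambda>e. the (\<phi> e)) -` {i} \<inter> E \<in> sets (restrict_space (pair_sets_space M) E)" for i
  proof -
    define A where "A = (\<lambda>e. the (\<phi> e)) -` {i} \<inter> E"
    have Aiff: "e \<in> A \<longleftrightarrow> \<phi> e = Some i" for e
      using some[of e] pcol_edge[OF p, of e] by (auto simp: A_def)
    have AV: "x \<in> space M \<and> y \<in> space M \<and> x \<noteq> y" if "{x, y} \<in> A" for x y
    proof -
      have "{x, y} \<in> E" using that by (simp add: A_def)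
      then show ?thesis using E_space[of "{x, y}"] no_loop[of x] by auto
    qed
    have A2: "A \<subseteq> nsets (space M) 2"
    proof
      fix e assume e: "e \<in> A"
      then obtain x y where "e = {x, y}" using edgeE'[of e] by (auto simp: A_def)
      then show "e \<in> nsets (space M) 2" using AV[of x y] e by simp
    qed
    \<comment> \<open>\<open>borel_pcol\<close> tests edges between images of one vertex, so a pair
      \<open>(x, y)\<close> is handled through the functions \<open>f n\<close> with
      \<open>y = f n x\<close>.\<close>
    define S where "S = {z \<in> space (M \<Otimes>\<^sub>M M). \<exists>n. f n (fst z) = snd z \<and> \<phi> {fst z, f n (fst z)} = Some i}"
    have S: "S \<in> sets (M \<Otimes>\<^sub>M M)"
    proof -
      have "Measurable.pred M (\<lambda>x. \<phi> {g [] x, g [n] x} = Some i)" for n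
        using \<phi>(1) unfolding borel_pcol_def by blast
      then have [measurable]: "Measurable.pred M (\<lambda>x. \<phi> {x, f n x} = Some i)" for n by simp
      have [measurable]: "Measurable.pred (M \<Otimes>\<^sub>M M) (\<lambda>z. \<phi> {fst z, f n (fst z)} = Some i)" for n
        by (rule measurable_compose[OF measurable_fst]) measurable
      show ?thesis unfolding S_def by measurable
    qed
    have SA: "{(x, y) \<in> space (off_diagonal M). {x, y} \<in> A} = S"
    proof (intro equalityI subsetI)
      fix z assume "z \<in> {(x, y) \<in> space (off_diagonal M). {x, y} \<in> A}"
      then obtain x y where z: "z = (x, y)" "{x, y} \<in> A" by blast
      obtain n where "y = f n x" using f_cover[of x y] z(2) by (auto simp: A_def)
      then show "z \<in> S" using z AV[OF z(2)] by (auto simp: S_def space_pair_measure Aiff)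
    next
      fix z assume "z \<in> S"
      then obtain x y where z: "z = (x, y)" "\<phi> {x, y} = Some i" "x \<in> space M" "y \<in> space M"
        by (auto simp: S_def space_pair_measure)
      then have "{x, y} \<in> A" by (simp add: Aiff)
      then show "z \<in> {(x, y) \<in> space (off_diagonal M). {x, y} \<in> A}"
        using z AV[of x y] by (auto simp: off_diagonal_def space_restrict_space space_pair_measure)
    qed
    have "S \<subseteq> {(x, y). x \<noteq> y}"
      unfolding SA[symmetric] using AV by blast
    then have "S \<in> sets (off_diagonal M)"
      unfolding off_diagonal_def sets_restrict_space using S by (intro image_eqI[of _ _ S]) auto
    then have "{(x, y) \<in> space (off_diagonal M). {x, y} \<in> A} \<in> sets (off_diagonal M)"
      unfolding SA .
    then have "A \<in> sets (pair_sets_space M)"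
      using A2 by (simp add: sets_pair_sets_space)
    then have "A \<in> sets (restrict_space (pair_sets_space M) E)"
      unfolding sets_restrict_space by (intro image_eqI[of _ _ A]) (auto simp: A_def)
    then show ?thesis by (simp add: A_def)
  qed
  ultimately show ?thesis by (simp add: borel_edge_coloring_def)
qed

end

theorem theorem1p6:
  fixes M :: "'a measure" and E :: "'a set set" and \<Delta> :: nat
  assumes "borel_graph M E"
    and "subexponential_growth (space M) E"
    and "max_degree (space M) E = enat \<Delta>"
  shows "borel_chromatic_index M E \<le> enat (\<Delta> + 1) \<and>
         (\<exists>\<phi>. borel_edge_coloring M E (\<Delta> + 1) \<phi>)"
proof -
  have M: "standard_borel_space M" and E: "E \<in> sets (pair_sets_space M)"
    using assms(1) by (auto simp: borel_graph_def)
  have edge: "\<exists>x y. x \<noteq> y \<and> e = {x, y} \<and> x \<in> space M \<and> y \<in> space M" if "e \<in> E" for e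
  proof -
    have "e \<in> nsets (space M) 2" using that E by (auto simp: sets_pair_sets_space)
    then show ?thesis by (metis nsets2_E)
  qed
  have EV: "e \<subseteq> space M" if "e \<in> E" for e using edge[OF that] by auto
  have deg: "finite {u. {x, u} \<in> E} \<and> card {u. {x, u} \<in> E} \<le> \<Delta>" for x
  proof (cases "x \<in> space M")
    case True
    then have "vertex_degree E x \<le> enat \<Delta>"
      using assms(3) unfolding max_degree_def by (metis SUP_upper)
    then show ?thesis by (auto simp: vertex_degree_def Let_def split: if_splits)
  next
    case False
    then have "{u. {x, u} \<in> E} = {}" using EV by blast
    then show ?thesis by simp
  qed
  interpret bounded_graph E \<Delta>
  proof
    show "\<exists>x y. x \<noteq> y \<and> e = {x, y}" if "e \<in> E" for e using edge[OF that] by (elim exE conjE) (intro exI conjI)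
  qed (use deg in simp_all)
  obtain f :: "nat \<Rightarrow> 'a \<Rightarrow> 'a" where f: "\<forall>n. f n \<in> measurable M M" "\<forall>n x. f n x = x \<or> {x, f n x} \<in> E"
    "\<forall>x y. {x, y} \<in> E \<longrightarrow> (\<exists>n. y = f n x)"
    "Measurable.pred (M \<Otimes>\<^sub>M M) (\<lambda>(x, y). {x, y} \<in> E)" "Measurable.pred (M \<Otimes>\<^sub>M M) (\<lambda>(x, y). x = y)"
    by (rule borel_graph_neighbour_functions[OF M E conjunct1[OF deg] conjunct2[OF deg]])
  obtain U :: "nat \<Rightarrow> 'a set" where U: "\<forall>n. U n \<in> sets M"
    "\<forall>x\<in>space M. \<forall>F. finite F \<longrightarrow> F \<subseteq> space M \<longrightarrow> x \<notin> F \<longrightarrow> (\<exists>n. x \<in> U n \<and> F \<inter> U n = {})"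
    by (rule standard_borel_separating_sets[OF M])
  interpret borel_graph_functions E \<Delta> M f U
  proof
    show "\<exists>n. x \<in> U n \<and> F \<inter> U n = {}" if "x \<in> space M" "finite F" "F \<subseteq> space M" "x \<notin> F" for x F
      using U(2) that by simp
  qed (use f U EV in simp_all)
  obtain h where h: "subexponential h" "bounds_growth h (space M) E"
    using assms(2) by (auto simp: subexponential_growth_def)
  have "card (gball n x) \<le> h n" if "x \<in> space M" for n x
  proof -
    have "finite (neighborhood E n x)" "card (neighborhood E n x) \<le> h n"
      using h(2) that by (auto simp: bounds_growth_def)
    then show ?thesis using card_mono[OF _ gball_subset_neighborhood, of n x] by simp
  qed
  then obtain \<phi> where "borel_pcol \<phi>" "dom \<phi> = E" using ex_borel_pcol[OF h(1)] by metis
  then have c: "borel_edge_coloring M E (\<Delta> + 1) (\<lambda>e. the (\<phi> e))" by (rule borel_pcol_imp_coloring)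
  then have "borel_chromatic_index M E \<le> enat (\<Delta> + 1)"
    unfolding borel_chromatic_index_def by (intro Inf_lower) blast
  then show ?thesis using c by blast
qed

end
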